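(* Let $\mathcal{M}$ be a gridding matrix. If some connected component of the graph $G_\mathcal{M}$ contains a cycle, or contains two or more cells whose entries are permutation classes that are not monotone griddable, then the grid class $\mathrm{Grid}(\mathcal{M})$ is not partially well-ordered.
   Context: A permutation $\pi$ of length $n$ is identified with its plot $\{(i,\pi(i))\}$. A permutation $\alpha$ is contained in $\pi$ ($\alpha\le\pi$) if $\pi$ has a subsequence order isomorphic to $\alpha$. A permutation class is a set of permutations closed downward under $\le$. A set of permutations is partially well-ordered if it contains no infinite antichain (infinite set of pairwise incomparable elements). Matrices are indexed from the bottom-left with column index first: an $m\times n$ matrix has $m$ columns and $n$ rows, and $\mathcal{M}_{ij}$ lies in column $i$, row $j$. A gridding matrix is a matrix each of whose entries is a permutation class (an infinite class or the empty class). An $m\times n$ gridding of $\pi$ is a choice of $m-1$ vertical and $n-1$ horizontal lines dividing the plot of $\pi$ into $mn$ cells; $\pi^{ij}$ is the set of points in cell $ij$. An $\mathcal{M}$-gridding of $\pi$ is an $m\times n$ gridding such that each $\pi^{ij}$ is order isomorphic to a permutation in $\mathcal{M}_{ij}$; $\mathrm{Grid}(\mathcal{M})$ is the class of all permutations having an $\mathcal{M}$-gridding. A class $\mathcal{C}$ is monotone griddable if there is a gridding matrix $\mathcal{N}$ with all entries in $\{\mathrm{Av}(21),\mathrm{Av}(12),\emptyset\}$ such that every element of $\mathcal{C}$ has an $\mathcal{N}$-gridding. The graph $G_\mathcal{M}$ has as vertices the non-empty cells of $\mathcal{M}$, two being adjacent if they lie in the same row or the same column and all cells strictly between them are empty.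 *)

theory Defs
  imports Main "HOL-Library.Sublist" "HOL-Combinatorics.Multiset_Permutations"
begin

text \<open>
  A permutation of length \<open>n\<close> is written in one-line notation, as a list of the numbers
  \<open>1, \<dots>, n\<close>; its plot consists of the points \<open>(k + 1, \<pi> ! k)\<close> for \<open>k < n\<close>. The empty
  permutation is included.
\<close>

definition perms :: "nat list set" where
  "perms = (\<Union>n. permutations_of_set {1..n})"

definition order_iso :: "nat list \<Rightarrow> nat list \<Rightarrow> bool" where
  "order_iso xs ys \<longleftrightarrow> length xs = length ys \<and>
     (\<forall>i < length xs. \<forall>j < length xs. xs ! i < xs ! j \<longleftrightarrow> ys ! i < ys ! j)"

definition contained :: "nat list \<Rightarrow> nat list \<Rightarrow> bool" (infix "\<preceq>" 50) where
  "\<alpha> \<preceq> \<pi> \<longleftrightarrow> (\<exists>\<sigma>. subseq \<sigma> \<pi> \<and> order_iso \<sigma> \<alpha>)"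

definition perm_class :: "nat list set \<Rightarrow> bool" where
  "perm_class C \<longleftrightarrow> C \<subseteq> perms \<and> (\<forall>\<pi> \<in> C. \<forall>\<alpha> \<in> perms. \<alpha> \<preceq> \<pi> \<longrightarrow> \<alpha> \<in> C)"

definition Av :: "nat list \<Rightarrow> nat list set" where
  "Av \<beta> = {\<pi> \<in> perms. \<not> \<beta> \<preceq> \<pi>}"

definition antichain :: "nat list set \<Rightarrow> bool" where
  "antichain A \<longleftrightarrow> (\<forall>\<alpha> \<in> A. \<forall>\<beta> \<in> A. \<alpha> \<noteq> \<beta> \<longrightarrow> \<not> \<alpha> \<preceq> \<beta>)"

definition partially_well_ordered :: "nat list set \<Rightarrow> bool" where
  "partially_well_ordered X \<longleftrightarrow> \<not> (\<exists>A \<subseteq> X. infinite A \<and> antichain A)"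


text \<open>
  An \<open>m \<times> n\<close> matrix has \<open>m\<close> columns and \<open>n\<close> rows; \<open>M i j\<close> is the entry in column \<open>i\<close> (from the
  left) and row \<open>j\<close> (from the bottom), where \<open>i < m\<close> and \<open>j < n\<close>, so indices start at \<open>0\<close>. The
  empty class is the empty set \<open>{}\<close>, without the empty permutation.
\<close>

type_synonym class_matrix = "nat \<Rightarrow> nat \<Rightarrow> nat list set"

definition gridding_matrix :: "nat \<Rightarrow> nat \<Rightarrow> class_matrix \<Rightarrow> bool" where
  "gridding_matrix m n M \<longleftrightarrow> 0 < m \<and> 0 < n \<and>
     (\<forall>i < m. \<forall>j < n. perm_class (M i j) \<and> (infinite (M i j) \<or> M i j = {}))"

text \<open>
  Only the gap between consecutive points in which a line lies is relevant. The \<open>m - 1\<close> vertical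
  lines are \<open>c 1 \<le> \<dots> \<le> c (m - 1)\<close>, where \<open>c i\<close> is the number of points to the left of the line
  (the line is at \<open>x = c i + 1 / 2\<close>, say); \<open>c 0\<close> and \<open>c m\<close> are the borders of the plot. Likewise
  \<open>r j\<close> is the number of points below the \<open>j\<close>-th horizontal line. Several lines may lie in the
  same gap, so cells, rows and columns may be empty of points.
\<close>

definition gridding :: "nat \<Rightarrow> nat \<Rightarrow> nat list \<Rightarrow> (nat \<Rightarrow> nat) \<Rightarrow> (nat \<Rightarrow> nat) \<Rightarrow> bool" where
  "gridding m n \<pi> c r \<longleftrightarrow>
     c 0 = 0 \<and> c m = length \<pi> \<and> (\<forall>i < m. c i \<le> c (Suc i)) \<and>
     r 0 = 0 \<and> r n = length \<pi> \<and> (\<forall>j < n. r j \<le> r (Suc j))"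

text \<open>
  The points of a cell, read from left to right. The point \<open>(k + 1, \<pi> ! k)\<close> is in column \<open>i\<close> iff
  \<open>c i < k + 1 \<le> c (i + 1)\<close>.
\<close>

definition cell :: "nat list \<Rightarrow> (nat \<Rightarrow> nat) \<Rightarrow> (nat \<Rightarrow> nat) \<Rightarrow> nat \<Rightarrow> nat \<Rightarrow> nat list" where
  "cell \<pi> c r i j =
     nths \<pi> {k. k < length \<pi> \<and> c i < k + 1 \<and> k + 1 \<le> c (i + 1) \<and>
                r j < \<pi> ! k \<and> \<pi> ! k \<le> r (j + 1)}"

text \<open>
  A cell without points is always allowed. This matters only for the entry \<open>{}\<close>, since every
  non-empty class contains the empty permutation.
\<close>

definition matrix_gridding ::
  "nat \<Rightarrow> nat \<Rightarrow> class_matrix \<Rightarrow> nat list \<Rightarrow> (nat \<Rightarrow> nat) \<Rightarrow> (nat \<Rightarrow> nat) \<Rightarrow> bool" where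
  "matrix_gridding m n M \<pi> c r \<longleftrightarrow> gridding m n \<pi> c r \<and>
     (\<forall>i < m. \<forall>j < n. cell \<pi> c r i j = [] \<or> (\<exists>\<sigma> \<in> M i j. order_iso (cell \<pi> c r i j) \<sigma>))"

definition Grid :: "nat \<Rightarrow> nat \<Rightarrow> class_matrix \<Rightarrow> nat list set" where
  "Grid m n M = {\<pi> \<in> perms. \<exists>c r. matrix_gridding m n M \<pi> c r}"

definition monotone_griddable :: "nat list set \<Rightarrow> bool" where
  "monotone_griddable C \<longleftrightarrow>
     (\<exists>m n N. gridding_matrix m n N \<and>
        (\<forall>i < m. \<forall>j < n. N i j \<in> {Av [2, 1], Av [1, 2], {}}) \<and> C \<subseteq> Grid m n N)"


definition cells :: "nat \<Rightarrow> nat \<Rightarrow> class_matrix \<Rightarrow> (nat \<times> nat) set" where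
  "cells m n M = {(i, j). i < m \<and> j < n \<and> M i j \<noteq> {}}"

definition adjacent :: "nat \<Rightarrow> nat \<Rightarrow> class_matrix \<Rightarrow> nat \<times> nat \<Rightarrow> nat \<times> nat \<Rightarrow> bool" where
  "adjacent m n M u v \<longleftrightarrow> u \<in> cells m n M \<and> v \<in> cells m n M \<and> u \<noteq> v \<and>
     (snd u = snd v \<and>
        (\<forall>k. min (fst u) (fst v) < k \<and> k < max (fst u) (fst v) \<longrightarrow> M k (snd u) = {}) \<or>
      fst u = fst v \<and>
        (\<forall>k. min (snd u) (snd v) < k \<and> k < max (snd u) (snd v) \<longrightarrow> M (fst u) k = {}))"

definition components :: "nat \<Rightarrow> nat \<Rightarrow> class_matrix \<Rightarrow> (nat \<times> nat) set set" where
  "components m n M = (\<lambda>u. {v. (adjacent m n M)\<^sup>*\<^sup>* u v}) ` cells m n M"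

definition is_cycle :: "nat \<Rightarrow> nat \<Rightarrow> class_matrix \<Rightarrow> (nat \<times> nat) list \<Rightarrow> bool" where
  "is_cycle m n M vs \<longleftrightarrow> length vs \<ge> 3 \<and> distinct vs \<and>
     (\<forall>i. Suc i < length vs \<longrightarrow> adjacent m n M (vs ! i) (vs ! Suc i)) \<and>
     adjacent m n M (last vs) (hd vs)"

end

theory Submission
  imports Defs "HOL-Library.Product_Lexorder" "HOL-Library.Ramsey"
begin

text \<open>
  By Ramsey's theorem an infinite class contains all increasing or all decreasing permutations. A
  class that is not monotone griddable contains all sums of \<open>21\<close> or all skew sums of \<open>12\<close>:
  otherwise the boxes that contain both an ascent and a descent have no large subset with pairwise
  disjoint projections, so boundedly many lines cut all of them, and every remaining cell is
  monotone.

  A cycle of cells, or a path between two cells of the second kind, gives a periodic walk through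
  cells that alternates between rows and columns; it stays at a cell for one step only if that cell
  contains all sums of \<open>21\<close> or all skew sums of \<open>12\<close>. Put one point \<open>p\<^sub>t\<close> at each step, such that on the line
  shared by \<open>p\<^sub>t\<close> and \<open>p\<^sub>t\<^sub>+\<^sub>1\<close> the latter is slightly closer to the centre. Then time proceeds at most
  at speed one: if an embedding respects the lines and maps \<open>p\<^sub>t\<close> to a point of time \<open>u\<close>, it maps
  \<open>p\<^sub>t\<^sub>+\<^sub>1\<close> to a point of time at most \<open>u + 1\<close>. Every embedding respects the lines along a long
  stretch of time, up to reversal of time, because along each line the image half lines form a
  monotone sequence. Now add extra points at sparse regular times. A stretch with many extra points
  has too many points to be mapped injectively into a stretch of about the same length with at most
  one extra point, so spirals with increasingly sparse extra points form an infinite antichain.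
\<close>

section \<open>Permutations of finite point sets\<close>

text \<open>An embedding need not respect cells, directions or time, so no single point can be
  pinned down; what survives is a count. The images of L consecutive times lie within L + 2P + 3
  consecutive times, an error that depends on the period \<open>P\<close> only. Hence 2P + 5 extra
  points do not fit where one extra place exists, and a constant factor between successive spacings
  suffices. Rows and columns must work together: on one half line an embedding may run outwards or
  inwards. The two lines through a point show the same direction because both read it off from the
  change of image time over several periods. Only the (skew) diagonal through the centre of a cell
  is used, on both sides, so long monotone patterns are enough wherever the walk moves. When it
  stays, two consecutive points are inverted relative to the direction of the cell and form one
  layer of a sum of 21 or a skew sum of 12. Such a stay is forced at the ends of a path walked back
  and forth: the walk has to leave by the line by which it came, and one idle step restores the
  alternation of rows and columns. A cycle turns by itself.\<close>

definition std :: "'a::linorder list \<Rightarrow> nat list" where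
  "std ys = map (\<lambda>y. card {z \<in> set ys. z \<le> y}) ys"

lemma length_std [simp]: "length (std ys) = length ys"
  by (simp add: std_def)

lemma card_below_less_iff:
  fixes a b :: "'a::linorder"
  assumes "finite A" "a \<in> A" "b \<in> A"
  shows "card {z \<in> A. z \<le> a} < card {z \<in> A. z \<le> b} \<longleftrightarrow> a < b"
proof
  assume "a < b"
  then have "{z \<in> A. z \<le> a} \<subseteq> {z \<in> A. z \<le> b}" "b \<notin> {z \<in> A. z \<le> a}" "b \<in> {z \<in> A. z \<le> b}"
    using assms by auto
  then show "card {z \<in> A. z \<le> a} < card {z \<in> A. z \<le> b}"
    using assms(1) by (intro psubset_card_mono) auto
next
  assume l: "card {z \<in> A. z \<le> a} < card {z \<in> A. z \<le> b}"
  show "a < b"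
  proof (rule ccontr)
    assume "\<not> a < b"
    then have "card {z \<in> A. z \<le> b} \<le> card {z \<in> A. z \<le> a}"
      using assms by (intro card_mono) auto
    with l show False by simp
  qed
qed

lemma std_nth_less_iff:
  assumes "i < length ys" "j < length ys"
  shows "std ys ! i < std ys ! j \<longleftrightarrow> ys ! i < ys ! j"
  using assms card_below_less_iff[of "set ys" "ys ! i" "ys ! j"] by (simp add: std_def)

lemma std_in_perms:
  assumes "distinct ys"
  shows "std ys \<in> perms"
proof -
  have d: "distinct (std ys)"
  proof (subst distinct_conv_nth, intro allI impI)
    fix i j assume *: "i < length (std ys)" "j < length (std ys)" "i \<noteq> j"
    then have "ys ! i \<noteq> ys ! j"
      using assms by (simp add: nth_eq_iff_index_eq)
    then show "std ys ! i \<noteq> std ys ! j"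
      using * std_nth_less_iff[of i ys j] std_nth_less_iff[of j ys i] by force
  qed
  have "set (std ys) \<subseteq> {1..length ys}"
  proof
    fix v assume "v \<in> set (std ys)"
    then obtain y where y: "y \<in> set ys" "v = card {z \<in> set ys. z \<le> y}"
      by (auto simp: std_def)
    have "card {y} \<le> v" unfolding y(2) using y(1) by (intro card_mono) auto
    moreover have "v \<le> card (set ys)" unfolding y(2) by (intro card_mono) auto
    ultimately show "v \<in> {1..length ys}"
      using card_length[of ys] by auto
  qed
  moreover have "card (set (std ys)) = length ys" using d distinct_card by fastforce
  ultimately have "set (std ys) = {1..length ys}"
    by (intro card_subset_eq) auto
  with d show ?thesis by (auto simp: perms_def permutations_of_set_def)
qed

lemma perms_distinct: "\<pi> \<in> perms \<Longrightarrow> distinct \<pi>"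
  by (auto simp: perms_def permutations_of_set_def)

lemma order_iso_std: "order_iso xs (std xs)"
  by (simp add: order_iso_def std_nth_less_iff)

lemma subseq_index:
  assumes "subseq xs ys"
  shows "\<exists>g. (\<forall>i < length xs. g i < length ys \<and> ys ! g i = xs ! i) \<and>
             (\<forall>i j. i < j \<longrightarrow> j < length xs \<longrightarrow> g i < g j)"
  using assms
proof (induction xs ys rule: list_emb.induct)
  case (list_emb_Nil ys)
  then show ?case by simp
next
  case (list_emb_Cons xs ys y)
  then obtain g where "\<forall>i < length xs. g i < length ys \<and> ys ! g i = xs ! i"
      "\<forall>i j. i < j \<longrightarrow> j < length xs \<longrightarrow> g i < g j" by blast
  then show ?case by (intro exI[of _ "\<lambda>i. Suc (g i)"]) auto
next
  case (list_emb_Cons2 x y xs ys)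
  then obtain g where g: "\<forall>i < length xs. g i < length ys \<and> ys ! g i = xs ! i"
      "\<forall>i j. i < j \<longrightarrow> j < length xs \<longrightarrow> g i < g j" by blast
  show ?case
    using g \<open>x = y\<close>
    by (intro exI[of _ "case_nat 0 (\<lambda>i. Suc (g i))"]) (auto split: nat.splits simp: less_Suc_eq_0_disj)
qed

lemma subseq_map_nth:
  assumes "sorted_wrt (<) ks" "\<forall>k \<in> set ks. k < length \<pi>"
  shows "subseq (map ((!) \<pi>) ks) \<pi>"
proof -
  have "sorted_wrt (<) (filter (\<lambda>k. k \<in> set ks) [0..<length \<pi>])"
    by (simp add: sorted_wrt_filter)
  then have "filter (\<lambda>k. k \<in> set ks) [0..<length \<pi>] = ks"
    using assms by (intro strict_sorted_equal) auto
  moreover have "subseq (map ((!) \<pi>) (filter (\<lambda>k. k \<in> set ks) [0..<length \<pi>]))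
      (map ((!) \<pi>) [0..<length \<pi>])"
    by (intro subseq_map subseq_filter_left)
  ultimately show ?thesis by (simp add: map_nth)
qed

section \<open>Generic point sets and the permutations that they draw\<close>

definition generic :: "(int \<times> int) set \<Rightarrow> bool" where
  "generic S \<longleftrightarrow> finite S \<and> inj_on fst S \<and> inj_on snd S"

text \<open>The sort is lexicographic on pairs; on a generic set the first coordinates differ, so it
  is the order from left to right.\<close>

definition perm_of :: "(int \<times> int) set \<Rightarrow> nat list" where
  "perm_of S = std (map snd (sorted_list_of_set S))"

lemma generic_subset: "generic S \<Longrightarrow> T \<subseteq> S \<Longrightarrow> generic T"
  by (auto simp: generic_def finite_subset inj_on_subset)

lemma length_perm_of [simp]: "length (perm_of S) = card S"
  by (simp add: perm_of_def)

lemma points_nth: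
  assumes "generic S" "k < card S"
  shows "sorted_list_of_set S ! k \<in> S"
  using assms nth_mem[of k "sorted_list_of_set S"] by (auto simp: generic_def)

lemma points_index:
  assumes "generic S" "p \<in> S"
  obtains k where "k < card S" "sorted_list_of_set S ! k = p"
  using assms by (metis generic_def in_set_conv_nth length_sorted_list_of_set set_sorted_list_of_set)

lemma points_fst_less:
  assumes "generic S" "k < card S" "l < card S"
  shows "fst (sorted_list_of_set S ! k) < fst (sorted_list_of_set S ! l) \<longleftrightarrow> k < l"
proof -
  let ?L = "sorted_list_of_set S"
  have *: "fst (?L ! i) < fst (?L ! j)" if "i < j" "j < card S" for i j
  proof -
    have "?L ! i < ?L ! j"
      using that sorted_wrt_nth_less[OF strict_sorted_list_of_set, of i j S] by simp
    moreover have "?L ! i \<in> S" "?L ! j \<in> S" using that assms by (auto intro: points_nth)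
    ultimately show ?thesis
      using assms(1) unfolding generic_def less_prod_def
      by (metis inj_onD order_le_less order_less_irrefl)
  qed
  show ?thesis
    using *[of k l] *[of l k] assms by (metis less_asym linorder_neqE_nat less_irrefl)
qed

lemma perm_of_nth_less:
  assumes "k < card S" "l < card S"
  shows "perm_of S ! k < perm_of S ! l \<longleftrightarrow>
    snd (sorted_list_of_set S ! k) < snd (sorted_list_of_set S ! l)"
  using assms std_nth_less_iff[of k "map snd (sorted_list_of_set S)" l]
  by (simp add: perm_of_def)

lemma perm_of_in_perms:
  assumes "generic S"
  shows "perm_of S \<in> perms"
  unfolding perm_of_def
  by (rule std_in_perms) (use assms in \<open>auto simp: distinct_map generic_def\<close>)

text \<open>Strict inequalities between distinct points of a generic set decide the order on both
  axes, so these one-way implications already give an order isomorphism onto the image.\<close>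

definition embeds :: "(int \<times> int) set \<Rightarrow> nat list \<Rightarrow> bool" where
  "embeds S \<pi> \<longleftrightarrow> (\<exists>h. (\<forall>p \<in> S. h p < length \<pi>) \<and>
     (\<forall>p \<in> S. \<forall>q \<in> S. (fst p < fst q \<longrightarrow> h p < h q) \<and> (snd p < snd q \<longrightarrow> \<pi> ! h p < \<pi> ! h q)))"

lemma perm_of_contained_iff:
  assumes "generic S"
  shows "perm_of S \<preceq> \<pi> \<longleftrightarrow> embeds S \<pi>"
proof
  let ?L = "sorted_list_of_set S"
  assume "embeds S \<pi>"
  then obtain h where h: "\<forall>p \<in> S. h p < length \<pi>"
    "\<And>p q. p \<in> S \<Longrightarrow> q \<in> S \<Longrightarrow> fst p < fst q \<Longrightarrow> h p < h q"
    "\<And>p q. p \<in> S \<Longrightarrow> q \<in> S \<Longrightarrow> snd p < snd q \<Longrightarrow> \<pi> ! h p < \<pi> ! h q"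
    unfolding embeds_def by blast
  have "sorted_wrt (<) (map h ?L)"
    unfolding sorted_wrt_iff_nth_less
    using assms by (auto intro!: h(2) points_nth simp: points_fst_less)
  then have 1: "subseq (map ((!) \<pi>) (map h ?L)) \<pi>"
    by (rule subseq_map_nth) (use h(1) assms in \<open>auto simp: generic_def\<close>)
  have snd_iff: "\<pi> ! h p < \<pi> ! h q \<longleftrightarrow> snd p < snd q" if "p \<in> S" "q \<in> S" for p q
  proof
    assume "\<pi> ! h p < \<pi> ! h q"
    then have "\<not> snd q < snd p" "p \<noteq> q" using h(3)[OF that(2,1)] by auto
    moreover have "snd p \<noteq> snd q" using \<open>p \<noteq> q\<close> that assms unfolding generic_def inj_on_def by blast
    ultimately show "snd p < snd q" by simp
  qed (rule h(3)[OF that])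
  have "order_iso (map ((!) \<pi>) (map h ?L)) (perm_of S)"
    unfolding order_iso_def using assms by (auto simp: perm_of_nth_less snd_iff points_nth)
  with 1 show "perm_of S \<preceq> \<pi>" unfolding contained_def by blast
next
  let ?L = "sorted_list_of_set S"
  assume "perm_of S \<preceq> \<pi>"
  then obtain \<sigma> where \<sigma>: "subseq \<sigma> \<pi>" "order_iso \<sigma> (perm_of S)"
    unfolding contained_def by blast
  then have len: "length \<sigma> = card S" by (simp add: order_iso_def)
  obtain g where g: "\<And>i. i < card S \<Longrightarrow> g i < length \<pi> \<and> \<pi> ! g i = \<sigma> ! i"
      "\<And>i j. i < j \<Longrightarrow> j < card S \<Longrightarrow> g i < g j"
    using subseq_index[OF \<sigma>(1)] len by auto
  have "\<forall>p \<in> S. \<exists>k. k < card S \<and> ?L ! k = p"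
    using points_index[OF assms] by blast
  then obtain idx where idx: "\<And>p. p \<in> S \<Longrightarrow> idx p < card S \<and> ?L ! idx p = p"
    by (auto dest!: bchoice)
  show "embeds S \<pi>" unfolding embeds_def
  proof (intro exI[of _ "g \<circ> idx"] conjI ballI impI)
    fix p assume "p \<in> S"
    then show "(g \<circ> idx) p < length \<pi>" using g(1) idx by simp
  next
    fix p q assume pq: "p \<in> S" "q \<in> S" "fst p < fst q"
    then have "idx p < idx q"
      using points_fst_less[OF assms, of "idx p" "idx q"] idx by simp
    then show "(g \<circ> idx) p < (g \<circ> idx) q" using g(2) idx pq by simp
  next
    fix p q assume pq: "p \<in> S" "q \<in> S" "snd p < snd q"
    then have "perm_of S ! idx p < perm_of S ! idx q"
      using perm_of_nth_less[of "idx p" S "idx q"] idx by simp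
    then have "\<sigma> ! idx p < \<sigma> ! idx q"
      using \<sigma>(2) idx pq len by (simp add: order_iso_def)
    then show "\<pi> ! (g \<circ> idx) p < \<pi> ! (g \<circ> idx) q" using g(1) idx pq by simp
  qed
qed

lemma embeds_perm_of_iff:
  assumes "generic T"
  shows "embeds S (perm_of T) \<longleftrightarrow> (\<exists>f. f ` S \<subseteq> T \<and>
     (\<forall>p \<in> S. \<forall>q \<in> S. (fst p < fst q \<longrightarrow> fst (f p) < fst (f q)) \<and>
        (snd p < snd q \<longrightarrow> snd (f p) < snd (f q))))"
proof
  let ?L = "sorted_list_of_set T"
  assume "embeds S (perm_of T)"
  then obtain h where h: "\<forall>p \<in> S. h p < card T"
    "\<And>p q. p \<in> S \<Longrightarrow> q \<in> S \<Longrightarrow> fst p < fst q \<Longrightarrow> h p < h q"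
    "\<And>p q. p \<in> S \<Longrightarrow> q \<in> S \<Longrightarrow> snd p < snd q \<Longrightarrow> perm_of T ! h p < perm_of T ! h q"
    unfolding embeds_def by auto
  show "\<exists>f. f ` S \<subseteq> T \<and>
     (\<forall>p \<in> S. \<forall>q \<in> S. (fst p < fst q \<longrightarrow> fst (f p) < fst (f q)) \<and>
        (snd p < snd q \<longrightarrow> snd (f p) < snd (f q)))"
  proof (intro exI[of _ "\<lambda>p. ?L ! h p"] conjI ballI impI)
    show "(\<lambda>p. ?L ! h p) ` S \<subseteq> T" using points_nth[OF assms] h(1) by blast
  qed (use assms h in \<open>auto simp: points_fst_less perm_of_nth_less[symmetric]\<close>)
next
  let ?L = "sorted_list_of_set T"
  assume "\<exists>f. f ` S \<subseteq> T \<and>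
     (\<forall>p \<in> S. \<forall>q \<in> S. (fst p < fst q \<longrightarrow> fst (f p) < fst (f q)) \<and>
        (snd p < snd q \<longrightarrow> snd (f p) < snd (f q)))"
  then obtain f where f: "\<And>p. p \<in> S \<Longrightarrow> f p \<in> T"
    "\<And>p q. p \<in> S \<Longrightarrow> q \<in> S \<Longrightarrow> fst p < fst q \<Longrightarrow> fst (f p) < fst (f q)"
    "\<And>p q. p \<in> S \<Longrightarrow> q \<in> S \<Longrightarrow> snd p < snd q \<Longrightarrow> snd (f p) < snd (f q)" by blast
  have "\<forall>p \<in> S. \<exists>k. k < card T \<and> ?L ! k = f p"
    using points_index[OF assms f(1)] by blast
  then obtain idx where idx: "\<And>p. p \<in> S \<Longrightarrow> idx p < card T \<and> ?L ! idx p = f p"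
    by (auto dest!: bchoice)
  show "embeds S (perm_of T)" unfolding embeds_def
  proof (intro exI[of _ idx] conjI ballI impI)
    fix p assume "p \<in> S"
    then show "idx p < length (perm_of T)" using idx by simp
  next
    fix p q assume pq: "p \<in> S" "q \<in> S" "fst p < fst q"
    show "idx p < idx q"
      using points_fst_less[OF assms, of "idx p" "idx q"] idx[OF pq(1)] idx[OF pq(2)] f(2)[OF pq] by simp
  next
    fix p q assume pq: "p \<in> S" "q \<in> S" "snd p < snd q"
    show "perm_of T ! idx p < perm_of T ! idx q"
      using perm_of_nth_less[of "idx p" T "idx q"] idx[OF pq(1)] idx[OF pq(2)] f(3)[OF pq] by simp
  qed
qed

lemma perm_of_in_class:
  assumes "perm_class C" "\<pi> \<in> C" "generic S" "embeds S \<pi>"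
  shows "perm_of S \<in> C"
  using assms perm_of_contained_iff perm_of_in_perms unfolding perm_class_def by blast

lemma perm_of_mono_in_class:
  assumes "perm_class C" "generic T" "perm_of T \<in> C" "generic S"
    and "\<And>p. p \<in> S \<Longrightarrow> f p \<in> T"
    and "\<And>p q. p \<in> S \<Longrightarrow> q \<in> S \<Longrightarrow> fst p < fst q \<Longrightarrow> fst (f p) < fst (f q)"
    and "\<And>p q. p \<in> S \<Longrightarrow> q \<in> S \<Longrightarrow> snd p < snd q \<Longrightarrow> snd (f p) < snd (f q)"
  shows "perm_of S \<in> C"
proof -
  have "embeds S (perm_of T)"
    unfolding embeds_perm_of_iff[OF assms(2)] using assms(5-7) by blast
  then show ?thesis using perm_of_in_class assms by blast
qed

lemma contained_length: "\<alpha> \<preceq> \<beta> \<Longrightarrow> length \<alpha> \<le> length \<beta>"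
  unfolding contained_def order_iso_def by (metis list_emb_length)

text \<open>With \<open>f\<close> a coordinate and \<open>g\<close> a column or row index, the
  left-hand cardinality is the position of the \<open>i\<close>-th line and the right-hand one is
  the rank of \<open>p\<close>. This translates an assignment of strips to points into lines given
  by numbers of points.\<close>

lemma card_less_iff_le:
  fixes f :: "'a \<Rightarrow> 'b::linorder"
  assumes "finite S" "inj_on f S" "p \<in> S"
    and mono: "\<And>p q. p \<in> S \<Longrightarrow> q \<in> S \<Longrightarrow> f p < f q \<Longrightarrow> g p \<le> (g q :: nat)"
  shows "card {q \<in> S. g q < i} < card {q \<in> S. f q \<le> f p} \<longleftrightarrow> i \<le> g p"
proof
  assume "i \<le> g p"
  then have "{q \<in> S. g q < i} \<subset> {q \<in> S. f q \<le> f p}"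
    using assms(3) mono[of p] by (auto simp: not_le dest: leD) (force simp: not_le)+
  then show "card {q \<in> S. g q < i} < card {q \<in> S. f q \<le> f p}"
    using assms(1) by (intro psubset_card_mono) auto
next
  assume l: "card {q \<in> S. g q < i} < card {q \<in> S. f q \<le> f p}"
  show "i \<le> g p"
  proof (rule ccontr)
    assume "\<not> i \<le> g p"
    have "{q \<in> S. f q \<le> f p} \<subseteq> {q \<in> S. g q < i}"
    proof safe
      fix q assume "q \<in> S" "f q \<le> f p"
      then have "g q \<le> g p" using mono[of q p] assms(2,3) by (cases "q = p") (auto simp: inj_on_def le_less)
      then show "g q < i" using \<open>\<not> i \<le> g p\<close> by simp
    qed
    then have "card {q \<in> S. f q \<le> f p} \<le> card {q \<in> S. g q < i}"
      using assms(1) by (intro card_mono) auto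
    with l show False by simp
  qed
qed

lemma nths_eq_filter:
  assumes "\<And>k. k < length xs \<Longrightarrow> k \<in> A \<longleftrightarrow> P (xs ! k)"
  shows "nths xs A = filter P xs"
  using assms
proof (induction xs rule: rev_induct)
  case Nil
  then show ?case by simp
next
  case (snoc x xs)
  have "nths xs A = filter P xs"
  proof (rule snoc.IH)
    fix k assume "k < length xs"
    then show "k \<in> A \<longleftrightarrow> P (xs ! k)" using snoc.prems[of k] by (simp add: nth_append)
  qed
  moreover have "length xs \<in> A \<longleftrightarrow> P x" using snoc.prems[of "length xs"] by simp
  ultimately show ?case by (simp add: nths_append)
qed

text \<open>Monotone assignments of columns and rows to the points determine the lines: each line is
  placed after all points of smaller index. Membership in a grid class can then be checked on point
  sets, without handling lines.\<close>

lemma perm_of_in_Grid: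
  assumes S: "generic S"
    and ci: "\<And>p. p \<in> S \<Longrightarrow> ci p < m" "\<And>p q. p \<in> S \<Longrightarrow> q \<in> S \<Longrightarrow> fst p < fst q \<Longrightarrow> ci p \<le> ci q"
    and ri: "\<And>p. p \<in> S \<Longrightarrow> ri p < n" "\<And>p q. p \<in> S \<Longrightarrow> q \<in> S \<Longrightarrow> snd p < snd q \<Longrightarrow> ri p \<le> ri q"
    and cl: "\<And>i j. i < m \<Longrightarrow> j < n \<Longrightarrow> {p \<in> S. ci p = i \<and> ri p = j} \<noteq> {} \<Longrightarrow>
               perm_of {p \<in> S. ci p = i \<and> ri p = j} \<in> M i j"
  shows "perm_of S \<in> Grid m n M"
proof -
  let ?L = "sorted_list_of_set S"
  define c where "c i = card {p \<in> S. ci p < i}" for i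
  define r where "r j = card {p \<in> S. ri p < j}" for j
  have fin: "finite S" using S by (simp add: generic_def)
  have setL: "set ?L = S" using fin by simp
  have "gridding m n (perm_of S) c r"
    unfolding gridding_def
  proof (intro conjI allI impI)
    show "c m = length (perm_of S)" "r n = length (perm_of S)"
      unfolding c_def r_def using ci(1) ri(1) by (auto intro!: arg_cong[where f = card])
    fix i show "c i \<le> c (Suc i)" "r i \<le> r (Suc i)"
      unfolding c_def r_def using fin by (auto intro!: card_mono)
  qed (auto simp: c_def r_def)
  moreover have "cell (perm_of S) c r i j = [] \<or> (\<exists>\<sigma> \<in> M i j. order_iso (cell (perm_of S) c r i j) \<sigma>)"
    if ij: "i < m" "j < n" for i j
  proof -
    define Z where "Z = {p \<in> S. ci p = i \<and> ri p = j}"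
    define rk where "rk p = card {z \<in> snd ` S. z \<le> snd p}" for p :: "int \<times> int"
    have L: "perm_of S = map rk ?L"
      unfolding perm_of_def std_def rk_def using fin by simp
    have rk: "rk p = card {q \<in> S. snd q \<le> snd p}" for p
    proof -
      have "{z \<in> snd ` S. z \<le> snd p} = snd ` {q \<in> S. snd q \<le> snd p}" by auto
      moreover have "inj_on snd {q \<in> S. snd q \<le> snd p}"
        using S by (auto simp: generic_def inj_on_def)
      ultimately show ?thesis unfolding rk_def by (simp add: card_image)
    qed
    have k: "Suc k = card {q \<in> S. fst q \<le> fst (?L ! k)}" if "k < card S" for k
    proof -
      have "{q \<in> S. fst q \<le> fst (?L ! k)} = (!) ?L ` {..k}"
      proof (intro equalityI subsetI)
        fix q assume "q \<in> {q \<in> S. fst q \<le> fst (?L ! k)}"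
        then obtain l where "l < card S" "?L ! l = q" "fst q \<le> fst (?L ! k)"
          using points_index[OF S] by blast
        then show "q \<in> (!) ?L ` {..k}" using points_fst_less[OF S that, of l] by force
      next
        fix q assume "q \<in> (!) ?L ` {..k}"
        then obtain l where l: "l \<le> k" "q = ?L ! l" by auto
        then show "q \<in> {q \<in> S. fst q \<le> fst (?L ! k)}"
          using points_fst_less[OF S that, of l] that points_nth[OF S] by force
      qed
      moreover have "inj_on ((!) ?L) {..k}"
        using that by (intro inj_on_nth) auto
      ultimately show ?thesis by (simp add: card_image)
    qed
    have mem: "k \<in> {k. k < length (perm_of S) \<and> c i < k + 1 \<and> k + 1 \<le> c (i + 1) \<and>
                r j < perm_of S ! k \<and> perm_of S ! k \<le> r (j + 1)} \<longleftrightarrow> ?L ! k \<in> Z"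
      if "k < length ?L" for k
    proof -
      have kS: "k < card S" using that by simp
      let ?p = "?L ! k"
      have p: "?p \<in> S" using kS points_nth[OF S] by simp
      have "c i' < k + 1 \<longleftrightarrow> i' \<le> ci ?p" for i'
        unfolding c_def using k[OF kS] card_less_iff_le[of S fst ?p ci i'] S p ci(2)
        by (simp add: generic_def)
      moreover have "r j' < perm_of S ! k \<longleftrightarrow> j' \<le> ri ?p" for j'
        unfolding r_def L using kS card_less_iff_le[of S snd ?p ri j'] S p ri(2)
        by (simp add: generic_def rk)
      ultimately show ?thesis using p kS unfolding Z_def
        by (simp add: linorder_not_less[symmetric]) linarith
    qed
    have "nths ?L {k. k < length (perm_of S) \<and> c i < k + 1 \<and> k + 1 \<le> c (i + 1) \<and>
                r j < perm_of S ! k \<and> perm_of S ! k \<le> r (j + 1)} = filter (\<lambda>p. p \<in> Z) ?L"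
      using mem by (intro nths_eq_filter)
    also have "\<dots> = sorted_list_of_set Z"
      using fin by (intro strict_sorted_equal)
        (auto simp: sorted_wrt_filter Z_def)
    finally have cell: "cell (perm_of S) c r i j = map rk (sorted_list_of_set Z)"
      unfolding cell_def using L by (metis (no_types, lifting) nths_map)
    have ZS: "Z \<subseteq> S" "generic Z" using S by (auto simp: Z_def intro: generic_subset)
    have "order_iso (map rk (sorted_list_of_set Z)) (perm_of Z)"
      unfolding order_iso_def
    proof (intro conjI allI impI)
      fix k l assume "k < length (map rk (sorted_list_of_set Z))" "l < length (map rk (sorted_list_of_set Z))"
      then have kl: "k < card Z" "l < card Z" by auto
      moreover have "sorted_list_of_set Z ! k \<in> S" "sorted_list_of_set Z ! l \<in> S"
        using points_nth[OF ZS(2)] kl ZS(1) by auto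
      ultimately show "(map rk (sorted_list_of_set Z) ! k < map rk (sorted_list_of_set Z) ! l) =
          (perm_of Z ! k < perm_of Z ! l)"
        using fin by (simp add: perm_of_nth_less rk_def card_below_less_iff)
    qed simp
    then show ?thesis
      using cell cl[OF ij] unfolding Z_def[symmetric] by (cases "Z = {}") auto
  qed
  ultimately show ?thesis
    using perm_of_in_perms[OF S] unfolding Grid_def matrix_gridding_def by blast
qed

section \<open>Long patterns in infinite classes\<close>

text \<open>The range of indices is symmetric about 0 because a cell of a spiral is filled on both
  sides of its centre; signed levels will serve as indices.\<close>

definition monotone_points :: "int \<Rightarrow> nat \<Rightarrow> (int \<times> int) set" where
  "monotone_points \<tau> n = (\<lambda>k. (k, \<tau> * k)) ` {- int n..int n}"

text \<open>For \<open>\<tau> = 1\<close> this is a sum of \<open>2 * n + 1\<close> copies of 21,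
  for \<open>\<tau> = - 1\<close> a skew sum of as many copies of 12. So \<open>\<tau>\<close> is
  the overall direction and the opposite of the direction inside a layer.\<close>

definition layered_points :: "int \<Rightarrow> nat \<Rightarrow> (int \<times> int) set" where
  "layered_points \<tau> n = (\<lambda>k. (2 * k, \<tau> * (2 * k + 1))) ` {- int n..int n} \<union>
     (\<lambda>k. (2 * k + 1, \<tau> * (2 * k))) ` {- int n..int n}"

lemma generic_monotone_points: "\<tau> \<in> {1, - 1} \<Longrightarrow> generic (monotone_points \<tau> n)"
  by (auto simp: generic_def monotone_points_def inj_on_def)

lemma generic_layered_points: "\<tau> \<in> {1, - 1} \<Longrightarrow> generic (layered_points \<tau> n)"
  unfolding generic_def layered_points_def inj_on_def by (auto; presburger)

lemma embedsI_signed: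
  assumes "\<tau> \<in> {1, - 1}" "\<And>p. p \<in> S \<Longrightarrow> h p < length \<pi>"
    and "\<And>p q. p \<in> S \<Longrightarrow> q \<in> S \<Longrightarrow> fst p < fst q \<Longrightarrow> h p < h q"
    and "\<And>p q. p \<in> S \<Longrightarrow> q \<in> S \<Longrightarrow> \<tau> * snd p < \<tau> * snd q \<Longrightarrow> \<tau> * int (\<pi> ! h p) < \<tau> * int (\<pi> ! h q)"
  shows "embeds S \<pi>"
  unfolding embeds_def
proof (intro exI[of _ h] conjI ballI impI)
  fix p q assume pq: "p \<in> S" "q \<in> S" "snd p < snd q"
  from assms(1) show "\<pi> ! h p < \<pi> ! h q"
    using assms(4)[OF pq(1,2)] assms(4)[OF pq(2,1)] pq(3) by auto
qed (use assms(2,3) in auto)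

lemma embeds_monotone_points:
  assumes "\<tau> \<in> {1, - 1}"
    and "\<And>k. k \<in> {- int n..int n} \<Longrightarrow> e k < length \<pi>"
    and "\<And>k l. k \<in> {- int n..int n} \<Longrightarrow> l \<in> {- int n..int n} \<Longrightarrow> k < l \<Longrightarrow>
           e k < e l \<and> \<tau> * int (\<pi> ! e k) < \<tau> * int (\<pi> ! e l)"
  shows "embeds (monotone_points \<tau> n) \<pi>"
  by (rule embedsI_signed[OF assms(1), where h = "\<lambda>p. e (fst p)"])
    (use assms in \<open>auto simp: monotone_points_def\<close>)

text \<open>The shift swaps the two members of each pair 2k, 2k + 1 and turns the first coordinate
  of a layered point into \<open>\<tau>\<close> times the second. It can reverse an order only
  inside a pair.\<close>

lemma parity_shift_less:
  fixes u v :: int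
  assumes "u + (if even u then 1 else - 1) < v + (if even v then 1 else - 1)"
  shows "u div 2 < v div 2 \<or> u div 2 = v div 2 \<and> odd u \<and> even v"
  using assms by (cases "even u"; cases "even v") (auto elim!: evenE oddE)

lemma embeds_layered_points:
  assumes \<tau>: "\<tau> \<in> {1, - 1}"
    and *: "\<And>k. k \<in> {- int n..int n} \<Longrightarrow> a k < b k \<and> b k < length \<pi> \<and>
           \<tau> * int (\<pi> ! b k) < \<tau> * int (\<pi> ! a k)"
    and **: "\<And>k l i j. k \<in> {- int n..int n} \<Longrightarrow> l \<in> {- int n..int n} \<Longrightarrow> k < l \<Longrightarrow>
           i \<in> {a k, b k} \<Longrightarrow> j \<in> {a l, b l} \<Longrightarrow>
           i < j \<and> \<tau> * int (\<pi> ! i) < \<tau> * int (\<pi> ! j)"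
  shows "embeds (layered_points \<tau> n) \<pi>"
proof (rule embedsI_signed[OF \<tau>,
    where h = "\<lambda>p. if even (fst p) then a (fst p div 2) else b (fst p div 2)"])
  let ?h = "\<lambda>p. if even (fst p :: int) then a (fst p div 2) else b (fst p div 2)"
  have in_ab: "?h p \<in> {a (fst p div 2), b (fst p div 2)}" for p :: "int \<times> int" by auto
  have snd: "\<tau> * snd p = fst p + (if even (fst p) then 1 else - 1)" "fst p div 2 \<in> {- int n..int n}"
    if "p \<in> layered_points \<tau> n" for p
    using that \<tau> by (auto simp: layered_points_def)
  fix p assume p: "p \<in> layered_points \<tau> n"
  show "?h p < length \<pi>" using *[OF snd(2)[OF p]] by auto
  fix q assume q: "q \<in> layered_points \<tau> n"
  show "?h p < ?h q" if "fst p < fst q"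
  proof (cases "fst p div 2 = fst q div 2")
    case True
    then have "even (fst p)" "odd (fst q)" using that by presburger+
    then show ?thesis using *[OF snd(2)[OF p]] True by simp
  next
    case False
    then have "fst p div 2 < fst q div 2" using that by presburger
    then show ?thesis using **[OF snd(2)[OF p] snd(2)[OF q] _ in_ab[of p] in_ab[of q]] by blast
  qed
  show "\<tau> * int (\<pi> ! ?h p) < \<tau> * int (\<pi> ! ?h q)" if l: "\<tau> * snd p < \<tau> * snd q"
  proof (cases "fst p div 2 = fst q div 2")
    case True
    then have "odd (fst p)" "even (fst q)"
      using parity_shift_less[OF l[unfolded snd(1)[OF p] snd(1)[OF q]]] by auto
    then show ?thesis using *[OF snd(2)[OF p]] True by simp
  next
    case False
    then have "fst p div 2 < fst q div 2"
      using parity_shift_less[OF l[unfolded snd(1)[OF p] snd(1)[OF q]]] by auto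
    then show ?thesis using **[OF snd(2)[OF p] snd(2)[OF q] _ in_ab[of p] in_ab[of q]] by blast
  qed
qed

lemma symmetric_enumeration:
  fixes V :: "nat set"
  assumes "finite V" "card V = 2 * n + 1"
  obtains e where "\<And>k. k \<in> {- int n..int n} \<Longrightarrow> e k \<in> V"
    "\<And>k l. k \<in> {- int n..int n} \<Longrightarrow> l \<in> {- int n..int n} \<Longrightarrow> k < l \<Longrightarrow> e k < e l"
proof
  let ?e = "\<lambda>k. sorted_list_of_set V ! nat (k + int n)"
  fix k assume k: "k \<in> {- int n..int n}"
  then have "sorted_list_of_set V ! nat (k + int n) \<in> set (sorted_list_of_set V)"
    using assms by (intro nth_mem) auto
  then show "?e k \<in> V" using assms(1) by simp
  fix l assume "l \<in> {- int n..int n}" "k < l"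
  then show "?e k < ?e l"
    using k assms sorted_wrt_nth_less[OF strict_sorted_list_of_set[of V]] by auto
qed

lemma infinite_class_long:
  assumes "perm_class C" "infinite C"
  shows "\<exists>\<pi> \<in> C. r \<le> length \<pi>"
proof (rule ccontr)
  assume "\<not> ?thesis"
  then have "C \<subseteq> (\<Union>n \<in> {..r}. permutations_of_set {1..n})"
    using assms(1) unfolding perm_class_def perms_def
    by (fastforce simp: permutations_of_set_def dest: distinct_card)
  moreover have "finite (\<Union>n \<in> {..r}. permutations_of_set {1..n})" by simp
  ultimately show False using assms(2) finite_subset by blast
qed

lemma ramsey_nat:
  "\<exists>r. \<forall>(V :: nat set) E. finite V \<and> r \<le> card V \<longrightarrow>
    (\<exists>R \<subseteq> V. card R = m \<and> clique R E \<or> card R = n \<and> indep R E)"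
  by (rule ex_forward[OF ramsey2]) (erule conjunct2)

lemma infinite_class_monotone_points:
  assumes C: "perm_class C" "infinite C"
  shows "\<exists>\<tau> \<in> {1, - 1}. \<forall>n. perm_of (monotone_points \<tau> n) \<in> C"
proof (rule ccontr)
  assume "\<not> ?thesis"
  then obtain n1 n2 where n: "perm_of (monotone_points 1 n1) \<notin> C" "perm_of (monotone_points (- 1) n2) \<notin> C"
    by auto
  obtain r where r: "\<forall>(V :: nat set) E. finite V \<and> r \<le> card V \<longrightarrow>
    (\<exists>R \<subseteq> V. card R = 2 * n1 + 1 \<and> clique R E \<or> card R = 2 * n2 + 1 \<and> indep R E)"
    using ramsey_nat ..
  obtain \<pi> where \<pi>: "\<pi> \<in> C" "r \<le> length \<pi>" using infinite_class_long[OF C] by blast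
  have dist: "distinct \<pi>" using \<pi>(1) C(1) perms_distinct by (auto simp: perm_class_def)
  \<comment> \<open>Vertices are positions and edges are ascents, so a clique is an increasing
    subsequence and an independent set a decreasing one.\<close>
  define E where "E = {{k, l} | k l. k < l \<and> \<pi> ! k < \<pi> ! l}"
  have E: "{k, l} \<in> E \<longleftrightarrow> \<pi> ! k < \<pi> ! l" if "k < l" for k l
    using that by (auto simp: E_def doubleton_eq_iff)
  from r[rule_format, of "{..<length \<pi>}" E] \<pi>(2) obtain R where R: "R \<subseteq> {..<length \<pi>}"
    "card R = 2 * n1 + 1 \<and> clique R E \<or> card R = 2 * n2 + 1 \<and> indep R E" by auto
  have finR: "finite R" using R(1) finite_subset by blast
  from R(2) show False
  proof
    assume c: "card R = 2 * n1 + 1 \<and> clique R E"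
    then obtain e where e: "\<And>k. k \<in> {- int n1..int n1} \<Longrightarrow> e k \<in> R"
      "\<And>k l. k \<in> {- int n1..int n1} \<Longrightarrow> l \<in> {- int n1..int n1} \<Longrightarrow> k < l \<Longrightarrow> e k < e l"
      using symmetric_enumeration[OF finR] by metis
    have "embeds (monotone_points 1 n1) \<pi>"
    proof (rule embeds_monotone_points)
      fix k assume k: "k \<in> {- int n1..int n1}"
      then show "e k < length \<pi>" using e(1) R(1) by auto
      fix l assume l: "l \<in> {- int n1..int n1}" "k < l"
      have "e k < e l" using e(2) k l by auto
      moreover from this have "{e k, e l} \<in> E" using c e(1) k l(1) by (auto simp: clique_def)
      ultimately show "e k < e l \<and> 1 * int (\<pi> ! e k) < 1 * int (\<pi> ! e l)"
        using E by auto
    qed auto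
    then show False using n(1) perm_of_in_class[OF C(1) \<pi>(1)] generic_monotone_points by blast
  next
    assume c: "card R = 2 * n2 + 1 \<and> indep R E"
    then obtain e where e: "\<And>k. k \<in> {- int n2..int n2} \<Longrightarrow> e k \<in> R"
      "\<And>k l. k \<in> {- int n2..int n2} \<Longrightarrow> l \<in> {- int n2..int n2} \<Longrightarrow> k < l \<Longrightarrow> e k < e l"
      using symmetric_enumeration[OF finR] by metis
    have "embeds (monotone_points (- 1) n2) \<pi>"
    proof (rule embeds_monotone_points)
      fix k assume k: "k \<in> {- int n2..int n2}"
      then show ek: "e k < length \<pi>" using e(1) R(1) by auto
      fix l assume l: "l \<in> {- int n2..int n2}" "k < l"
      have el: "e l < length \<pi>" using e(1) R(1) l by auto
      have kl: "e k < e l" using e(2) k l by auto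
      moreover from this have "{e k, e l} \<notin> E" using c e(1) k l(1) by (auto simp: indep_def)
      moreover have "\<pi> ! e k \<noteq> \<pi> ! e l" using dist ek el kl by (simp add: nth_eq_iff_index_eq)
      ultimately show "e k < e l \<and> - 1 * int (\<pi> ! e k) < - 1 * int (\<pi> ! e l)"
        using E by auto
    qed auto
    then show False using n(2) perm_of_in_class[OF C(1) \<pi>(1)] generic_monotone_points by blast
  qed
qed

section \<open>Piercing intervals and boxes with few lines\<close>

abbreviation apart :: "('a \<Rightarrow> nat) \<Rightarrow> ('a \<Rightarrow> nat) \<Rightarrow> 'a \<Rightarrow> 'a \<Rightarrow> bool" where
  "apart lo hi g g' \<equiv> hi g < lo g' \<or> hi g' < lo g"

text \<open>Greedy choice: the smallest right end pierces every interval that starts no later than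
  it, and its own interval is apart from all the others. Those others therefore contain no
  \<open>r - 1\<close> pairwise apart intervals.\<close>

lemma pierce_intervals:
  assumes "finite G" "\<forall>g \<in> G. lo g \<le> hi g"
    and "\<not> (\<exists>D \<subseteq> G. card D = r \<and> pairwise (apart lo hi) D)"
  shows "\<exists>H. finite H \<and> card H \<le> r \<and> (\<forall>g \<in> G. \<exists>h \<in> H. lo g \<le> h \<and> h \<le> hi g)"
  using assms
proof (induction r arbitrary: G)
  case 0
  have "{} \<subseteq> G \<and> card ({} :: 'a set) = 0 \<and> pairwise (apart lo hi) {}" by simp
  with 0(3) show ?case by blast
next
  case (Suc r)
  show ?case
  proof (cases "G = {}")
    case True
    then show ?thesis by (intro exI[of _ "{}"]) auto
  next
    case False
    obtain g where g: "g \<in> G" "\<And>g'. g' \<in> G \<Longrightarrow> hi g \<le> hi g'"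
      using False Suc.prems(1) by (metis arg_min_if_finite(1) arg_min_least)
    define G' where "G' = {g' \<in> G. hi g < lo g'}"
    have "\<not> (\<exists>D \<subseteq> G'. card D = r \<and> pairwise (apart lo hi) D)"
    proof
      assume "\<exists>D \<subseteq> G'. card D = r \<and> pairwise (apart lo hi) D"
      then obtain D where D: "D \<subseteq> G'" "card D = r" "pairwise (apart lo hi) D" by blast
      have "finite D" using D(1) Suc.prems(1) unfolding G'_def
        by (metis (no_types, lifting) finite_subset mem_Collect_eq subsetI)
      moreover have "g \<notin> D" using D(1) g(1) Suc.prems(2) by (force simp: G'_def)
      ultimately have "card (insert g D) = Suc r" using D(2) by simp
      moreover have "pairwise (apart lo hi) (insert g D)"
        using D by (auto simp: pairwise_insert G'_def)
      ultimately show False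
        using Suc.prems(3) D(1) g(1) unfolding G'_def by (metis (no_types, lifting) insert_subset mem_Collect_eq subset_iff)
    qed
    then obtain H where H: "finite H" "card H \<le> r" "\<forall>g \<in> G'. \<exists>h \<in> H. lo g \<le> h \<and> h \<le> hi g"
      using Suc.IH[of G'] Suc.prems by (auto simp: G'_def)
    show ?thesis
    proof (intro exI[of _ "insert (hi g) H"] conjI ballI)
      show "card (insert (hi g) H) \<le> Suc r" using H(1,2) by (simp add: card_insert_if)
      fix g' assume g': "g' \<in> G"
      show "\<exists>h \<in> insert (hi g) H. lo g' \<le> h \<and> h \<le> hi g'"
      proof (cases "hi g < lo g'")
        case True
        then show ?thesis using H(3) g' by (auto simp: G'_def)
      next
        case False
        then show ?thesis using g(2)[OF g'] by auto
      qed
    qed (use H in auto)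
  qed
qed

text \<open>Choose the interval with the smallest right end; it meets at most one interval of every other
  family, because all intervals met contain that end.\<close>

lemma apart_representatives:
  assumes "finite I" "\<forall>i \<in> I. finite (G i) \<and> card I \<le> card (G i) \<and> pairwise (apart lo hi) (G i)"
    and "\<forall>i \<in> I. \<forall>g \<in> G i. lo g \<le> hi g"
  shows "\<exists>s. (\<forall>i \<in> I. s i \<in> G i) \<and> (\<forall>i \<in> I. \<forall>j \<in> I. i \<noteq> j \<longrightarrow> apart lo hi (s i) (s j))"
  using assms
proof (induction "card I" arbitrary: I G)
  case 0
  then show ?case by simp
next
  case (Suc c)
  define U where "U = (\<Union>i \<in> I. G i)"
  have "finite U" using Suc.prems by (auto simp: U_def)
  have "I \<noteq> {}" using Suc.hyps(2) by auto
  then obtain i where "i \<in> I" by blast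
  then have "card (G i) \<noteq> 0" using Suc.prems(2) Suc.hyps(2) by fastforce
  then have "U \<noteq> {}" using \<open>i \<in> I\<close> by (force simp: U_def)
  then obtain g where g: "g \<in> U" "\<And>g'. g' \<in> U \<Longrightarrow> hi g \<le> hi g'"
    using \<open>finite U\<close> by (metis arg_min_if_finite(1) arg_min_least)
  then obtain i0 where i0: "i0 \<in> I" "g \<in> G i0" by (auto simp: U_def)
  define I' where "I' = I - {i0}"
  define G' where "G' i = {g' \<in> G i. hi g < lo g'}" for i
  have card': "card I' = c" using Suc.hyps(2) Suc.prems(1) i0(1) by (simp add: I'_def)
  have "\<forall>i \<in> I'. finite (G' i) \<and> card I' \<le> card (G' i) \<and> pairwise (apart lo hi) (G' i)"
  proof (intro ballI conjI)
    fix i assume "i \<in> I'"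
    then have i: "i \<in> I" by (simp add: I'_def)
    show "finite (G' i)" using Suc.prems(2) i by (simp add: G'_def)
    show "pairwise (apart lo hi) (G' i)"
      using Suc.prems(2) i by (auto simp: G'_def intro: pairwise_subset)
    have "card (G i - G' i) \<le> 1"
    proof -
      have "a = b" if "a \<in> G i - G' i" "b \<in> G i - G' i" for a b
      proof (rule ccontr)
        assume "a \<noteq> b"
        then have "apart lo hi a b" using that Suc.prems(2) i by (auto simp: pairwise_def)
        moreover have "hi g \<le> hi a" "hi g \<le> hi b" using g(2) that i by (auto simp: U_def)
        moreover have "lo a \<le> hi g" "lo b \<le> hi g" using that by (auto simp: G'_def)
        ultimately show False by linarith
      qed
      then show ?thesis using Suc.prems(2) i by (simp add: card_le_Suc0_iff_eq)
    qed
    moreover have "card (G i) = card (G' i) + card (G i - G' i)"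
      using Suc.prems(2) i by (subst card_Diff_subset) (auto simp: G'_def card_mono)
    ultimately show "card I' \<le> card (G' i)"
      using Suc.prems(2) i Suc.hyps(2) card' by fastforce
  qed
  moreover have "\<forall>i \<in> I'. \<forall>g \<in> G' i. lo g \<le> hi g" "finite I'"
    using Suc.prems unfolding I'_def G'_def by auto
  ultimately have "\<exists>s. (\<forall>i \<in> I'. s i \<in> G' i) \<and> (\<forall>i \<in> I'. \<forall>j \<in> I'. i \<noteq> j \<longrightarrow> apart lo hi (s i) (s j))"
    using Suc.hyps(1)[of I' G'] card' by simp
  then obtain s where s: "\<forall>i \<in> I'. s i \<in> G' i" "\<forall>i \<in> I'. \<forall>j \<in> I'. i \<noteq> j \<longrightarrow> apart lo hi (s i) (s j)"
    by blast
  show ?case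
  proof (intro exI[of _ "s(i0 := g)"] conjI ballI impI)
    fix i assume i: "i \<in> I"
    show "(s(i0 := g)) i \<in> G i" using s(1) i i0 by (auto simp: I'_def G'_def)
    fix j assume j: "j \<in> I" "i \<noteq> j"
    show "apart lo hi ((s(i0 := g)) i) ((s(i0 := g)) j)"
      using s i j by (auto simp: I'_def G'_def)
  qed
qed

text \<open>Sweep a vertical line to the right and stop at the first \<open>v\<close> such that the
  boxes ending by \<open>v\<close> include \<open>r\<close> with pairwise disjoint vertical
  projections. Boxes ending before \<open>v\<close> need at most \<open>r\<close> horizontal lines,
  boxes meeting \<open>v\<close> are cut by it, and the boxes beyond \<open>v\<close> have one group
  fewer at their disposal. The forbidden configuration consists of \<open>s\<close> such groups side
  by side.\<close>

lemma pierce_strips: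
  fixes xl xr yl yr :: "'a \<Rightarrow> nat"
  assumes "finite F" "\<forall>g \<in> F. xl g \<le> xr g \<and> yl g \<le> yr g"
    and "\<not> (\<exists>G. (\<forall>i < s. G i \<subseteq> F \<and> card (G i) = r \<and> pairwise (apart yl yr) (G i)) \<and>
              (\<forall>j < s. \<forall>i < j. \<forall>g \<in> G i. \<forall>g' \<in> G j. xr g < xl g'))"
  shows "\<exists>V H. finite V \<and> finite H \<and> card V \<le> s \<and> card H \<le> s * r \<and>
           (\<forall>g \<in> F. (\<exists>v \<in> V. xl g \<le> v \<and> v \<le> xr g) \<or> (\<exists>h \<in> H. yl g \<le> h \<and> h \<le> yr g))"
  using assms
proof (induction s arbitrary: F)
  case 0
  then show ?case by simp
next
  case (Suc s)
  define heavy where "heavy v \<longleftrightarrow> (\<exists>D \<subseteq> {g \<in> F. xr g \<le> v}. card D = r \<and> pairwise (apart yl yr) D)" for v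
  show ?case
  proof (cases "\<exists>v. heavy v")
    case False
    have "\<not> (\<exists>D \<subseteq> F. card D = r \<and> pairwise (apart yl yr) D)"
    proof
      assume D: "\<exists>D \<subseteq> F. card D = r \<and> pairwise (apart yl yr) D"
      have "\<exists>v. \<forall>g \<in> F. xr g \<le> v"
        using Suc.prems(1) by (metis Max_ge finite_imageI imageI)
      then obtain v where "\<forall>g \<in> F. xr g \<le> v" ..
      then have "{g \<in> F. xr g \<le> v} = F" by auto
      then have "heavy v" using D by (simp only: heavy_def)
      then show False using False by blast
    qed
    then obtain H where "finite H" "card H \<le> r" "\<forall>g \<in> F. \<exists>h \<in> H. yl g \<le> h \<and> h \<le> yr g"
      using pierce_intervals[of F yl yr r] Suc.prems by blast
    then show ?thesis by (intro exI[of _ "{}"] exI[of _ H]) auto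
  next
    case True
    define v where "v = (LEAST v. heavy v)"
    have v: "heavy v" unfolding v_def using True by (metis LeastI)
    define F1 where "F1 = {g \<in> F. xr g < v}"
    define F2 where "F2 = {g \<in> F. v < xl g}"
    have "\<not> (\<exists>D \<subseteq> F1. card D = r \<and> pairwise (apart yl yr) D)"
    proof
      assume D: "\<exists>D \<subseteq> F1. card D = r \<and> pairwise (apart yl yr) D"
      show False
      proof (cases v)
        case 0
        then have "F1 = {}" by (simp add: F1_def)
        then have "r = 0" using D by auto
        \<comment> \<open>No right end is below 0, so \<open>r = 0\<close>, and then empty groups
          already form the forbidden configuration.\<close>
        show ?thesis by (rule notE[OF Suc.prems(3)], rule exI[of _ "\<lambda>_. {}"]) (simp add: \<open>r = 0\<close>)
      next
        case (Suc w)
        then have "F1 = {g \<in> F. xr g \<le> w}" by (auto simp: F1_def)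
        then have "heavy w" using D by (simp add: heavy_def)
        then show ?thesis using Suc Least_le[of heavy w] by (simp add: v_def)
      qed
    qed
    then obtain H1 where H1: "finite H1" "card H1 \<le> r" "\<forall>g \<in> F1. \<exists>h \<in> H1. yl g \<le> h \<and> h \<le> yr g"
      using pierce_intervals[of F1 yl yr r] Suc.prems by (auto simp: F1_def)
    have "\<not> (\<exists>G. (\<forall>i < s. G i \<subseteq> F2 \<and> card (G i) = r \<and> pairwise (apart yl yr) (G i)) \<and>
              (\<forall>j < s. \<forall>i < j. \<forall>g \<in> G i. \<forall>g' \<in> G j. xr g < xl g'))"
    proof
      assume "\<exists>G. (\<forall>i < s. G i \<subseteq> F2 \<and> card (G i) = r \<and> pairwise (apart yl yr) (G i)) \<and>
              (\<forall>j < s. \<forall>i < j. \<forall>g \<in> G i. \<forall>g' \<in> G j. xr g < xl g')"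
      then obtain G where G0: "(\<forall>i < s. G i \<subseteq> F2 \<and> card (G i) = r \<and> pairwise (apart yl yr) (G i)) \<and>
              (\<forall>j < s. \<forall>i < j. \<forall>g \<in> G i. \<forall>g' \<in> G j. xr g < xl g')" ..
      then have G: "G i \<subseteq> F2 \<and> card (G i) = r \<and> pairwise (apart yl yr) (G i)" if "i < s" for i
        using that by simp
      from G0 have Gx: "xr g < xl g'" if "j < s" "i < j" "g \<in> G i" "g' \<in> G j" for i j g g'
        using that by simp
      obtain D where D: "D \<subseteq> {g \<in> F. xr g \<le> v}" "card D = r" "pairwise (apart yl yr) D"
        using v unfolding heavy_def by blast
      \<comment> \<open>The group at which the sweep stopped is put in front of the groups found
        beyond \<open>v\<close>.\<close>
      define G' where "G' = case_nat D G"
      have "G' i \<subseteq> F \<and> card (G' i) = r \<and> pairwise (apart yl yr) (G' i)" if "i < Suc s" for i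
        using that D G[of "i - 1"] by (cases i) (auto simp: G'_def F2_def)
      moreover have "xr g < xl g'" if "j < Suc s" "i < j" "g \<in> G' i" "g' \<in> G' j" for i j g g'
      proof -
        obtain j' where j': "j = Suc j'" using \<open>i < j\<close> by (cases j) auto
        then have g': "g' \<in> G j'" "j' < s" using that by (auto simp: G'_def)
        show ?thesis
        proof (cases i)
          case 0
          then have "xr g \<le> v" using that D by (auto simp: G'_def)
          then show ?thesis using g' G[of j'] by (auto simp: F2_def)
        next
          case (Suc i')
          then show ?thesis using that j' g' Gx[of j' i' g g'] by (auto simp: G'_def)
        qed
      qed
      ultimately show False using Suc.prems(3) by blast
    qed
    then obtain V H where VH: "finite V" "finite H" "card V \<le> s" "card H \<le> s * r"
      "\<forall>g \<in> F2. (\<exists>v \<in> V. xl g \<le> v \<and> v \<le> xr g) \<or> (\<exists>h \<in> H. yl g \<le> h \<and> h \<le> yr g)"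
      using Suc.IH[of F2] Suc.prems(1,2) unfolding F2_def by auto
    show ?thesis
    proof (rule exI[of _ "insert v V"], rule exI[of _ "H1 \<union> H"], intro conjI ballI)
      show "card (insert v V) \<le> Suc s" using VH by (simp add: card_insert_if)
      show "card (H1 \<union> H) \<le> Suc s * r" using VH H1 card_Un_le[of H1 H] by simp
      fix g assume g: "g \<in> F"
      consider "g \<in> F1" | "g \<in> F2" | "xl g \<le> v" "v \<le> xr g"
        using g unfolding F1_def F2_def by fastforce
      then show "(\<exists>v \<in> insert v V. xl g \<le> v \<and> v \<le> xr g) \<or> (\<exists>h \<in> H1 \<union> H. yl g \<le> h \<and> h \<le> yr g)"
        using H1(3) VH(5) by cases blast+
    qed (use VH H1 in auto)
  qed
qed

text \<open>From \<open>r\<close> groups side by side, each of \<open>r\<close> boxes with disjoint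
  vertical projections, one box per group can be chosen such that the chosen vertical projections
  are disjoint as well. The horizontal ones are disjoint because the groups are, so the forbidden
  set of \<open>r\<close> boxes arises.\<close>

lemma pierce_boxes:
  fixes xl xr yl yr :: "'a \<Rightarrow> nat"
  assumes "finite F" "\<forall>g \<in> F. xl g \<le> xr g \<and> yl g \<le> yr g"
    and no: "\<not> (\<exists>D \<subseteq> F. card D = r \<and> pairwise (apart xl xr) D \<and> pairwise (apart yl yr) D)"
  shows "\<exists>V H. finite V \<and> finite H \<and> card V \<le> r \<and> card H \<le> r * r \<and>
           (\<forall>g \<in> F. (\<exists>v \<in> V. xl g \<le> v \<and> v \<le> xr g) \<or> (\<exists>h \<in> H. yl g \<le> h \<and> h \<le> yr g))"
proof (rule pierce_strips[OF assms(1,2)])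
  show "\<not> (\<exists>G. (\<forall>i < r. G i \<subseteq> F \<and> card (G i) = r \<and> pairwise (apart yl yr) (G i)) \<and>
              (\<forall>j < r. \<forall>i < j. \<forall>g \<in> G i. \<forall>g' \<in> G j. xr g < xl g'))"
  proof
    assume "\<exists>G. (\<forall>i < r. G i \<subseteq> F \<and> card (G i) = r \<and> pairwise (apart yl yr) (G i)) \<and>
              (\<forall>j < r. \<forall>i < j. \<forall>g \<in> G i. \<forall>g' \<in> G j. xr g < xl g')"
    then obtain G where G0: "(\<forall>i < r. G i \<subseteq> F \<and> card (G i) = r \<and> pairwise (apart yl yr) (G i)) \<and>
              (\<forall>j < r. \<forall>i < j. \<forall>g \<in> G i. \<forall>g' \<in> G j. xr g < xl g')" ..
    then have G: "G i \<subseteq> F \<and> card (G i) = r \<and> pairwise (apart yl yr) (G i)" if "i < r" for i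
      using that by simp
    from G0 have Gx: "xr g < xl g'" if "j < r" "i < j" "g \<in> G i" "g' \<in> G j" for i j g g'
      using that by simp
    have "\<exists>s. (\<forall>i \<in> {..<r}. s i \<in> G i) \<and>
        (\<forall>i \<in> {..<r}. \<forall>j \<in> {..<r}. i \<noteq> j \<longrightarrow> apart yl yr (s i) (s j))"
    proof (rule apart_representatives)
      show "\<forall>i \<in> {..<r}. finite (G i) \<and> card {..<r} \<le> card (G i) \<and> pairwise (apart yl yr) (G i)"
        using G assms(1) finite_subset by fastforce
      show "\<forall>i \<in> {..<r}. \<forall>g \<in> G i. yl g \<le> yr g" using G assms(2) by blast
    qed simp
    then obtain s where s: "\<And>i. i < r \<Longrightarrow> s i \<in> G i"
      "\<And>i j. i < r \<Longrightarrow> j < r \<Longrightarrow> i \<noteq> j \<Longrightarrow> apart yl yr (s i) (s j)" by auto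
    have ax: "apart xl xr (s i) (s j)" if "i < r" "j < r" "i \<noteq> j" for i j
      using Gx[of i j "s j" "s i"] Gx[of j i "s i" "s j"] s(1) that by (meson linorder_neqE_nat)
    have inF: "s i \<in> F" if "i < r" for i using G s(1) that by blast
    have "inj_on s {..<r}"
    proof (rule inj_onI, rule ccontr)
      fix i j assume ij: "i \<in> {..<r}" "j \<in> {..<r}" "s i = s j" "i \<noteq> j"
      then have "apart xl xr (s i) (s i)" using ax[of i j] by simp
      then show False using inF[of i] ij(1) assms(2) by fastforce
    qed
    then have "card (s ` {..<r}) = r" by (simp add: card_image)
    moreover have "pairwise (apart xl xr) (s ` {..<r})" "pairwise (apart yl yr) (s ` {..<r})"
      using ax s(2) unfolding pairwise_def by blast+
    moreover have "s ` {..<r} \<subseteq> F" using inF by blast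
    ultimately show False using no by blast
  qed
qed

section \<open>Classes that are not monotone griddable\<close>

lemma contained_two:
  assumes "[a, b] \<preceq> \<alpha>" "a \<noteq> b"
  shows "\<exists>i j. i < j \<and> j < length \<alpha> \<and> (a < b \<longleftrightarrow> \<alpha> ! i < \<alpha> ! j) \<and> (b < a \<longleftrightarrow> \<alpha> ! j < \<alpha> ! i)"
proof -
  obtain \<sigma> where \<sigma>: "subseq \<sigma> \<alpha>" "order_iso \<sigma> [a, b]"
    using assms(1) unfolding contained_def by blast
  then have l: "length \<sigma> = 2" by (simp add: order_iso_def)
  obtain g where g: "\<forall>i < length \<sigma>. g i < length \<alpha> \<and> \<alpha> ! g i = \<sigma> ! i"
      "\<forall>i j. i < j \<longrightarrow> j < length \<sigma> \<longrightarrow> g i < g j" using subseq_index[OF \<sigma>(1)] by blast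
  have "\<sigma> ! 0 < \<sigma> ! 1 \<longleftrightarrow> a < b" "\<sigma> ! 1 < \<sigma> ! 0 \<longleftrightarrow> b < a"
    using \<sigma>(2) l unfolding order_iso_def
    by (metis (no_types, lifting) nth_Cons_0 nth_Cons_Suc One_nat_def less_2_cases_iff)+
  then show ?thesis using g l by (intro exI[of _ "g 0"] exI[of _ "g 1"]) auto
qed

lemma std_in_Av_21:
  assumes "distinct ys" "\<And>i j. i < j \<Longrightarrow> j < length ys \<Longrightarrow> \<not> ys ! j < ys ! i"
  shows "std ys \<in> Av [2, 1]"
  using std_in_perms[OF assms(1)] contained_two[of 2 1 "std ys"] assms(2)
  unfolding Av_def by (auto simp: std_nth_less_iff)

lemma std_in_Av_12:
  assumes "distinct ys" "\<And>i j. i < j \<Longrightarrow> j < length ys \<Longrightarrow> \<not> ys ! i < ys ! j"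
  shows "std ys \<in> Av [1, 2]"
  using std_in_perms[OF assms(1)] contained_two[of 1 2 "std ys"] assms(2)
  unfolding Av_def by (auto simp: std_nth_less_iff)

lemma order_iso_trans: "order_iso xs ys \<Longrightarrow> order_iso ys zs \<Longrightarrow> order_iso xs zs"
  by (auto simp: order_iso_def)

lemma contained_trans:
  assumes "\<alpha> \<preceq> \<beta>" "\<beta> \<preceq> \<gamma>"
  shows "\<alpha> \<preceq> \<gamma>"
proof -
  obtain \<sigma> where \<sigma>: "subseq \<sigma> \<beta>" "order_iso \<sigma> \<alpha>" using assms(1) unfolding contained_def by blast
  obtain \<rho> where \<rho>: "subseq \<rho> \<gamma>" "order_iso \<rho> \<beta>" using assms(2) unfolding contained_def by blast
  obtain g where g: "\<And>i. i < length \<sigma> \<Longrightarrow> g i < length \<beta> \<and> \<beta> ! g i = \<sigma> ! i"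
      "\<And>i j. i < j \<Longrightarrow> j < length \<sigma> \<Longrightarrow> g i < g j" using subseq_index[OF \<sigma>(1)] by blast
  have len: "length \<rho> = length \<beta>" using \<rho>(2) by (simp add: order_iso_def)
  let ?\<tau> = "map ((!) \<rho>) (map g [0..<length \<sigma>])"
  have "subseq ?\<tau> \<rho>"
    using g len by (intro subseq_map_nth) (auto simp: sorted_wrt_iff_nth_less)
  then have "subseq ?\<tau> \<gamma>" using \<rho>(1) by (rule subseq_order.trans)
  moreover have "order_iso ?\<tau> \<sigma>"
    using \<rho>(2) g len unfolding order_iso_def by auto
  ultimately show ?thesis unfolding contained_def using order_iso_trans \<sigma>(2) by blast
qed

lemma perm_class_Av: "perm_class (Av \<beta>)"
  unfolding perm_class_def Av_def using contained_trans by blast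

lemma infinite_if_unbounded_length:
  assumes "\<And>n. \<exists>xs \<in> A. length xs = n"
  shows "infinite A"
proof
  assume "finite A"
  then have "finite (length ` A)" by (rule finite_imageI)
  moreover have "length ` A = UNIV" using assms by (auto simp: set_eq_iff) (metis imageI)
  ultimately show False by simp
qed

lemma infinite_Av_two:
  shows "infinite (Av [2, 1])" "infinite (Av [1, 2])"
proof -
  have "std [0..<n] \<in> Av [2, 1]" for n
    by (rule std_in_Av_21) auto
  then show "infinite (Av [2, 1])"
    by (intro infinite_if_unbounded_length bexI[of _ "std [0..<_]"]) simp_all
  have "std (rev [0..<n]) \<in> Av [1, 2]" for n
    by (rule std_in_Av_12) (auto simp: rev_nth)
  then show "infinite (Av [1, 2])"
    by (intro infinite_if_unbounded_length bexI[of _ "std (rev [0..<_])"]) simp_all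
qed

text \<open>Missing cuts are replaced by copies of the right border \<open>L\<close>, so the number
  of strips depends on \<open>K\<close> alone. This keeps the size of the gridding the same for all
  permutations of a class.\<close>

lemma cut_function:
  assumes "V \<subseteq> {..L}" "card V \<le> K"
  shows "\<exists>c :: nat \<Rightarrow> nat. c 0 = 0 \<and> c (Suc K) = L \<and> mono c \<and> (\<forall>v \<in> V. \<exists>i \<le> Suc K. c i = v)"
proof -
  let ?xs = "sorted_list_of_set V"
  have fin: "finite V" using assms(1) finite_subset by blast
  define c where "c i = (if i = 0 then 0 else if i \<le> card V then ?xs ! (i - 1) else L)" for i
  have mem: "?xs ! k \<in> V" if "k < card V" for k
    using nth_mem[of k ?xs] that fin by simp
  have "mono c"
  proof (rule monoI)
    fix x y :: nat assume "x \<le> y"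
    then have "?xs ! (x - 1) \<le> ?xs ! (y - 1)" if "y \<le> card V" "x \<noteq> 0"
      using that sorted_nth_mono[OF sorted_sorted_list_of_set, of "x - 1" "y - 1" V] by simp
    then show "c x \<le> c y" using mem[of "x - 1"] assms(1) \<open>x \<le> y\<close> by (auto simp: c_def subset_iff)
  qed
  moreover have "\<exists>i \<le> Suc K. c i = v" if "v \<in> V" for v
  proof -
    obtain k where "k < card V" "?xs ! k = v"
      using \<open>v \<in> V\<close> fin in_set_conv_nth[of v ?xs] by auto
    then show ?thesis using assms(2) by (intro exI[of _ "Suc k"]) (auto simp: c_def)
  qed
  moreover have "c 0 = 0" "c (Suc K) = L" using assms(2) by (auto simp: c_def)
  ultimately show ?thesis by blast
qed

text \<open>Cuts on both sides of a piercing line squeeze every strip that it meets to one position.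
  Such a strip cannot contain an ascent or a descent.\<close>

lemma cut_isolates:
  fixes c :: "nat \<Rightarrow> nat"
  assumes "mono c" "c k = v" "c l = Suc v" "c i \<le> v" "v < c (Suc i)"
  shows "c i = v \<and> c (Suc i) = Suc v"
proof -
  have "i < l" using assms by (metis Suc_n_not_le_n leI le_trans monoD)
  then have "c (Suc i) \<le> Suc v" using assms(1,3) by (metis Suc_leI monoD)
  moreover have "k \<le> i" using assms(1,2,5) by (metis Suc_leI leI leD monoD)
  then have "v \<le> c i" using assms(1,2) by (metis monoD)
  ultimately show ?thesis using assms by simp
qed

text \<open>The matrix must not depend on the permutation, so it has one block of columns for each way to
  choose the types of the cells; all points are put into the appropriate block.\<close>

lemma gridding_into_assignment_blocks:
  assumes "0 < m" "0 < n"
    and "\<And>\<pi>. \<pi> \<in> C \<Longrightarrow> \<pi> \<in> perms \<and> (\<exists>c r N. matrix_gridding m n N \<pi> c r \<and>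
           (\<forall>i < m. \<forall>j < n. N i j \<in> {Av [2, 1], Av [1, 2]}))"
  shows "monotone_griddable C"
proof -
  define A where "A = Pow ({..<m} \<times> {..<n})"
  have "finite A" by (simp add: A_def)
  then obtain h where h: "bij_betw h {0..<card A} A" using ex_bij_betw_nat_finite by blast
  have pos: "0 < card A" by (auto simp: A_def card_Pow)
  \<comment> \<open>Column \<open>l\<close> is column \<open>l mod m\<close> of block
    \<open>l div m\<close>, and block \<open>a\<close> realises the assignment \<open>h a\<close>:
    its pairs are the increasing cells.\<close>
  define N where "N l j = (if (l mod m, j) \<in> h (l div m) then Av [2, 1] else Av [1, 2])" for l j
  have "gridding_matrix (card A * m) n N"
    using assms(1,2) pos perm_class_Av infinite_Av_two by (auto simp: gridding_matrix_def N_def)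
  moreover have "C \<subseteq> Grid (card A * m) n N"
  proof
    fix \<pi> assume "\<pi> \<in> C"
    from assms(3)[OF this] obtain c r N' where N': "\<pi> \<in> perms" "matrix_gridding m n N' \<pi> c r"
      "\<forall>i < m. \<forall>j < n. N' i j \<in> {Av [2, 1], Av [1, 2]}" by blast
    then have "gridding m n \<pi> c r" by (simp add: matrix_gridding_def)
    note \<pi> = N'(1) this N'(2) N'(3)[rule_format]
    have "{(i, j). i < m \<and> j < n \<and> N' i j = Av [2, 1]} \<in> A" by (auto simp: A_def)
    then obtain a where a: "a < card A" "h a = {(i, j). i < m \<and> j < n \<and> N' i j = Av [2, 1]}"
      using bij_betw_imp_surj_on[OF h] by (metis (no_types, lifting) atLeastLessThan_iff imageE)
    \<comment> \<open>Truncated subtraction sends all lines before block \<open>a\<close> to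
      \<open>c 0\<close>, and the minimum sends all lines after it to \<open>c m\<close>; every
      other block gets width zero.\<close>
    define c' where "c' l = c (min (l - a * m) m)" for l
    have c: "c 0 = 0" "c m = length \<pi>" "\<And>i. i < m \<Longrightarrow> c i \<le> c (Suc i)"
      using \<pi>(2) by (auto simp: gridding_def)
    have am: "(a + 1) * m \<le> card A * m" using a(1) by (intro mult_le_mono1) simp
    have "c' l \<le> c' (Suc l)" for l
    proof (cases "a * m \<le> l \<and> l - a * m < m")
      case True
      then show ?thesis using c(3)[of "l - a * m"] by (auto simp: c'_def min_def Suc_diff_le not_le)
    next
      case False
      then consider "Suc l \<le> a * m" | "m \<le> l - a * m" "m \<le> Suc l - a * m" by linarith
      then show ?thesis by cases (simp_all add: c'_def min_absorb2)
    qed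
    moreover have "c' 0 = 0" using c(1) by (simp add: c'_def)
    moreover have "m \<le> card A * m - a * m" using am by (simp add: algebra_simps) 
    then have "c' (card A * m) = length \<pi>" using c(2) by (simp add: c'_def min_absorb2)
    ultimately have "gridding (card A * m) n \<pi> c' r"
      using \<pi>(2) by (simp add: gridding_def)
    moreover have "cell \<pi> c' r l j = [] \<or> (\<exists>\<sigma> \<in> N l j. order_iso (cell \<pi> c' r l j) \<sigma>)"
      if lj: "l < card A * m" "j < n" for l j
    proof (cases "l div m = a")
      case True
      define i where "i = l mod m"
      have i: "i < m" using assms(1) by (simp add: i_def)
      have l: "l = a * m + i" using True div_mult_mod_eq[of l m] unfolding i_def by metis
      have "c' l = c i" "c' (l + 1) = c (i + 1)" using i by (auto simp: c'_def l min_def)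
      then have "cell \<pi> c' r l j = cell \<pi> c r i j" by (simp add: cell_def)
      moreover have "N l j = N' i j"
        using \<pi>(4)[OF i lj(2)] a(2) i lj(2) True by (auto simp: N_def i_def)
      ultimately show ?thesis
        using \<pi>(3) i lj(2) by (simp add: matrix_gridding_def)
    next
      case False
      have "c' l = c' (l + 1)"
      proof (cases "l < a * m")
        case True
        then show ?thesis by (simp add: c'_def)
      next
        case False
        then have "a \<le> l div m" using assms(1) by (simp add: less_eq_div_iff_mult_less_eq)
        then have "a + 1 \<le> l div m" using \<open>l div m \<noteq> a\<close> by simp
        then have "(a + 1) * m \<le> l" using assms(1) by (simp add: less_eq_div_iff_mult_less_eq)
        then have "m \<le> l - a * m" by (simp add: algebra_simps)
        moreover from this have "m \<le> Suc l - a * m" by simp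
        ultimately show ?thesis by (simp add: c'_def min_absorb2)
      qed
      then have "{k. k < length \<pi> \<and> c' l < k + 1 \<and> k + 1 \<le> c' (l + 1) \<and>
                r j < \<pi> ! k \<and> \<pi> ! k \<le> r (j + 1)} = {}" by auto
      then have "cell \<pi> c' r l j = []" unfolding cell_def by (simp only: nths_empty)
      then show ?thesis ..
    qed
    ultimately show "\<pi> \<in> Grid (card A * m) n N"
      using \<pi>(1) unfolding Grid_def matrix_gridding_def by blast
  qed
  ultimately show ?thesis
    unfolding monotone_griddable_def
    by (intro exI[of _ "card A * m"] exI[of _ n] exI[of _ N]) (auto simp: N_def)
qed

section \<open>Boxes that contain both an ascent and a descent\<close>

definition in_box :: "nat list \<Rightarrow> nat \<times> nat \<times> nat \<times> nat \<Rightarrow> nat \<Rightarrow> bool" where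
  "in_box \<pi> = (\<lambda>(x1, x2, y1, y2) i. x1 \<le> i \<and> i \<le> x2 \<and> y1 \<le> \<pi> ! i \<and> \<pi> ! i \<le> y2)"

text \<open>Horizontally a box is given by list positions, which count from 0 and stay below the
  length; vertically it is given by values, which count from 1.\<close>

definition mixed_boxes :: "nat list \<Rightarrow> (nat \<times> nat \<times> nat \<times> nat) set" where
  "mixed_boxes \<pi> = {b \<in> {..length \<pi>} \<times> {..<length \<pi>} \<times> {..length \<pi>} \<times> {..length \<pi>}.
     (\<exists>i j. i < j \<and> in_box \<pi> b i \<and> in_box \<pi> b j \<and> \<pi> ! i < \<pi> ! j) \<and>
     (\<exists>i j. i < j \<and> in_box \<pi> b i \<and> in_box \<pi> b j \<and> \<pi> ! j < \<pi> ! i)}"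

abbreviation "left_of \<equiv> fst :: nat \<times> nat \<times> nat \<times> nat \<Rightarrow> nat"
abbreviation "right_of \<equiv> (\<lambda>b. fst (snd b)) :: nat \<times> nat \<times> nat \<times> nat \<Rightarrow> nat"
abbreviation "bottom_of \<equiv> (\<lambda>b. fst (snd (snd b))) :: nat \<times> nat \<times> nat \<times> nat \<Rightarrow> nat"
abbreviation "top_of \<equiv> (\<lambda>b. snd (snd (snd b))) :: nat \<times> nat \<times> nat \<times> nat \<Rightarrow> nat"

lemma in_boxD:
  "in_box \<pi> b i \<Longrightarrow> left_of b \<le> i \<and> i \<le> right_of b \<and> bottom_of b \<le> \<pi> ! i \<and> \<pi> ! i \<le> top_of b"
  by (auto simp: in_box_def split: prod.splits)

lemma mixed_boxes_finite: "finite (mixed_boxes \<pi>)"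
  unfolding mixed_boxes_def by simp

lemma mixed_boxes_nonempty:
  "b \<in> mixed_boxes \<pi> \<Longrightarrow> left_of b \<le> right_of b \<and> bottom_of b \<le> top_of b \<and> right_of b < length \<pi>"
  by (auto simp: mixed_boxes_def in_box_def split: prod.splits)

lemma embeds_layered_points_boxes:
  assumes \<tau>: "\<tau> \<in> {1, - 1}"
    and mixed: "\<And>k. k \<in> {- int n..int n} \<Longrightarrow> bx k \<in> mixed_boxes \<pi>"
    and x: "\<And>k l. k \<in> {- int n..int n} \<Longrightarrow> l \<in> {- int n..int n} \<Longrightarrow> k < l \<Longrightarrow>
              right_of (bx k) < left_of (bx l)"
    and y: "\<And>k l. k \<in> {- int n..int n} \<Longrightarrow> l \<in> {- int n..int n} \<Longrightarrow> k < l \<Longrightarrow>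
              (\<tau> = 1 \<longrightarrow> top_of (bx k) < bottom_of (bx l)) \<and>
              (\<tau> = - 1 \<longrightarrow> top_of (bx l) < bottom_of (bx k))"
  shows "embeds (layered_points \<tau> n) \<pi>"
proof -
  have "\<forall>k \<in> {- int n..int n}. \<exists>p. fst p < snd p \<and> in_box \<pi> (bx k) (fst p) \<and> in_box \<pi> (bx k) (snd p) \<and>
      \<tau> * int (\<pi> ! snd p) < \<tau> * int (\<pi> ! fst p)"
    using mixed \<tau> unfolding mixed_boxes_def by fastforce
  from bchoice[OF this] obtain p where p: "\<And>k. k \<in> {- int n..int n} \<Longrightarrow> fst (p k) < snd (p k) \<and>
      in_box \<pi> (bx k) (fst (p k)) \<and> in_box \<pi> (bx k) (snd (p k)) \<and>
      \<tau> * int (\<pi> ! snd (p k)) < \<tau> * int (\<pi> ! fst (p k))"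
    by blast
  show ?thesis
  proof (rule embeds_layered_points[OF \<tau>, where a = "\<lambda>k. fst (p k)" and b = "\<lambda>k. snd (p k)"])
    fix k assume k: "k \<in> {- int n..int n}"
    have "snd (p k) < length \<pi>"
      using p[OF k] in_boxD[of \<pi> "bx k" "snd (p k)"] mixed_boxes_nonempty[OF mixed[OF k]] by linarith
    then show "fst (p k) < snd (p k) \<and> snd (p k) < length \<pi> \<and>
         \<tau> * int (\<pi> ! snd (p k)) < \<tau> * int (\<pi> ! fst (p k))" using p[OF k] by blast
    fix l i j
    assume l: "l \<in> {- int n..int n}" "k < l" and ij: "i \<in> {fst (p k), snd (p k)}" "j \<in> {fst (p l), snd (p l)}"
    have "in_box \<pi> (bx k) i" "in_box \<pi> (bx l) j" using ij p[OF k] p[OF l(1)] by auto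
    from in_boxD[OF this(1)] in_boxD[OF this(2)]
    show "i < j \<and> \<tau> * int (\<pi> ! i) < \<tau> * int (\<pi> ! j)"
      using x[OF k l] y[OF k l] \<tau> by auto
  qed
qed

text \<open>Boxes with disjoint projections on both axes are ordered from left to right, and each
  pair goes up or down. By Ramsey's theorem many of them form a chain up or a chain down. A descent
  from each box of the former gives a sum of copies of 21, an ascent from each box of the latter a
  skew sum of copies of 12.\<close>

lemma mixed_boxes_independent:
  assumes C: "perm_class C" "\<pi> \<in> C"
    and n: "perm_of (layered_points 1 n1) \<notin> C" "perm_of (layered_points (- 1) n2) \<notin> C"
    and r: "\<forall>(V :: nat set) E. finite V \<and> r \<le> card V \<longrightarrow>
    (\<exists>R \<subseteq> V. card R = 2 * n1 + 1 \<and> clique R E \<or> card R = 2 * n2 + 1 \<and> indep R E)"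
  shows "\<not> (\<exists>D \<subseteq> mixed_boxes \<pi>. card D = r \<and> pairwise (apart left_of right_of) D \<and>
             pairwise (apart bottom_of top_of) D)"
proof
  assume "\<exists>D \<subseteq> mixed_boxes \<pi>. card D = r \<and> pairwise (apart left_of right_of) D \<and>
             pairwise (apart bottom_of top_of) D"
  then obtain D where D: "D \<subseteq> mixed_boxes \<pi>" "card D = r" "pairwise (apart left_of right_of) D"
             "pairwise (apart bottom_of top_of) D" by blast
  have finD: "finite D" using D(1) mixed_boxes_finite finite_subset by blast
  have ne: "left_of b \<le> right_of b \<and> bottom_of b \<le> top_of b" if "b \<in> D" for b
    using that D(1) mixed_boxes_nonempty by blast
  have inj: "inj_on left_of D"
  proof (rule inj_onI, rule ccontr)
    fix b b' assume b: "b \<in> D" "b' \<in> D" "left_of b = left_of b'" "b \<noteq> b'"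
    then have "apart left_of right_of b b'" using pairwiseD[OF D(3)] by blast
    then show False using b(3) ne[OF b(1)] ne[OF b(2)] by linarith
  qed
  \<comment> \<open>Boxes are represented by their left ends, which are distinct natural numbers;
    edges are the pairs that go up.\<close>
  define E where "E = {{left_of b, left_of b'} | b b'. b \<in> D \<and> b' \<in> D \<and>
    left_of b < left_of b' \<and> top_of b < bottom_of b'}"
  define bx where "bx = inv_into D left_of"
  have bx: "bx x \<in> D \<and> left_of (bx x) = x" if "x \<in> left_of ` D" for x
    using that unfolding bx_def by (meson f_inv_into_f inv_into_into)
  have E: "{x, x'} \<in> E \<longleftrightarrow> top_of (bx x) < bottom_of (bx x')"
    if "x \<in> left_of ` D" "x' \<in> left_of ` D" "x < x'" for x x'
  proof
    assume "{x, x'} \<in> E"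
    then obtain b b' where b: "b \<in> D" "b' \<in> D" "left_of b < left_of b'" "top_of b < bottom_of b'"
      "{x, x'} = {left_of b, left_of b'}" unfolding E_def by blast
    then have "x = left_of b" "x' = left_of b'" using that(3) by (auto simp: doubleton_eq_iff)
    then have "bx x = b" "bx x' = b'" using b inj unfolding bx_def by (auto simp: inv_into_f_f)
    then show "top_of (bx x) < bottom_of (bx x')" using b by simp
  next
    assume "top_of (bx x) < bottom_of (bx x')"
    then show "{x, x'} \<in> E" unfolding E_def using bx[OF that(1)] bx[OF that(2)] that(3)
      by (smt (verit) mem_Collect_eq)
  qed
  have sep: "right_of (bx x) < left_of (bx x') \<and>
      (top_of (bx x) < bottom_of (bx x') \<or> top_of (bx x') < bottom_of (bx x))"
    if "x \<in> left_of ` D" "x' \<in> left_of ` D" "x < x'" for x x'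
  proof -
    have "bx x \<noteq> bx x'" using bx[OF that(1)] bx[OF that(2)] that(3) by force
    then have "apart left_of right_of (bx x) (bx x')" "apart bottom_of top_of (bx x) (bx x')"
      using pairwiseD[OF D(3)] pairwiseD[OF D(4)] bx[OF that(1)] bx[OF that(2)] by blast+
    then show ?thesis using bx[OF that(1)] bx[OF that(2)] ne[of "bx x"] ne[of "bx x'"] that(3) by linarith
  qed
  have "finite (left_of ` D)" "r \<le> card (left_of ` D)" using finD D(2) inj by (auto simp: card_image)
  then obtain R where R: "R \<subseteq> left_of ` D"
    "card R = 2 * n1 + 1 \<and> clique R E \<or> card R = 2 * n2 + 1 \<and> indep R E" using r by blast
  have finR: "finite R" using R(1) finD finite_subset by blast
  from R(2) show False
  proof
    assume c: "card R = 2 * n1 + 1 \<and> clique R E"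
    then obtain e where e: "\<And>k. k \<in> {- int n1..int n1} \<Longrightarrow> e k \<in> R"
      "\<And>k l. k \<in> {- int n1..int n1} \<Longrightarrow> l \<in> {- int n1..int n1} \<Longrightarrow> k < l \<Longrightarrow> e k < e l"
      using symmetric_enumeration[OF finR] by metis
    have "embeds (layered_points 1 n1) \<pi>"
    proof (rule embeds_layered_points_boxes[where bx = "\<lambda>k. bx (e k)"])
      fix k assume k: "k \<in> {- int n1..int n1}"
      then have ek: "e k \<in> left_of ` D" using e(1) R(1) by blast
      then show "bx (e k) \<in> mixed_boxes \<pi>" using bx D(1) by blast
      fix l assume l: "l \<in> {- int n1..int n1}" "k < l"
      have el: "e l \<in> left_of ` D" using l e(1) R(1) by blast
      have kl: "e k < e l" using e(2) k l by blast
      show "right_of (bx (e k)) < left_of (bx (e l))" using sep[OF ek el kl] by blast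
      have "{e k, e l} \<in> E" using c e(1) k l(1) kl by (auto simp: clique_def)
      then show "(1 = (1 :: int) \<longrightarrow> top_of (bx (e k)) < bottom_of (bx (e l))) \<and>
          (1 = (- 1 :: int) \<longrightarrow> top_of (bx (e l)) < bottom_of (bx (e k)))"
        using E[OF ek el kl] by simp
    qed simp
    then show False using n(1) perm_of_in_class[OF C] generic_layered_points by blast
  next
    assume c: "card R = 2 * n2 + 1 \<and> indep R E"
    then obtain e where e: "\<And>k. k \<in> {- int n2..int n2} \<Longrightarrow> e k \<in> R"
      "\<And>k l. k \<in> {- int n2..int n2} \<Longrightarrow> l \<in> {- int n2..int n2} \<Longrightarrow> k < l \<Longrightarrow> e k < e l"
      using symmetric_enumeration[OF finR] by metis
    have "embeds (layered_points (- 1) n2) \<pi>"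
    proof (rule embeds_layered_points_boxes[where bx = "\<lambda>k. bx (e k)"])
      fix k assume k: "k \<in> {- int n2..int n2}"
      then have ek: "e k \<in> left_of ` D" using e(1) R(1) by blast
      then show "bx (e k) \<in> mixed_boxes \<pi>" using bx D(1) by blast
      fix l assume l: "l \<in> {- int n2..int n2}" "k < l"
      have el: "e l \<in> left_of ` D" using l e(1) R(1) by blast
      have kl: "e k < e l" using e(2) k l by blast
      show "right_of (bx (e k)) < left_of (bx (e l))" using sep[OF ek el kl] by blast
      have "{e k, e l} \<notin> E" using c e(1) k l(1) kl by (auto simp: indep_def)
      then show "(- 1 = (1 :: int) \<longrightarrow> top_of (bx (e k)) < bottom_of (bx (e l))) \<and>
          (- 1 = (- 1 :: int) \<longrightarrow> top_of (bx (e l)) < bottom_of (bx (e k)))"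
        using E[OF ek el kl] sep[OF ek el kl] by simp
    qed simp
    then show False using n(2) perm_of_in_class[OF C] generic_layered_points by blast
  qed
qed

lemma not_monotone_griddable_layered_points:
  assumes C: "perm_class C" "\<not> monotone_griddable C"
  shows "\<exists>\<tau> \<in> {1, - 1}. \<forall>n. perm_of (layered_points \<tau> n) \<in> C"
proof (rule ccontr)
  assume "\<not> ?thesis"
  then obtain n1 n2 where n: "perm_of (layered_points 1 n1) \<notin> C" "perm_of (layered_points (- 1) n2) \<notin> C"
    by auto
  obtain r where r: "\<forall>(V :: nat set) E. finite V \<and> r \<le> card V \<longrightarrow>
    (\<exists>R \<subseteq> V. card R = 2 * n1 + 1 \<and> clique R E \<or> card R = 2 * n2 + 1 \<and> indep R E)"
    using ramsey_nat ..
  have "monotone_griddable C"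
  proof (rule gridding_into_assignment_blocks)
    fix \<pi> assume \<pi>C: "\<pi> \<in> C"
    then have \<pi>: "\<pi> \<in> perms" using C(1) by (auto simp: perm_class_def)
    have dist: "distinct \<pi>" using \<pi> by (rule perms_distinct)
    have val: "\<pi> ! k \<le> length \<pi>" if "k < length \<pi>" for k
      using nth_mem[OF that] \<pi> by (auto simp: perms_def permutations_of_set_def dest: distinct_card)
    obtain V H where VH: "finite V" "finite H" "card V \<le> r" "card H \<le> r * r"
      "\<And>b. b \<in> mixed_boxes \<pi> \<Longrightarrow> (\<exists>v \<in> V. left_of b \<le> v \<and> v \<le> right_of b) \<or>
         (\<exists>h \<in> H. bottom_of b \<le> h \<and> h \<le> top_of b)"
      using pierce_boxes[OF mixed_boxes_finite _ mixed_boxes_independent[OF C(1) \<pi>C n r]]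
        mixed_boxes_nonempty by metis
    \<comment> \<open>Position \<open>v\<close> is in column \<open>i\<close> iff
      \<open>c i \<le> v < c (i + 1)\<close>, so cuts at \<open>v\<close> and \<open>v + 1\<close>
      isolate it. Value \<open>h\<close> is in row \<open>j\<close> iff
      \<open>d j < h \<le> d (j + 1)\<close>, so cuts at \<open>h - 1\<close> and \<open>h\<close>
      isolate it.\<close>
    define V' where "V' = (V \<union> Suc ` V) \<inter> {..length \<pi>}"
    define H' where "H' = (H \<union> (\<lambda>h. h - 1) ` H) \<inter> {..length \<pi>}"
    have "card V' \<le> card V + card V"
      unfolding V'_def using VH(1) card_Un_le[of V "Suc ` V"] card_image_le[OF VH(1), of Suc]
        card_mono[of "V \<union> Suc ` V" "(V \<union> Suc ` V) \<inter> {..length \<pi>}"] by simp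
    then have cV: "card V' \<le> 2 * r" using VH(3) by simp
    have "card H' \<le> card H + card H"
      unfolding H'_def using VH(2) card_Un_le[of H "(\<lambda>h. h - 1) ` H"] card_image_le[OF VH(2), of "\<lambda>h. h - 1"]
        card_mono[of "H \<union> (\<lambda>h. h - 1) ` H" "(H \<union> (\<lambda>h. h - 1) ` H) \<inter> {..length \<pi>}"] by simp
    then have cH: "card H' \<le> 2 * (r * r)" using VH(4) by simp
    obtain c where c: "c 0 = 0" "c (Suc (2 * r)) = length \<pi>" "mono c" "\<forall>v \<in> V'. \<exists>i \<le> Suc (2 * r). c i = v"
      using cut_function[OF _ cV] V'_def by blast
    obtain d where d: "d 0 = 0" "d (Suc (2 * (r * r))) = length \<pi>" "mono d" "\<forall>v \<in> H'. \<exists>i \<le> Suc (2 * (r * r)). d i = v"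
      using cut_function[OF _ cH] H'_def by blast
    have grid: "gridding (Suc (2 * r)) (Suc (2 * (r * r))) \<pi> c d"
      using c d by (simp add: gridding_def monoD)
    \<comment> \<open>One ascent decides the type of the cell; \<open>not_both\<close> below then
      excludes any descent in it.\<close>
    define N where "N i j = (if \<exists>k l. k < l \<and> l < length (cell \<pi> c d i j) \<and>
        cell \<pi> c d i j ! k < cell \<pi> c d i j ! l then Av [2, 1] else Av [1, 2])" for i j
    have "\<exists>\<sigma> \<in> N i j. order_iso (cell \<pi> c d i j) \<sigma>"
      if ij: "i < Suc (2 * r)" "j < Suc (2 * (r * r))" for i j
    proof -
      let ?c = "cell \<pi> c d i j"
      let ?K = "{k. k < length \<pi> \<and> c i < k + 1 \<and> k + 1 \<le> c (i + 1) \<and> d j < \<pi> ! k \<and> \<pi> ! k \<le> d (j + 1)}"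
      have cell_sub: "subseq ?c \<pi>" unfolding cell_def subseq_conv_nths by blast
      have dc: "distinct ?c" using dist by (simp add: cell_def)
      obtain g where g: "\<And>k. k < length ?c \<Longrightarrow> g k < length \<pi> \<and> \<pi> ! g k = ?c ! k"
        "\<And>k l. k < l \<Longrightarrow> l < length ?c \<Longrightarrow> g k < g l"
        using subseq_index[of ?c \<pi>] cell_sub by blast
      have gK: "g k \<in> ?K" if "k < length ?c" for k
      proof -
        have "?c ! k \<in> set ?c" using that by simp
        then obtain k' where k': "k' \<in> ?K" "\<pi> ! k' = ?c ! k" "k' < length \<pi>"
          unfolding cell_def set_nths by auto
        then have "g k = k'" using g(1)[OF that] nth_eq_iff_index_eq[OF dist, of "g k" k'] by simp
        then show ?thesis using k'(1) by (simp only:)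
      qed
      have not_both: False
        if kl: "k < l" "l < length ?c" "?c ! k < ?c ! l" and kl': "k' < l'" "l' < length ?c" "?c ! l' < ?c ! k'"
        for k l k' l'
      proof -
        \<comment> \<open>This is the cell itself as a closed box; the offsets differ because
          positions count from 0 and values from 1.\<close>
        define b where "b = (c i, c (i + 1) - 1, d j + 1, d (j + 1))"
        have in_b: "in_box \<pi> b (g x)" if "x < length ?c" for x
          using gK[OF that] by (auto simp: b_def in_box_def)
        have ci: "c i < c (Suc i)" using gK[of l] kl by auto
        have ci': "c (Suc i) \<le> length \<pi>" "d (Suc j) \<le> length \<pi>" "d j < d (Suc j)"
          using monoD[OF c(3), of "Suc i" "Suc (2 * r)"] monoD[OF d(3), of "Suc j" "Suc (2 * (r * r))"]
            c(2) d(2) ij gK[of l] kl by auto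
        have "b \<in> mixed_boxes \<pi>" unfolding mixed_boxes_def
        proof (intro CollectI conjI)
          show "b \<in> {..length \<pi>} \<times> {..<length \<pi>} \<times> {..length \<pi>} \<times> {..length \<pi>}"
            using ci ci' by (auto simp: b_def)
          show "\<exists>i j. i < j \<and> in_box \<pi> b i \<and> in_box \<pi> b j \<and> \<pi> ! i < \<pi> ! j"
            using kl g in_b by (intro exI[of _ "g k"] exI[of _ "g l"]) simp
          show "\<exists>i j. i < j \<and> in_box \<pi> b i \<and> in_box \<pi> b j \<and> \<pi> ! j < \<pi> ! i"
            using kl' g in_b by (intro exI[of _ "g k'"] exI[of _ "g l'"]) simp
        qed
        from VH(5)[OF this] show False
        proof (elim disjE bexE)
          fix v assume v: "v \<in> V" "left_of b \<le> v \<and> v \<le> right_of b"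
          then have "v \<in> V'" "Suc v \<in> V'" using ci ci' by (auto simp: V'_def b_def)
          then obtain x y where xy: "c x = v" "c y = Suc v" using c(4) by blast
          have "c i = v \<and> c (Suc i) = Suc v"
            by (rule cut_isolates[OF c(3) xy]) (use v ci in \<open>auto simp: b_def\<close>)
          then have "g k = v" "g l = v" using gK[of k] gK[of l] kl by auto
          then show False using g(2) kl by force
        next
          fix h assume h: "h \<in> H" "bottom_of b \<le> h \<and> h \<le> top_of b"
          then have "h - 1 \<in> H'" "h \<in> H'" "Suc (h - 1) = h" using ci' by (auto simp: H'_def b_def)
          then obtain x y where xy: "d x = h - 1" "d y = Suc (h - 1)" using d(4) by metis
          have "d j = h - 1 \<and> d (Suc j) = Suc (h - 1)"
            by (rule cut_isolates[OF d(3) xy]) (use h ci' in \<open>auto simp: b_def\<close>)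
          then have "\<pi> ! g k = \<pi> ! g l" using gK[of k] gK[of l] kl by auto
          then show False using g(1) kl by simp
        qed
      qed
      show ?thesis
      proof (cases "\<exists>k l. k < l \<and> l < length ?c \<and> ?c ! k < ?c ! l")
        case True
        then have "std ?c \<in> Av [2, 1]" using not_both dc by (intro std_in_Av_21) blast+
        then show ?thesis using True order_iso_std by (auto simp: N_def)
      next
        case False
        then have "std ?c \<in> Av [1, 2]" using dc by (intro std_in_Av_12) blast+
        then show ?thesis using False order_iso_std by (auto simp: N_def)
      qed
    qed
    then have "matrix_gridding (Suc (2 * r)) (Suc (2 * (r * r))) N \<pi> c d"
      using grid unfolding matrix_gridding_def by blast
    moreover have "N i j \<in> {Av [2, 1], Av [1, 2]}" for i j by (simp add: N_def)
    ultimately show "\<pi> \<in> perms \<and> (\<exists>c d N.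
        matrix_gridding (Suc (2 * r)) (Suc (2 * (r * r))) N \<pi> c d \<and>
           (\<forall>i < Suc (2 * r). \<forall>j < Suc (2 * (r * r)). N i j \<in> {Av [2, 1], Av [1, 2]}))"
      using \<pi> by blast
  qed simp_all
  then show False using C(2) by blast
qed

section \<open>Spirals of points\<close>

text \<open>
  The label \<open>(t, False)\<close> stands for the point at step \<open>t\<close> of the walk \<open>e\<close>, and \<open>(t, True)\<close> for the
  extra point at that step. The Boolean \<open>b\<close> selects the column (\<open>True\<close>) or the row (\<open>False\<close>) of a
  cell. Every column and row is split at its centre into two half lines; \<open>sg b t\<close> is the half used at
  step \<open>t\<close>, \<open>ix b t\<close> the index of the line, and \<open>dep b\<close> the distance of a point from the centre. A
  walk around a cycle with an odd number of decreasing cells returns on the opposite halves, so its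
  period \<open>P\<close> may be twice the length of the cycle.
\<close>

locale spiral =
  fixes e :: "nat \<Rightarrow> nat \<times> nat" and sx :: "nat \<Rightarrow> int" and \<tau> :: "nat \<times> nat \<Rightarrow> int"
    and P tm m n :: nat
  assumes P_pos: "0 < P" and P_even: "even P"
    and e_period: "e (t + P) = e t" and sx_period: "sx (t + P) = sx t"
    and sx_sign: "sx t \<in> {1, - 1}" and \<tau>_sign: "\<tau> c \<in> {1, - 1}"
    and e_bound: "fst (e t) < m" "snd (e t) < n"
    and row_step: "even t \<Longrightarrow> snd (e (Suc t)) = snd (e t) \<and> sx (Suc t) * \<tau> (e (Suc t)) = sx t * \<tau> (e t)"
    and col_step: "odd t \<Longrightarrow> fst (e (Suc t)) = fst (e t) \<and> sx (Suc t) = sx t"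
    and turn: "e t = e (Suc t) \<Longrightarrow> e (Suc t) \<noteq> e (Suc (Suc t))"
    and tm: "tm < P" "e tm \<noteq> e (Suc tm)"
begin

definition sg :: "bool \<Rightarrow> nat \<Rightarrow> int" where
  "sg b t = (if b then sx t else sx t * \<tau> (e t))"

definition ix :: "bool \<Rightarrow> nat \<Rightarrow> nat" where
  "ix b t = (if b then fst (e t) else snd (e t))"

text \<open>All depths of time t lie between 4t + 1 and 4t + 8, and the residues 0, 1, 3 modulo 4
  keep them distinct. The main point of time t has depth 4t + 7 on the line shared with time t + 1,
  whose main point has 4(t + 1) + 1 = 4t + 5 there, and depth 4t + 1 on its other line. The extra
  point, at 4t + 8, is beyond the main point on both lines and closer than everything of time t +
  2.\<close>

definition dep :: "bool \<Rightarrow> nat \<times> bool \<Rightarrow> int" where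
  "dep b z = (if snd z then 4 * int (fst z) + 8
     else if even (fst z) = b then 4 * int (fst z) + 1 else 4 * int (fst z) + 7)"

text \<open>The factor \<open>4 * int N + 10\<close> exceeds every depth at times below
  \<open>N\<close>, so the zones around neighbouring centres do not overlap.\<close>

definition width :: "nat \<Rightarrow> int" where
  "width N = 2 * (4 * int N + 10)"

definition pos :: "nat \<Rightarrow> bool \<Rightarrow> nat \<times> bool \<Rightarrow> int" where
  "pos N b z = width N * int (ix b (fst z)) + sg b (fst z) * dep b z"

definition labels :: "nat \<Rightarrow> nat \<Rightarrow> (nat \<times> bool) set" where
  "labels N s = {(t, q). t < N \<and> (q \<longrightarrow> t mod (s * P) = tm)}"

definition point :: "nat \<Rightarrow> nat \<times> bool \<Rightarrow> int \<times> int" where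
  "point N z = (pos N True z, pos N False z)"

text \<open>The half lines of one direction are numbered in the order of the coordinate, the
  negative half of a line just before its positive half. This makes the number a monotone function
  of position.\<close>

definition half_line :: "bool \<Rightarrow> nat \<Rightarrow> int" where
  "half_line b t = 2 * int (ix b t) + (if sg b t = 1 then 1 else 0)"

lemma P_ge_2: "2 \<le> P"
  using P_pos P_even by (cases "P = 1") auto

lemma sg_sign: "sg b t = 1 \<or> sg b t = - 1"
  using sx_sign[of t] \<tau>_sign[of "e t"] by (auto simp: sg_def)

lemma e_periods: "e (t + k * P) = e t"
proof (induction k)
  case (Suc k)
  then show ?case using e_period[of "t + k * P"] by (simp add: algebra_simps)
qed simp

lemma sx_periods: "sx (t + k * P) = sx t"
proof (induction k)
  case (Suc k)
  then show ?case using sx_period[of "t + k * P"] by (simp add: algebra_simps)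
qed simp

lemma line_periods: "ix b (t + k * P) = ix b t" "sg b (t + k * P) = sg b t"
  by (auto simp: ix_def sg_def e_periods sx_periods)

lemma line_shared: "ix (odd t) (Suc t) = ix (odd t) t" "sg (odd t) (Suc t) = sg (odd t) t"
  using row_step[of t] col_step[of t] by (auto simp: ix_def sg_def)

lemma finite_labels: "finite (labels N s)"
  by (rule finite_subset[of _ "{..<N} \<times> UNIV"]) (auto simp: labels_def)

lemma dep_bounds: "4 * int (fst z) + 1 \<le> dep b z" "dep b z \<le> 4 * int (fst z) + 8"
  by (auto simp: dep_def)

lemma dep_inj:
  assumes "dep b z = dep b z'"
  shows "z = z'"
proof -
  have "(4 * int (fst z) + 8) mod 4 = 0" "(4 * int (fst z) + 1) mod 4 = 1"
    "(4 * int (fst z) + 7) mod 4 = 3" for z :: "nat \<times> bool" by presburger+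
  then have mod: "dep b z mod 4 = (if snd z then 0 else if even (fst z) = b then 1 else 3)" for z
    unfolding dep_def by simp
  have "snd z = snd z'" using mod[of z] mod[of z'] assms by (auto split: if_splits)
  moreover have "fst z = fst z'"
    using mod[of z] mod[of z'] assms by (auto simp: dep_def split: if_splits)
  ultimately show ?thesis by (simp add: prod_eq_iff)
qed

lemma offset_bound:
  assumes "z \<in> labels N s"
  shows "\<bar>sg b (fst z) * dep b z\<bar> < 4 * int N + 10" "0 < dep b z"
proof -
  have "int (fst z) + 1 \<le> int N" using assms by (auto simp: labels_def)
  then show "0 < dep b z" "\<bar>sg b (fst z) * dep b z\<bar> < 4 * int N + 10"
    using dep_bounds(1)[of z b] dep_bounds(2)[of b z] sg_sign[of b "fst z"] by auto
qed

lemma cell_separation: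
  fixes w :: int
  assumes "\<bar>d\<bar> < w" "\<bar>d'\<bar> < w" "2 * w * i + d \<le> 2 * w * i' + d'"
  shows "i \<le> i'"
proof (rule ccontr)
  assume "\<not> i \<le> i'"
  then have "i' + 1 \<le> i" by simp
  then have "2 * w * (i' + 1) \<le> 2 * w * i" using assms(1) by (intro mult_left_mono) auto
  then show False using assms by (simp add: algebra_simps)
qed

lemma pos_le_ix:
  assumes "z \<in> labels N s" "z' \<in> labels N s" "pos N b z \<le> pos N b z'"
  shows "ix b (fst z) \<le> ix b (fst z')"
proof -
  have "int (ix b (fst z)) \<le> int (ix b (fst z'))"
    by (rule cell_separation[OF offset_bound(1)[OF assms(1), of b] offset_bound(1)[OF assms(2), of b]])
      (use assms(3) in \<open>simp add: pos_def width_def\<close>)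
  then show ?thesis by simp
qed

lemma pos_inj:
  assumes "z \<in> labels N s" "z' \<in> labels N s" "pos N b z = pos N b z'"
  shows "z = z'"
proof -
  have "ix b (fst z) = ix b (fst z')"
    using pos_le_ix[OF assms(1,2), of b] pos_le_ix[OF assms(2,1), of b] assms(3) by simp
  then have "sg b (fst z) * dep b z = sg b (fst z') * dep b z'" using assms(3) by (simp add: pos_def)
  then have "dep b z = dep b z'"
    using sg_sign[of b "fst z"] sg_sign[of b "fst z'"] offset_bound(2)[OF assms(1), of b]
      offset_bound(2)[OF assms(2), of b] by auto
  then show ?thesis by (rule dep_inj)
qed

lemma half_line_mono:
  assumes "z \<in> labels N s" "z' \<in> labels N s" "pos N b z < pos N b z'"
  shows "half_line b (fst z) \<le> half_line b (fst z')"
proof (cases "ix b (fst z) = ix b (fst z')")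
  case True
  then have "sg b (fst z) * dep b z < sg b (fst z') * dep b z'" using assms(3) by (simp add: pos_def)
  then have "\<not> (sg b (fst z) = 1 \<and> sg b (fst z') = - 1)"
    using offset_bound(2)[OF assms(1), of b] offset_bound(2)[OF assms(2), of b] by auto
  then show ?thesis using True sg_sign[of b "fst z"] sg_sign[of b "fst z'"] by (auto simp: half_line_def)
next
  case False
  then have "ix b (fst z) < ix b (fst z')" using pos_le_ix[OF assms(1,2), of b] assms(3) by simp
  then show ?thesis by (auto simp: half_line_def)
qed

lemma half_line_eqD:
  assumes "half_line b t = half_line b t'"
  shows "ix b t = ix b t'" "sg b t = sg b t'"
proof -
  have "even (half_line b t) \<longleftrightarrow> sg b t \<noteq> 1" for t by (simp add: half_line_def)
  then have "sg b t = 1 \<longleftrightarrow> sg b t' = 1" using assms by metis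
  then show "sg b t = sg b t'" "ix b t = ix b t'"
    using sg_sign[of b t] sg_sign[of b t'] assms by (auto simp: half_line_def)
qed

lemma half_line_bounds: "\<bar>half_line b t\<bar> \<le> 2 * int (m + n)"
  using e_bound[of t] by (auto simp: half_line_def ix_def)

lemma generic_points: "generic (point N ` labels N s)"
  unfolding generic_def
proof (intro conjI)
  show "finite (point N ` labels N s)" using finite_labels by simp
  show "inj_on fst (point N ` labels N s)" "inj_on snd (point N ` labels N s)"
    unfolding inj_on_def by (auto simp: point_def dest: pos_inj simp del: split_paired_All)
qed

lemma inj_point: "inj_on (point N) (labels N s)"
  unfolding inj_on_def by (auto simp: point_def dest: pos_inj)

end

section \<open>A spiral cannot be embedded in a sparser one\<close>

text \<open>If the function rose on each of the \<open>2 * B + 1\<close> blocks, it would rise by at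
  least \<open>2 * B + 1\<close> in total, more than its range allows.\<close>

lemma stationary_block:
  fixes \<Phi> :: "nat \<Rightarrow> int"
  assumes mono: "\<And>k l. k \<le> l \<Longrightarrow> l \<le> (2 * B + 1) * w \<Longrightarrow> \<Phi> k \<le> \<Phi> l"
    and bound: "\<And>k. k \<le> (2 * B + 1) * w \<Longrightarrow> \<bar>\<Phi> k\<bar> \<le> int B"
  shows "\<exists>l \<le> 2 * B. \<Phi> (l * w) = \<Phi> (l * w + w)"
proof (rule ccontr)
  assume "\<not> ?thesis"
  then have ne: "\<Phi> (l * w) \<noteq> \<Phi> (l * w + w)" if "l \<le> 2 * B" for l using that by blast
  have "\<Phi> 0 + int l \<le> \<Phi> (l * w)" if "l \<le> 2 * B + 1" for l
    using that
  proof (induction l)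
    case (Suc l)
    have "(l + 1) * w \<le> (2 * B + 1) * w" using Suc.prems by (intro mult_le_mono1) simp
    then have "\<Phi> (l * w) \<le> \<Phi> (l * w + w)" by (intro mono) (auto simp: algebra_simps)
    then have "\<Phi> (l * w) + 1 \<le> \<Phi> (l * w + w)" using ne[of l] Suc.prems by simp
    then show ?case using Suc by (simp add: algebra_simps)
  qed simp
  from this[of "2 * B + 1"] bound[of 0] bound[of "(2 * B + 1) * w"] show False by simp
qed

lemma card_int_window:
  fixes f :: "'a \<Rightarrow> int"
  assumes "inj_on f A" "\<And>z. z \<in> A \<Longrightarrow> u \<le> f z \<and> f z \<le> v"
  shows "card A \<le> nat (v - u + 1)"
proof -
  have "card A = card (f ` A)" using assms(1) by (simp add: card_image)
  also have "\<dots> \<le> card {u..v}" using assms(2) by (intro card_mono) auto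
  finally show ?thesis by simp
qed

context spiral
begin

section \<open>How an embedding acts on half lines and on time\<close>

context
  fixes N s N' s' :: nat and f :: "nat \<times> bool \<Rightarrow> nat \<times> bool"
  assumes f_in: "\<And>z. z \<in> labels N s \<Longrightarrow> f z \<in> labels N' s'"
    and f_mono: "\<And>b z z'. z \<in> labels N s \<Longrightarrow> z' \<in> labels N s \<Longrightarrow>
      pos N b z < pos N b z' \<Longrightarrow> pos N' b (f z) < pos N' b (f z')"
begin

definition image_line :: "bool \<Rightarrow> nat \<times> bool \<Rightarrow> int" where
  "image_line b z = half_line b (fst (f z))"

text \<open>The value is 1 if leaving the centre along the half line is mapped to leaving the centre
  of the image line, and -1 if it is mapped to approaching it. The latter is what reverses
  time.\<close>

definition orientation :: "bool \<Rightarrow> nat \<times> bool \<Rightarrow> int" where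
  "orientation b z = sg b (fst z) * sg b (fst (f z))"

lemma orientation_sign: "orientation b z = 1 \<or> orientation b z = - 1"
  using sg_sign[of b "fst z"] sg_sign[of b "fst (f z)"] by (auto simp: orientation_def)

definition same_line :: "bool \<Rightarrow> nat \<times> bool \<Rightarrow> nat \<times> bool \<Rightarrow> bool" where
  "same_line b z z' \<longleftrightarrow> ix b (fst z) = ix b (fst z') \<and> sg b (fst z) = sg b (fst z')"

lemma pos_less_on_line:
  assumes "same_line b z z'" "dep b z < dep b z'"
  shows "if sg b (fst z) = 1 then pos N b z < pos N b z' else pos N b z' < pos N b z"
  using assms sg_sign[of b "fst z"] by (auto simp: same_line_def pos_def)

text \<open>Along a half line the coordinate is monotone in the depth, with direction
  \<open>sg\<close>. The map keeps the order of coordinates, and half lines are numbered in that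
  order.\<close>

lemma image_line_mono:
  assumes "z \<in> labels N s" "z' \<in> labels N s" "same_line b z z'" "dep b z \<le> dep b z'"
  shows "sg b (fst z) * image_line b z \<le> sg b (fst z) * image_line b z'"
proof (cases "z = z'")
  case False
  then have "dep b z < dep b z'" unfolding less_le using assms(4) dep_inj[of b z z'] by blast
  note * = pos_less_on_line[OF assms(3) this]
  show ?thesis
  proof (cases "sg b (fst z) = 1")
    case True
    then have "pos N' b (f z) < pos N' b (f z')" using * f_mono[OF assms(1,2)] by simp
    from half_line_mono[OF f_in[OF assms(1)] f_in[OF assms(2)] this]
    show ?thesis using True by (simp add: image_line_def)
  next
    case False
    then have "pos N' b (f z') < pos N' b (f z)" using * f_mono[OF assms(2,1)] by simp
    from half_line_mono[OF f_in[OF assms(2)] f_in[OF assms(1)] this]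
    show ?thesis using False sg_sign[of b "fst z"] by (simp add: image_line_def)
  qed
qed simp

lemma image_line_between:
  assumes "z1 \<in> labels N s" "z \<in> labels N s" "z2 \<in> labels N s" "same_line b z1 z" "same_line b z z2"
    and "dep b z1 \<le> dep b z" "dep b z \<le> dep b z2" "image_line b z1 = image_line b z2"
  shows "image_line b z = image_line b z1"
  using image_line_mono[OF assms(1,2,4,6)] image_line_mono[OF assms(2,3,5,7)] assms(4,8)
    sg_sign[of b "fst z"] by (auto simp: same_line_def)

lemma dep_image_less:
  assumes "z \<in> labels N s" "z' \<in> labels N s" "same_line b z z'" "dep b z < dep b z'"
    and "image_line b z = image_line b z'"
  shows "orientation b z = orientation b z'"
    "orientation b z * dep b (f z) < orientation b z * dep b (f z')"
proof -
  have h: "ix b (fst (f z)) = ix b (fst (f z'))" "sg b (fst (f z)) = sg b (fst (f z'))"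
    using half_line_eqD assms(5) unfolding image_line_def by blast+
  then show "orientation b z = orientation b z'" using assms(3) by (simp add: orientation_def same_line_def)
  have "pos N' b (f z) < pos N' b (f z') \<longleftrightarrow>
      sg b (fst (f z)) * dep b (f z) < sg b (fst (f z)) * dep b (f z')"
     "pos N' b (f z') < pos N' b (f z) \<longleftrightarrow>
      sg b (fst (f z)) * dep b (f z') < sg b (fst (f z)) * dep b (f z)"
    using h by (simp_all add: pos_def)
  then show "orientation b z * dep b (f z) < orientation b z * dep b (f z')"
    using pos_less_on_line[OF assms(3,4)] f_mono[OF assms(1,2), of b] f_mono[OF assms(2,1), of b]
      sg_sign[of b "fst z"] sg_sign[of b "fst (f z)"]
    by (auto simp: orientation_def)
qed

text \<open>This is the speed limit: depths of time u lie between 4u + 1 and 4u + 8, so a point of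
  smaller depth has a time larger by at most 1.\<close>

lemma index_image_le:
  assumes "orientation b z * dep b (f z) < orientation b z * dep b (f z')"
  shows "orientation b z * int (fst (f z)) \<le> orientation b z * int (fst (f z')) + 1"
  using assms orientation_sign[of b z] dep_bounds(1)[of "f z" b] dep_bounds(2)[of b "f z"]
    dep_bounds(1)[of "f z'" b] dep_bounds(2)[of b "f z'"] by auto

lemma main_label: "(t, False) \<in> labels N s \<longleftrightarrow> t < N"
  by (simp add: labels_def)

lemma same_line_periods: "same_line b (t, q) (t + k * P, q')"
  by (simp add: same_line_def line_periods)

lemma same_line_next: "same_line (odd t) (Suc t, q) (t + k * P, q')"
  using line_shared[of t] by (simp add: same_line_def line_periods)

lemma same_line_sym: "same_line b z z' \<Longrightarrow> same_line b z' z"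
  by (simp add: same_line_def)

lemma inj_f: "inj_on f (labels N s)"
proof (rule inj_onI, rule ccontr)
  fix z z' assume z: "z \<in> labels N s" "z' \<in> labels N s" "f z = f z'" "z \<noteq> z'"
  then have "pos N True z \<noteq> pos N True z'" using pos_inj by blast
  then show False using f_mono[OF z(1,2), of True] f_mono[OF z(2,1), of True] z(3) by fastforce
qed

text \<open>For each residue of time modulo \<open>P\<close>, the image half lines over successive
  periods form a bounded sequence, increasing once multiplied by the sign of the source half line.
  The sum of these \<open>P\<close> sequences is constant on some block of \<open>w\<close> periods,
  and since all summands increase, they are all constant there at once.\<close>

lemma stationary_stretch:
  assumes N: "((4 * (m + n) * P + 1) * w + 1) * P \<le> N"
  shows "\<exists>a. a + (w + 1) * P \<le> N \<and> (\<forall>t k. a \<le> t \<longrightarrow> t + k * P < a + (w + 1) * P \<longrightarrow>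
    image_line (odd t) (t + k * P, False) = image_line (odd t) (t, False))"
proof -
  let ?B = "2 * (m + n) * P"
  let ?K = "(2 * ?B + 1) * w"
  define g where "g r k = sg (odd r) r * image_line (odd r) (r + k * P, False)" for r k
  define \<Phi> where "\<Phi> k = (\<Sum>r<P. g r k)" for k
  have inN: "r + k * P < N" if "r < P" "k \<le> ?K" for r k
  proof -
    have "r + k * P < (k + 1) * P" using that(1) by simp
    also have "\<dots> \<le> (?K + 1) * P" using that(2) by (intro mult_le_mono1) simp
    also have "\<dots> \<le> N" using N by (simp add: algebra_simps)
    finally show ?thesis .
  qed
  have g_mono: "g r k \<le> g r l" if "r < P" "k \<le> l" "l \<le> ?K" for r k l
  proof -
    have "l = k + (l - k)" using that(2) by simp
    then have "r + l * P = (r + k * P) + (l - k) * P" by (metis add.assoc add_mult_distrib)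
    then have sl: "same_line (odd r) (r + k * P, False) (r + l * P, False)"
      using same_line_periods by metis
    have "even (r + k * P) = even r" "even (r + l * P) = even r" using P_even by auto
    moreover have "int k * int P \<le> int l * int P" using that(2) by (simp add: mult_right_mono)
    ultimately have "dep (odd r) (r + k * P, False) \<le> dep (odd r) (r + l * P, False)"
      by (simp add: dep_def)
    moreover have "(r + k * P, False) \<in> labels N s" "(r + l * P, False) \<in> labels N s"
      using inN that by (auto simp: main_label)
    ultimately show ?thesis
      using sl image_line_mono[of "(r + k * P, False)" "(r + l * P, False)" "odd r"]
      by (simp add: g_def line_periods)
  qed
  have "\<exists>l \<le> 2 * ?B. \<Phi> (l * w) = \<Phi> (l * w + w)"
  proof (rule stationary_block)
    fix k l assume "k \<le> l" "l \<le> ?K"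
    then show "\<Phi> k \<le> \<Phi> l" unfolding \<Phi>_def by (intro sum_mono g_mono) auto
  next
    fix k assume k: "k \<le> ?K"
    have "\<bar>\<Phi> k\<bar> \<le> (\<Sum>r<P. \<bar>g r k\<bar>)" unfolding \<Phi>_def by (rule sum_abs)
    also have "\<dots> \<le> (\<Sum>r<P. 2 * int (m + n))"
    proof (rule sum_mono)
      fix r
      show "\<bar>g r k\<bar> \<le> 2 * int (m + n)"
        using half_line_bounds[of "odd r" "fst (f (r + k * P, False))"] sg_sign[of "odd r" r]
        by (auto simp: g_def image_line_def)
    qed
    finally show "\<bar>\<Phi> k\<bar> \<le> int ?B" by (simp add: algebra_simps)
  qed
  then obtain l where l: "l \<le> 2 * ?B" "\<Phi> (l * w) = \<Phi> (l * w + w)" by blast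
  have "(l + 1) * w \<le> ?K" using l(1) by (intro mult_le_mono1) simp
  then have lw: "l * w + w \<le> ?K" by (simp add: algebra_simps)
  have ends: "g r (l * w) = g r (l * w + w)" if "r < P" for r
  proof (rule sum_mono_inv[OF l(2)[unfolded \<Phi>_def]])
    fix i assume "i \<in> {..<P}"
    then show "g i (l * w) \<le> g i (l * w + w)" using g_mono lw by simp
  qed (use that in auto)
  have const: "g r k = g r (l * w)" if "r < P" "l * w \<le> k" "k \<le> l * w + w" for r k
    using g_mono[OF that(1,2) order_trans[OF that(3) lw]] g_mono[OF that(1,3) lw] ends[OF that(1)]
    by linarith
  show ?thesis
  proof (intro exI[of _ "l * w * P"] conjI allI impI)
    have "l * w * P + (w + 1) * P \<le> (?K + 1) * P"
      using lw by (simp flip: add_mult_distrib)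
    also have "\<dots> \<le> N" using N by (simp add: algebra_simps)
    finally show "l * w * P + (w + 1) * P \<le> N" .
  next
    fix t k assume tk: "l * w * P \<le> t" "t + k * P < l * w * P + (w + 1) * P"
    define r where "r = t mod P"
    define i where "i = t div P"
    have t: "t = r + i * P" by (simp add: r_def i_def)
    have r: "r < P" using P_pos by (simp add: r_def)
    have i: "l * w \<le> i" unfolding i_def using tk(1) P_pos by (simp add: less_eq_div_iff_mult_less_eq)
    have "(i + k) * P < (l * w + w + 1) * P" using tk(2) unfolding t by (simp add: algebra_simps)
    then have "i + k < l * w + w + 1" using mult_less_cancel2 by blast
    then have ik: "i + k \<le> l * w + w" by simp
    have "g r i = g r (l * w)"
      by (rule const[OF r]) (use i ik in linarith)+
    moreover have "g r (i + k) = g r (l * w)"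
      by (rule const[OF r]) (use i ik in linarith)+
    ultimately have "sg (odd r) r * image_line (odd r) (r + (i + k) * P, False) =
        sg (odd r) r * image_line (odd r) (r + i * P, False)" unfolding g_def by (rule trans[OF _ sym, rotated])
    then have "image_line (odd r) (r + (i + k) * P, False) = image_line (odd r) (r + i * P, False)"
      using sg_sign[of "odd r" r] by auto
    moreover have "odd t = odd r" using P_even t by simp
    moreover have "t + k * P = r + (i + k) * P" unfolding t by (simp add: algebra_simps)
    ultimately show "image_line (odd t) (t + k * P, False) = image_line (odd t) (t, False)"
      using t by metis
  qed
qed

text \<open>Let L be the length of a stretch on which half lines are respected. The times of its
  image lie in a window of L + 2P + 3 integers, shorter than \<open>s' * P\<close>, so the window
  has at most L + 2P + 3 main labels and one extra label. The stretch has L main labels and at least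
  2P + 5 extra ones: it covers \<open>2 * P + 6\<close> periods of length \<open>s * P\<close>, one
  of which may be lost at the boundary.\<close>

lemma no_order_preserving_map:
  assumes s: "0 < s" and s': "(2 * P + 6) * s + 6 \<le> s'"
    and N: "((4 * (m + n) * P + 1) * ((2 * P + 6) * s + 12) + 1) * P \<le> N"
  shows False
proof -
  define L where "L = (2 * P + 6) * s * P"
  obtain a0 where a0: "a0 + ((2 * P + 6) * s + 12 + 1) * P \<le> N"
    "\<And>t k. a0 \<le> t \<Longrightarrow> t + k * P < a0 + ((2 * P + 6) * s + 12 + 1) * P \<Longrightarrow>
      image_line (odd t) (t + k * P, False) = image_line (odd t) (t, False)"
    using stationary_stretch[OF N] by blast
  \<comment> \<open>One period is reserved before \<open>a\<close> for comparing time t with t - P,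
    and twelve periods remain after \<open>c\<close>, enough for the eight periods used by
    \<open>grow\<close>.\<close>
  define a where "a = a0 + P"
  define c where "c = a + L"
  have len: "a0 + ((2 * P + 6) * s + 12 + 1) * P = c + 12 * P"
    by (simp add: a_def c_def L_def algebra_simps)
  have in_N: "(t, False) \<in> labels N s" if "t < c + 12 * P" for t
    using that a0(1) len by (simp add: main_label)
  have const: "image_line (odd t) (t + k * P, False) = image_line (odd t) (t, False)"
    if "a0 \<le> t" "t + k * P < c + 12 * P" for t k using a0(2) that len by simp
  \<comment> \<open>On the line shared by times t and t + 1, the point of time t + 1 lies in depth
    between those of times t - P and t, which are known to have the same image half line.\<close>
  have next_line: "image_line (odd t) (Suc t, False) = image_line (odd t) (t, False)"
    if t: "a \<le> t" "Suc t < c + 12 * P" for t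
  proof -
    define u where "u = t - P"
    have u: "t = u + P" "a0 \<le> u" using t by (auto simp: u_def a_def)
    have par: "odd u = odd t" using P_even u by simp
    have il: "image_line (odd t) (t, False) = image_line (odd t) (u, False)"
      using const[of u 1] u t par by simp
    have "image_line (odd t) (Suc t, False) = image_line (odd t) (u, False)"
    proof (rule image_line_between)
      show "same_line (odd t) (u, False) (Suc t, False)"
        using same_line_sym[OF same_line_next[of t False 0 False]] same_line_periods[of "odd t" u False 1 False] u
        by (simp add: same_line_def)
      show "same_line (odd t) (Suc t, False) (t, False)" using same_line_next[of t False 0 False] by simp
      show "dep (odd t) (u, False) \<le> dep (odd t) (Suc t, False)"
        "dep (odd t) (Suc t, False) \<le> dep (odd t) (t, False)"
        using u par P_ge_2 by (auto simp: dep_def)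
    qed (use in_N t u il in auto)
    then show ?thesis using il by simp
  qed
  define \<epsilon> where "\<epsilon> t = orientation (odd t) (t, False)" for t
  define idx where "idx t = int (fst (f (t, False)))" for t
  have \<epsilon>_sign: "\<epsilon> t = 1 \<or> \<epsilon> t = - 1" for t unfolding \<epsilon>_def by (rule orientation_sign)
  have step: "\<epsilon> t * idx (Suc t) \<le> \<epsilon> t * idx t + 1" "orientation (odd t) (Suc t, False) = \<epsilon> t"
    if t: "a \<le> t" "Suc t < c + 12 * P" for t
  proof -
    have sl: "same_line (odd t) (Suc t, False) (t, False)" using same_line_next[of t False 0 False] by simp
    have d: "dep (odd t) (Suc t, False) < dep (odd t) (t, False)" by (auto simp: dep_def)
    have z: "(Suc t, False) \<in> labels N s" "(t, False) \<in> labels N s" using in_N t by auto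
    note * = dep_image_less[OF z sl d next_line[OF t]]
    show "orientation (odd t) (Suc t, False) = \<epsilon> t" using *(1) by (simp add: \<epsilon>_def)
    then show "\<epsilon> t * idx (Suc t) \<le> \<epsilon> t * idx t + 1" using index_image_le[OF *(2)] by (simp add: idx_def)
  qed
  have period: "\<epsilon> t * idx t \<le> \<epsilon> t * idx (t + k * P) + 1"
    if t: "a \<le> t" "t + k * P < c + 12 * P" for t k
  proof (cases "k = 0")
    case False
    have d: "dep (odd t) (t, False) < dep (odd t) (t + k * P, False)"
      using False P_pos P_even by (auto simp: dep_def)
    have z: "(t, False) \<in> labels N s" "(t + k * P, False) \<in> labels N s" using in_N t by auto
    have "image_line (odd t) (t, False) = image_line (odd t) (t + k * P, False)"
      using const[of t k] t by (simp add: a_def)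
    from index_image_le[OF dep_image_less(2)[OF z same_line_periods d this]]
    show ?thesis by (simp add: \<epsilon>_def idx_def)
  qed simp
  \<comment> \<open>Each period moves the image depth by at least 1 in the direction of the
    orientation. Depths of a single time differ by at most 7, so after eight periods the image time
    itself has moved that way.\<close>
  have grow: "0 < orientation b (t, False) * (idx (t + 8 * P) - idx t)"
    if il: "\<And>k. k \<le> 8 \<Longrightarrow> image_line b (t + k * P, False) = image_line b (t, False)" "t + 8 * P < c + 12 * P"
    for b t
  proof -
    let ?o = "orientation b (t, False)"
    have *: "orientation b (t + k * P, False) = ?o \<and>
        ?o * dep b (f (t, False)) + int k \<le> ?o * dep b (f (t + k * P, False))" if "k \<le> 8" for k
      using that
    proof (induction k)
      case (Suc k)
      have e: "Suc k * P = k * P + P" by simp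
      have "Suc k * P \<le> 8 * P" using Suc.prems by (rule mult_le_mono1)
      then have "t + k * P < c + 12 * P" "t + Suc k * P < c + 12 * P"
        using il(2) unfolding e by linarith+
      then have z: "(t + k * P, False) \<in> labels N s" "(t + Suc k * P, False) \<in> labels N s"
        using in_N by blast+
      have d: "dep b (t + k * P, False) < dep b (t + Suc k * P, False)"
        using P_pos P_even by (auto simp: dep_def)
      have sl: "same_line b (t + k * P, False) (t + Suc k * P, False)"
        using same_line_periods[of b "t + k * P" False 1 False] by (simp add: algebra_simps)
      have "image_line b (t + k * P, False) = image_line b (t + Suc k * P, False)"
        using il(1)[of k] il(1)[of "Suc k"] Suc.prems by simp
      from dep_image_less[OF z sl d this] show ?case using Suc by simp
    qed simp
    have "?o * dep b (f (t, False)) + 8 \<le> ?o * dep b (f (t + 8 * P, False))" using *[of 8] by simp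
    then show ?thesis
      using orientation_sign[of b "(t, False)"] dep_bounds(1)[of "f (t, False)" b] dep_bounds(2)[of b "f (t, False)"]
        dep_bounds(1)[of "f (t + 8 * P, False)" b] dep_bounds(2)[of b "f (t + 8 * P, False)"]
      by (auto simp: idx_def)
  qed
  \<comment> \<open>The point of time t + 1 lies on the lines shared with times t and t + 2. Along
    either line, the orientation is the sign of the change in the same image time over eight
    periods, so the two orientations agree.\<close>
  have \<epsilon>_step: "\<epsilon> (Suc t) = \<epsilon> t" if t: "a \<le> t" "t < c + 2 * P" for t
  proof -
    have "0 < \<epsilon> (Suc t) * (idx (Suc t + 8 * P) - idx (Suc t))"
      unfolding \<epsilon>_def
    proof (rule grow)
      fix k :: nat assume "k \<le> 8"
      then have "k * P \<le> 8 * P" by simp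
      then have "a0 \<le> Suc t" "Suc t + k * P < c + 12 * P"
        using t P_ge_2 unfolding a_def by linarith+
      then show "image_line (odd (Suc t)) (Suc t + k * P, False) = image_line (odd (Suc t)) (Suc t, False)"
        by (rule const)
    qed (use t P_ge_2 in auto)
    moreover have "0 < \<epsilon> t * (idx (Suc t + 8 * P) - idx (Suc t))"
      unfolding step(2)[symmetric]
    proof (subst step(2)[symmetric])
      show "a \<le> t" "Suc t < c + 12 * P" using t P_pos by auto
      show "0 < orientation (odd t) (Suc t, False) * (idx (Suc t + 8 * P) - idx (Suc t))"
      proof (rule grow)
        fix k :: nat assume "k \<le> 8"
        then have "k * P \<le> 8 * P" by simp
        then have k: "a0 \<le> t" "a \<le> t + k * P" "Suc (t + k * P) < c + 12 * P" "t + k * P < c + 12 * P"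
          using t P_ge_2 unfolding a_def by linarith+
        have "image_line (odd t) (Suc t + k * P, False) = image_line (odd t) (t + k * P, False)"
          using next_line[OF k(2,3)] P_even by simp
        also have "\<dots> = image_line (odd t) (t, False)" using k by (intro const)
        also have "\<dots> = image_line (odd t) (Suc t, False)" using next_line[of t] t P_ge_2 by simp
        finally show "image_line (odd t) (Suc t + k * P, False) = image_line (odd t) (Suc t, False)" .
      qed (use t P_ge_2 in auto)
    qed
    ultimately show ?thesis using \<epsilon>_sign[of t] \<epsilon>_sign[of "Suc t"] by auto
  qed
  have \<epsilon>_const: "\<epsilon> t = \<epsilon> a" if "a \<le> t" "t \<le> c + 2 * P" for t
    using that by (induction t rule: dec_induct) (auto simp: \<epsilon>_step)
  \<comment> \<open>This is image time, negated if the embedding reverses time, so that the speed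
    limit reads the same in both cases.\<close>
  define \<rho> where "\<rho> t = \<epsilon> a * idx t" for t
  have \<rho>_Suc: "\<rho> (Suc t) \<le> \<rho> t + 1" if "a \<le> t" "t \<le> c + 2 * P" for t
    using step(1)[of t] \<epsilon>_const[OF that] that P_ge_2 by (simp add: \<rho>_def)
  have \<rho>_diff: "\<rho> (t + d) \<le> \<rho> t + int d" if "a \<le> t" "t + d \<le> c + 2 * P" for t d
    using that
  proof (induction d)
    case (Suc d)
    then show ?case using \<rho>_Suc[of "t + d"] by simp
  qed simp
  have \<rho>_period: "\<rho> t \<le> \<rho> (t + k * P) + 1" if "a \<le> t" "t + k * P \<le> c + 2 * P" for t k
    using period[of t k] \<epsilon>_const[of t] that P_ge_2 by (simp add: \<rho>_def)
  have \<rho>_upper: "\<rho> t \<le> \<rho> a + int (t - a)" if "a \<le> t" "t \<le> c + 2 * P" for t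
    using \<rho>_diff[of a "t - a"] that by simp
  \<comment> \<open>Some a + kP lies after t by at most \<open>P\<close>. Its value is at least that
    of \<open>a\<close> minus 1, and the speed limit allows it to exceed the value at t by at most
    \<open>P\<close>.\<close>
  have \<rho>_lower: "\<rho> a - 1 - int P \<le> \<rho> t" if t: "a \<le> t" "t \<le> c + P" for t
  proof -
    define k where "k = (t - a) div P + 1"
    have k: "t - a < k * P" "k * P \<le> (t - a) + P"
      using dividend_less_div_times[OF P_pos, of "t - a"] div_mult_mod_eq[of "t - a" P]
      by (simp_all add: k_def algebra_simps)
    then have "\<rho> a \<le> \<rho> (a + k * P) + 1" using t by (intro \<rho>_period) auto
    also have "\<rho> (a + k * P) \<le> \<rho> t + int (a + k * P - t)"
      using \<rho>_diff[of t "a + k * P - t"] k t by simp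
    also have "a + k * P - t \<le> P" using k t by linarith
    then have "int (a + k * P - t) \<le> int P" by (simp only: of_nat_le_iff)
    finally show ?thesis by simp
  qed
  define X where "X = {z \<in> labels N s. a \<le> fst z \<and> fst z < c}"
  define lo where "lo = \<rho> a - 2 - int P"
  define hi where "hi = \<rho> a + int L + int P"
  define Y where "Y = {z \<in> labels N' s'. lo \<le> \<epsilon> a * int (fst z) \<and> \<epsilon> a * int (fst z) \<le> hi}"
  have "f z \<in> Y" if z: "z \<in> X" for z
  proof -
    obtain t q where tq: "z = (t, q)" by (cases z)
    have t: "a \<le> t" "t < c" and zl: "(t, q) \<in> labels N s" using z by (auto simp: X_def tq)
    have b1: "\<rho> a - 1 - int P \<le> \<rho> t" "\<rho> t \<le> \<rho> a + int (t - a)" "\<rho> (t + P) \<le> \<rho> a + int (t + P - a)"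
      using \<rho>_lower[of t] \<rho>_upper[of t] \<rho>_upper[of "t + P"] t by auto
    have "\<rho> t - 1 \<le> \<epsilon> a * int (fst (f (t, q))) \<and> \<epsilon> a * int (fst (f (t, q))) \<le> max (\<rho> t) (\<rho> (t + P) + 1)"
    proof (cases q)
      case False
      then show ?thesis by (simp add: \<rho>_def idx_def)
    next
      case True
      have z: "(t, False) \<in> labels N s" "(t + P, False) \<in> labels N s" using in_N t by auto
      have il: "image_line (odd t) (t + P, False) = image_line (odd t) (t, False)"
        using const[of t 1] t by (simp add: a_def)
      have sl: "same_line (odd t) (t, False) (t, q)" "same_line (odd t) (t, q) (t + P, False)"
        using same_line_periods[of "odd t" t _ 0] same_line_periods[of "odd t" t _ 1] by auto
      \<comment> \<open>The extra point is enclosed by the main points of times t and t + P, so its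
        image half line and the range of its image time follow from theirs.\<close>
      have d: "dep (odd t) (t, False) < dep (odd t) (t, q)" "dep (odd t) (t, q) < dep (odd t) (t + P, False)"
        using True P_ge_2 P_even by (auto simp: dep_def)
      have ilq: "image_line (odd t) (t, q) = image_line (odd t) (t, False)"
        using image_line_between[OF z(1) zl z(2) sl] d il by simp
      note 1 = dep_image_less[OF z(1) zl sl(1) d(1) ilq[symmetric]]
      note 2 = dep_image_less[OF zl z(2) sl(2) d(2) trans[OF ilq il[symmetric]]]
      have "orientation (odd t) (t, False) = \<epsilon> a" using \<epsilon>_const[of t] t by (simp add: \<epsilon>_def)
      then show ?thesis
        using index_image_le[OF 1(2)] index_image_le[OF 2(2)] 1(1) by (simp add: \<rho>_def idx_def)
    qed
    then show ?thesis
      using b1 t f_in[OF zl] by (auto simp: Y_def tq lo_def hi_def c_def max_def split: if_splits)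
  qed
  then have "card X \<le> card Y"
    using inj_f finite_labels by (intro card_inj_on_le[of f]) (auto simp: X_def Y_def inj_on_def)
  moreover have "card Y \<le> L + 2 * P + 4"
  proof -
    have window: "nat (hi - lo + 1) = L + 2 * P + 3" by (simp add: hi_def lo_def)
    have "card {z \<in> Y. \<not> snd z} \<le> L + 2 * P + 3"
      unfolding window[symmetric]
      by (rule card_int_window[where f = "\<lambda>z. \<epsilon> a * int (fst z)"])
        (use \<epsilon>_sign[of a] in \<open>auto simp: Y_def inj_on_def\<close>)
    moreover have "card {z \<in> Y. snd z} \<le> 1"
    proof -
      have eq: "x = y" if xy: "(x, True) \<in> Y" "(y, True) \<in> Y" "x \<le> y" for x y
      proof -
        have "int (y - x) \<le> hi - lo" using xy \<epsilon>_sign[of a] by (auto simp: Y_def)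
        then have "y - x \<le> L + 2 * P + 2" by (simp add: hi_def lo_def)
        moreover have "L + 6 * P \<le> s' * P" using mult_le_mono1[OF s', of P] by (simp add: L_def algebra_simps)
        ultimately have "y - x < s' * P" using P_ge_2 by linarith
        moreover have "s' * P dvd y - x"
          using xy by (auto simp: Y_def labels_def mod_eq_dvd_iff_nat[symmetric])
        ultimately show "x = y" using xy(3) by (meson diff_is_0_eq dual_order.antisym nat_dvd_not_less neq0_conv)
      qed
      have "z = z'" if "z \<in> Y" "snd z" "z' \<in> Y" "snd z'" for z z'
        using eq[of "fst z" "fst z'"] eq[of "fst z'" "fst z"] that
        by (metis nat_le_linear prod.collapse)
      moreover have "finite {z \<in> Y. snd z}" using finite_labels by (simp add: Y_def)
      ultimately show ?thesis by (simp add: card_le_Suc0_iff_eq)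
    qed
    moreover have "Y = {z \<in> Y. \<not> snd z} \<union> {z \<in> Y. snd z}" by auto
    then have "card Y \<le> card {z \<in> Y. \<not> snd z} + card {z \<in> Y. snd z}" by (metis card_Un_le)
    ultimately show ?thesis by simp
  qed
  moreover have "L + 2 * P + 5 \<le> card X"
  proof -
    let ?A = "(\<lambda>t. (t, False)) ` {a..<c}"
    \<comment> \<open>The summand 1 skips the period of length \<open>s * P\<close> that contains
      \<open>a\<close>, whose marked time may precede \<open>a\<close>.\<close>
    let ?m = "\<lambda>j. tm + (a div (s * P) + 1 + j) * (s * P)"
    let ?B = "(\<lambda>j. (?m j, True)) ` {..<2 * P + 5}"
    have sP: "0 < s * P" using s P_pos by simp
    have "?A \<subseteq> X" using in_N by (auto simp: X_def)
    moreover have "?B \<subseteq> X"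
    proof
      fix z assume "z \<in> ?B"
      then obtain j where j: "j < 2 * P + 5" "z = (?m j, True)" by auto
      have div: "a div (s * P) * (s * P) \<le> a" "a < (a div (s * P) + 1) * (s * P)"
        using dividend_less_div_times[OF sP, of a] by (simp_all only: div_times_less_eq_dividend add_mult_distrib mult_1)
      have "(a div (s * P) + 1) * (s * P) \<le> (a div (s * P) + 1 + j) * (s * P)" by (intro mult_le_mono1) simp
      then have "a \<le> ?m j" using div(2) by linarith
      moreover have "1 * P \<le> s * P" using s by (intro mult_le_mono1) simp
      then have "tm < s * P" using tm(1) by linarith
      moreover have "(1 + j + 1) * (s * P) \<le> (2 * P + 6) * (s * P)" using j(1) by (intro mult_le_mono1) simp
      ultimately have "?m j < c" using div(1) unfolding c_def L_def by (simp add: algebra_simps)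
      moreover have "?m j mod (s * P) = tm"
        using \<open>tm < s * P\<close> by (simp only: mod_mult_self1 mod_less)
      ultimately show "z \<in> X" using \<open>a \<le> ?m j\<close> j(2) in_N[of "?m j"] by (simp add: X_def labels_def)
    qed
    ultimately have "card (?A \<union> ?B) \<le> card X"
      using finite_labels by (intro card_mono) (auto simp: X_def)
    moreover have "card (?A \<union> ?B) = card ?A + card ?B" by (intro card_Un_disjoint) auto
    moreover have "card ?A = L" by (simp add: card_image inj_on_def c_def)
    moreover have "card ?B = 2 * P + 5" using sP by (subst card_image) (auto simp: inj_on_def)
    ultimately show ?thesis by simp
  qed
  ultimately show False by simp
qed

end

end

section \<open>Cells of a spiral\<close>

lemma perm_of_image_in_class:
  assumes \<tau>: "\<tau> \<in> {1, - 1}" and C: "perm_class C" "generic T" "perm_of T \<in> C"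
    and g: "generic (\<phi> ` Z)" "inj_on \<phi> Z"
    and f: "\<And>z. z \<in> Z \<Longrightarrow> f z \<in> T"
    and x: "\<And>z z'. z \<in> Z \<Longrightarrow> z' \<in> Z \<Longrightarrow> fst (\<phi> z) < fst (\<phi> z') \<Longrightarrow> fst (f z) < fst (f z')"
    and y: "\<And>z z'. z \<in> Z \<Longrightarrow> z' \<in> Z \<Longrightarrow> \<tau> * snd (\<phi> z) < \<tau> * snd (\<phi> z') \<Longrightarrow>
      \<tau> * snd (f z) < \<tau> * snd (f z')"
  shows "perm_of (\<phi> ` Z) \<in> C"
proof (rule perm_of_mono_in_class[OF C g(1), where f = "\<lambda>p. f (inv_into Z \<phi> p)"])
  show "f (inv_into Z \<phi> p) \<in> T" if "p \<in> \<phi> ` Z" for p using that f by (simp add: inv_into_into)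
  fix p q assume "p \<in> \<phi> ` Z" "q \<in> \<phi> ` Z"
  then obtain z z' where z: "z \<in> Z" "z' \<in> Z" "p = \<phi> z" "q = \<phi> z'" by blast
  have inv: "inv_into Z \<phi> p = z" "inv_into Z \<phi> q = z'" using z g(2) by auto
  show "fst (f (inv_into Z \<phi> p)) < fst (f (inv_into Z \<phi> q))" if "fst p < fst q"
    using x[OF z(1,2)] that z(3,4) unfolding inv by simp
  show "snd (f (inv_into Z \<phi> p)) < snd (f (inv_into Z \<phi> q))" if "snd p < snd q"
    using y[OF z(1,2)] y[OF z(2,1)] that z(3,4) \<tau> unfolding inv by auto
qed

context spiral
begin

text \<open>This is the rank of a label in the pattern of its cell. If the walk stayed, the second
  label of the turning pair receives 2(t - 1) + 1, the level of the first, so that the pair occupies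
  one layer.\<close>

definition level :: "nat \<times> bool \<Rightarrow> int" where
  "level z = (if snd z then 2 * int (fst z) + 2
     else if 0 < fst z \<and> e (fst z - 1) = e (fst z) then 2 * int (fst z) - 1
     else 2 * int (fst z) + 1)"

lemma level_bounds: "2 * int (fst z) - 1 \<le> level z" "level z \<le> 2 * int (fst z) + 2" "0 < level z"
  by (auto simp: level_def)

text \<open>An extra point at the first step of a turning pair would be deeper than the second main
  point on one line and shallower on the other, in conflict with the layered pattern. The residue
  \<open>tm\<close> rules this out.\<close>

lemma marked_moves:
  assumes "(t, True) \<in> labels N s"
  shows "e t \<noteq> e (Suc t)"
proof -
  have "t mod (s * P) = tm" using assms by (simp add: labels_def)
  then have "t mod P = tm" using tm(1) by (metis mod_less mod_mult_right_eq mod_mod_cancel dvd_triv_right)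
  then have "t = tm + (t div P) * P" by (metis add.commute div_mult_mod_eq)
  then have "e t = e tm" "e (Suc t) = e (Suc tm)"
    using e_periods[of tm "t div P"] e_periods[of "Suc tm" "t div P"] by (metis, metis add_Suc)
  then show ?thesis using tm(2) by simp
qed

text \<open>Times at least two apart have disjoint ranges of depth, and consecutive times share a
  cell only in a turning pair. So row order and column order can disagree only inside such a pair,
  where the levels coincide.\<close>

lemma level_compare:
  assumes z: "z \<in> labels N s" "z' \<in> labels N s" "e (fst z) = e (fst z')" "fst z \<le> fst z'" "z \<noteq> z'"
  shows "(level z < level z' \<and> (\<forall>b. dep b z < dep b z')) \<or>
    (level z' < level z \<and> (\<forall>b. dep b z' < dep b z)) \<or>
    (level z = level z' \<and> fst z' = Suc (fst z) \<and> \<not> snd z \<and> \<not> snd z' \<and> e (fst z) = e (Suc (fst z)))"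
proof -
  obtain t q t' q' where eq: "z = (t, q)" "z' = (t', q')" by (metis prod.collapse)
  consider "t' = t" | "t' = Suc t" | "t + 2 \<le> t'" using z(4) eq by force
  then show ?thesis
  proof cases
    case 1
    then have "q \<noteq> q'" using z(5) eq by simp
    then show ?thesis using 1 by (auto simp: eq level_def dep_def)
  next
    case 2
    then have ee: "e t = e (Suc t)" using z(3) eq by simp
    then have "\<not> q" using marked_moves[of t N s] z(1) eq by (cases q) auto
    moreover have "\<not> (0 < t \<and> e (t - 1) = e t)" using turn[of "t - 1"] ee by (cases t) auto
    ultimately show ?thesis using 2 ee by (auto simp: eq level_def dep_def)
  next
    case 3
    have "level z < level z'" using level_bounds(2)[of z] level_bounds(1)[of z'] 3 eq by simp
    moreover have "dep b z < dep b z'" for b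
      using dep_bounds(2)[of b z] dep_bounds(1)[of z' b] 3 eq by simp
    ultimately show ?thesis by blast
  qed
qed

definition cell_labels :: "nat \<Rightarrow> nat \<Rightarrow> nat \<times> nat \<Rightarrow> (nat \<times> bool) set" where
  "cell_labels N s c = {z \<in> labels N s. e (fst z) = c}"

text \<open>The sign joins the points on the two sides of the centre into one sequence that runs
  through the cell along its diagonal.\<close>

definition slevel :: "nat \<times> bool \<Rightarrow> int" where
  "slevel z = sx (fst z) * level z"

lemma pos_cell_iff:
  assumes "z \<in> cell_labels N s c" "z' \<in> cell_labels N s c"
  shows "pos N True z < pos N True z' \<longleftrightarrow> sx (fst z) * dep True z < sx (fst z') * dep True z'"
    "\<tau> c * pos N False z < \<tau> c * pos N False z' \<longleftrightarrow>
      sx (fst z) * dep False z < sx (fst z') * dep False z'"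
proof -
  show "pos N True z < pos N True z' \<longleftrightarrow> sx (fst z) * dep True z < sx (fst z') * dep True z'"
    using assms by (simp add: cell_labels_def pos_def ix_def sg_def)
  show "\<tau> c * pos N False z < \<tau> c * pos N False z' \<longleftrightarrow>
      sx (fst z) * dep False z < sx (fst z') * dep False z'"
    using assms \<tau>_sign[of c] by (auto simp: cell_labels_def pos_def ix_def sg_def)
qed

lemma slevel_less:
  assumes z: "z \<in> cell_labels N s c" "z' \<in> cell_labels N s c" "slevel z < slevel z'"
  shows "sx (fst z) * dep b z < sx (fst z') * dep b z'"
proof -
  have lab: "z \<in> labels N s" "z' \<in> labels N s" "e (fst z) = e (fst z')"
    using z by (auto simp: cell_labels_def)
  have d: "0 < dep b z" "0 < dep b z'" using offset_bound(2) lab by auto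
  have ne: "z \<noteq> z'" using z(3) by auto
  show ?thesis
  proof (cases "sx (fst z) = sx (fst z')")
    case False
    then show ?thesis
      using sx_sign[of "fst z"] sx_sign[of "fst z'"] z(3) d level_bounds(3)[of z] level_bounds(3)[of z']
      by (auto simp: slevel_def)
  next
    case True
    have "(level z < level z' \<longrightarrow> dep b z < dep b z') \<and> (level z' < level z \<longrightarrow> dep b z' < dep b z)"
    proof (cases "fst z \<le> fst z'")
      case True
      then show ?thesis using level_compare[OF lab True ne] by force
    next
      case False
      then show ?thesis using level_compare[OF lab(2,1) lab(3)[symmetric] _ ne[symmetric]] by force
    qed
    then show ?thesis using True sx_sign[of "fst z'"] z(3) by (auto simp: slevel_def)
  qed
qed

lemma slevel_equal:
  assumes z: "z \<in> cell_labels N s c" "z' \<in> cell_labels N s c" "slevel z = slevel z'" "z \<noteq> z'"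
  shows "sx (fst z) = sx (fst z')" "even (fst z) \<noteq> even (fst z')" "\<not> snd z" "\<not> snd z'"
    "\<bar>int (fst z) - int (fst z')\<bar> = 1" "\<exists>t. e t = c \<and> e t = e (Suc t)"
proof -
  have lab: "z \<in> labels N s" "z' \<in> labels N s" "e (fst z) = e (fst z')" "e (fst z) = c"
    using z by (auto simp: cell_labels_def)
  show s: "sx (fst z) = sx (fst z')"
    using sx_sign[of "fst z"] sx_sign[of "fst z'"] z(3) level_bounds(3)[of z] level_bounds(3)[of z']
    by (auto simp: slevel_def)
  then have l: "level z = level z'" using z(3) sx_sign[of "fst z'"] by (auto simp: slevel_def)
  have "(fst z' = Suc (fst z) \<or> fst z = Suc (fst z')) \<and> \<not> snd z \<and> \<not> snd z' \<and> (\<exists>t. e t = c \<and> e t = e (Suc t))"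
  proof (cases "fst z \<le> fst z'")
    case True
    then show ?thesis using level_compare[OF lab(1-3) True z(4)] l lab(4) by auto
  next
    case False
    then show ?thesis
      using level_compare[OF lab(2,1) lab(3)[symmetric] _ z(4)[symmetric]] l lab(3,4) by auto
  qed
  then show "even (fst z) \<noteq> even (fst z')" "\<not> snd z" "\<not> snd z'" "\<bar>int (fst z) - int (fst z')\<bar> = 1"
    "\<exists>t. e t = c \<and> e t = e (Suc t)" by auto
qed

text \<open>Inside a turning pair the label of even time always has the smaller depth in the column and
  the larger depth in the row.\<close>

lemma perm_of_cell:
  assumes C: "perm_class C" "\<And>k. perm_of (monotone_points (\<tau> c) k) \<in> C"
    and pairs: "\<exists>t. e t = c \<and> e t = e (Suc t) \<Longrightarrow> (\<And>k. perm_of (layered_points (\<tau> c) k) \<in> C)"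
  shows "perm_of (point N ` cell_labels N s c) \<in> C"
proof -
  let ?Z = "cell_labels N s c"
  have sub: "?Z \<subseteq> labels N s" by (auto simp: cell_labels_def)
  have g: "generic (point N ` ?Z)" "inj_on (point N) ?Z"
    using generic_subset[OF generic_points image_mono[OF sub]] inj_on_subset[OF inj_point sub] .
  have bound: "\<bar>slevel z\<bar> \<le> int (2 * N + 2)" if "z \<in> ?Z" for z
  proof -
    have "fst z < N" using that by (auto simp: cell_labels_def labels_def)
    then show ?thesis using level_bounds(2,3)[of z] sx_sign[of "fst z"] by (auto simp: slevel_def)
  qed
  show ?thesis
  proof (cases "\<exists>t. e t = c \<and> e t = e (Suc t)")
    case False
    show ?thesis
    proof (rule perm_of_image_in_class[OF \<tau>_sign[of c] C(1) generic_monotone_points[OF \<tau>_sign] C(2) g,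
          where f = "\<lambda>z. (slevel z, \<tau> c * slevel z)"])
      fix z assume z: "z \<in> ?Z"
      show "(slevel z, \<tau> c * slevel z) \<in> monotone_points (\<tau> c) (2 * N + 2)"
        using bound[OF z] unfolding monotone_points_def by (intro image_eqI[of _ _ "slevel z"]) auto
      fix z' assume z': "z' \<in> ?Z"
      have less: "slevel z < slevel z'" if "sx (fst z) * dep b z < sx (fst z') * dep b z'" for b
      proof (rule ccontr)
        assume "\<not> slevel z < slevel z'"
        then consider "slevel z' < slevel z" | "slevel z = slevel z'" by linarith
        then show False
        proof cases
          case 1
          then show ?thesis using slevel_less[OF z' z, of b] that by simp
        next
          case 2
          then have "z = z'" using slevel_equal(6)[OF z z'] False by blast
          then show ?thesis using that by simp
        qed
      qed
      show "fst (slevel z, \<tau> c * slevel z) < fst (slevel z', \<tau> c * slevel z')"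
        if "fst (point N z) < fst (point N z')"
        using less[of True] that pos_cell_iff(1)[OF z z'] by (simp add: point_def)
      show "\<tau> c * snd (slevel z, \<tau> c * slevel z) < \<tau> c * snd (slevel z', \<tau> c * slevel z')"
        if "\<tau> c * snd (point N z) < \<tau> c * snd (point N z')"
        using less[of False] that pos_cell_iff(2)[OF z z'] \<tau>_sign[of c] by (auto simp: point_def)
    qed
  next
    case True
    \<comment> \<open>In a layer, 0 marks the left point and 1 the right one. For
      \<open>sx = 1\<close> the left point is the one of even time, which has the smaller column
      depth; for \<open>sx = - 1\<close> left and right are exchanged.\<close>
    define \<beta> :: "nat \<times> bool \<Rightarrow> int" where "\<beta> z = (if even (fst z) = (sx (fst z) = 1) then 0 else 1)" for z
    let ?f = "\<lambda>z. (2 * slevel z + \<beta> z, \<tau> c * (2 * slevel z + 1 - \<beta> z))"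
    show ?thesis
    proof (rule perm_of_image_in_class[OF \<tau>_sign[of c] C(1) generic_layered_points[OF \<tau>_sign] pairs[OF True] g,
          where f = ?f])
      fix z assume z: "z \<in> ?Z"
      have "slevel z \<in> {- int (2 * N + 2)..int (2 * N + 2)}" using bound[OF z] by auto
      then show "?f z \<in> layered_points (\<tau> c) (2 * N + 2)"
        unfolding layered_points_def by (cases "\<beta> z = 0") (auto simp: \<beta>_def split: if_splits)
      fix z' assume z': "z' \<in> ?Z"
      have less: "slevel z < slevel z' \<or> slevel z = slevel z' \<and> z \<noteq> z' \<and> even (fst z) = (b = (sx (fst z) = 1))"
        if l: "sx (fst z) * dep b z < sx (fst z') * dep b z'" for b
      proof (cases "slevel z = slevel z'")
        case True
        have ne: "z \<noteq> z'" using l by auto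
        note p = slevel_equal[OF z z' True ne]
        have "(dep b z < dep b z') = (sx (fst z) = 1)"
          using l p(1) sx_sign[of "fst z"] by auto
        moreover have "(dep b z < dep b z') = (even (fst z) = b)"
          using p(2-5) unfolding dep_def by auto
        ultimately show ?thesis using True ne by auto
      next
        case False
        then show ?thesis using slevel_less[OF z' z, of b] l by fastforce
      qed
      have \<beta>01: "\<beta> z = 0 \<or> \<beta> z = 1" for z by (simp add: \<beta>_def)
      have \<beta>eq: "\<beta> z' = 1 - \<beta> z" if "slevel z = slevel z'" "z \<noteq> z'"
        using slevel_equal(1,2)[OF z z' that] by (auto simp: \<beta>_def)
      show "fst (?f z) < fst (?f z')" if "fst (point N z) < fst (point N z')"
      proof -
        have l: "sx (fst z) * dep True z < sx (fst z') * dep True z'"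
          using that pos_cell_iff(1)[OF z z'] by (simp add: point_def)
        from less[OF l] show ?thesis
        proof
          assume "slevel z < slevel z'"
          then show ?thesis using \<beta>01[of z] \<beta>01[of z'] by auto
        next
          assume *: "slevel z = slevel z' \<and> z \<noteq> z' \<and> even (fst z) = (True = (sx (fst z) = 1))"
          then have "\<beta> z = 0" by (simp add: \<beta>_def)
          then show ?thesis using \<beta>eq * by simp
        qed
      qed
      show "\<tau> c * snd (?f z) < \<tau> c * snd (?f z')" if "\<tau> c * snd (point N z) < \<tau> c * snd (point N z')"
      proof -
        have l: "sx (fst z) * dep False z < sx (fst z') * dep False z'"
          using that pos_cell_iff(2)[OF z z'] by (simp add: point_def)
        have "2 * slevel z + 1 - \<beta> z < 2 * slevel z' + 1 - \<beta> z'"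
          using less[OF l]
        proof
          assume "slevel z < slevel z'"
          then show ?thesis using \<beta>01[of z] \<beta>01[of z'] by auto
        next
          assume *: "slevel z = slevel z' \<and> z \<noteq> z' \<and> even (fst z) = (False = (sx (fst z) = 1))"
          then have "\<beta> z = 1" by (auto simp: \<beta>_def)
          then show ?thesis using \<beta>eq * by simp
        qed
        then show ?thesis using \<tau>_sign[of c] by auto
      qed
    qed
  qed
qed

text \<open>The line index is recovered from a coordinate by division; the shift by half a width
  puts the centre of each line in the middle of its interval.\<close>

definition strip :: "nat \<Rightarrow> int \<Rightarrow> nat" where
  "strip N x = nat ((x + (4 * int N + 10)) div width N)"

lemma strip_pos:
  assumes "z \<in> labels N s"
  shows "strip N (pos N b z) = ix b (fst z)"
proof -
  have w: "0 < width N" by (simp add: width_def)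
  let ?d = "sg b (fst z) * dep b z + (4 * int N + 10)"
  have "0 \<le> ?d" "?d < width N" using offset_bound(1)[OF assms, of b] by (auto simp: width_def)
  then have "(width N * int (ix b (fst z)) + ?d) div width N = int (ix b (fst z))"
    using w by simp
  then show ?thesis by (simp add: strip_def pos_def add.assoc)
qed

lemma strip_mono: "x \<le> y \<Longrightarrow> strip N x \<le> strip N y"
  unfolding strip_def by (intro nat_mono zdiv_mono1) (auto simp: width_def)

lemma perm_of_points_in_Grid:
  assumes C: "\<And>t. perm_class (M (fst (e t)) (snd (e t)))"
      "\<And>t k. perm_of (monotone_points (\<tau> (e t)) k) \<in> M (fst (e t)) (snd (e t))"
    and pairs: "\<And>t k. e t = e (Suc t) \<Longrightarrow> perm_of (layered_points (\<tau> (e t)) k) \<in> M (fst (e t)) (snd (e t))"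
  shows "perm_of (point N ` labels N s) \<in> Grid m n M"
proof (rule perm_of_in_Grid[OF generic_points, where ci = "\<lambda>p. strip N (fst p)" and ri = "\<lambda>p. strip N (snd p)"])
  fix p assume "p \<in> point N ` labels N s"
  then show "strip N (fst p) < m" "strip N (snd p) < n"
    using e_bound by (auto simp: point_def strip_pos ix_def)
next
  fix p q :: "int \<times> int"
  show "fst p < fst q \<Longrightarrow> strip N (fst p) \<le> strip N (fst q)"
    "snd p < snd q \<Longrightarrow> strip N (snd p) \<le> strip N (snd q)" by (simp_all add: strip_mono)
next
  fix i j
  assume ne: "{p \<in> point N ` labels N s. strip N (fst p) = i \<and> strip N (snd p) = j} \<noteq> {}"
  have eq: "{p \<in> point N ` labels N s. strip N (fst p) = i \<and> strip N (snd p) = j} =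
      point N ` cell_labels N s (i, j)"
    by (auto simp: cell_labels_def point_def strip_pos ix_def prod_eq_iff)
  then obtain z where "z \<in> cell_labels N s (i, j)" using ne by auto
  then have t: "e (fst z) = (i, j)" by (simp add: cell_labels_def)
  show "perm_of {p \<in> point N ` labels N s. strip N (fst p) = i \<and> strip N (snd p) = j} \<in> M i j"
    unfolding eq
  proof (rule perm_of_cell)
    show "perm_class (M i j)" using C(1)[of "fst z"] t by simp
    show "perm_of (monotone_points (\<tau> (i, j)) k) \<in> M i j" for k using C(2)[of "fst z"] t by simp
    show "perm_of (layered_points (\<tau> (i, j)) k) \<in> M i j" if "\<exists>t. e t = (i, j) \<and> e t = e (Suc t)" for k
    proof -
      obtain u where "e u = (i, j)" "e u = e (Suc u)" using \<open>\<exists>t. _\<close> by blast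
      then show ?thesis using pairs[of u k] by simp
    qed
  qed
qed

text \<open>What matters about the target is the sparsity of its extra points; one spiral is thus
  avoided by all sufficiently sparse ones, however long they are.\<close>

lemma not_contained:
  assumes s: "0 < s" and s': "(2 * P + 6) * s + 6 \<le> s'"
    and N: "((4 * (m + n) * P + 1) * ((2 * P + 6) * s + 12) + 1) * P \<le> N"
  shows "\<not> perm_of (point N ` labels N s) \<preceq> perm_of (point N' ` labels N' s')"
proof
  assume "perm_of (point N ` labels N s) \<preceq> perm_of (point N' ` labels N' s')"
  then have "\<exists>g. g ` point N ` labels N s \<subseteq> point N' ` labels N' s' \<and>
      (\<forall>p \<in> point N ` labels N s. \<forall>q \<in> point N ` labels N s.
        (fst p < fst q \<longrightarrow> fst (g p) < fst (g q)) \<and> (snd p < snd q \<longrightarrow> snd (g p) < snd (g q)))"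
    unfolding perm_of_contained_iff[OF generic_points] embeds_perm_of_iff[OF generic_points] .
  then obtain g where g: "g ` point N ` labels N s \<subseteq> point N' ` labels N' s'"
    "\<forall>p \<in> point N ` labels N s. \<forall>q \<in> point N ` labels N s.
        (fst p < fst q \<longrightarrow> fst (g p) < fst (g q)) \<and> (snd p < snd q \<longrightarrow> snd (g p) < snd (g q))"
    by (elim exE conjE)
  define f where "f z = inv_into (labels N' s') (point N') (g (point N z))" for z
  have f: "f z \<in> labels N' s' \<and> point N' (f z) = g (point N z)" if "z \<in> labels N s" for z
  proof -
    have "g (point N z) \<in> point N' ` labels N' s'" using g(1) that by blast
    then show ?thesis unfolding f_def by (simp add: inv_into_into f_inv_into_f)
  qed
  have pos_f: "pos N' True (f z) = fst (g (point N z))" "pos N' False (f z) = snd (g (point N z))"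
    if "z \<in> labels N s" for z
    using arg_cong[where f = fst, OF conjunct2[OF f[OF that]]]
      arg_cong[where f = snd, OF conjunct2[OF f[OF that]]] by (simp_all add: point_def)
  show False
  proof (rule no_order_preserving_map[OF _ _ s s' N])
    fix z assume z: "z \<in> labels N s"
    then show "f z \<in> labels N' s'" using f by blast
    fix b z' assume z': "z' \<in> labels N s" "pos N b z < pos N b z'"
    have "(fst (point N z) < fst (point N z') \<longrightarrow> fst (g (point N z)) < fst (g (point N z'))) \<and>
        (snd (point N z) < snd (point N z') \<longrightarrow> snd (g (point N z)) < snd (g (point N z')))"
      using g(2) z z'(1) by blast
    then show "pos N' b (f z) < pos N' b (f z')"
      using z'(2) pos_f[OF z] pos_f[OF z'(1)] by (cases b) (simp_all add: point_def)
  qed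
qed

lemma card_points: "N \<le> card (point N ` labels N s)" "card (point N ` labels N s) \<le> 2 * N"
proof -
  have c: "card (point N ` labels N s) = card (labels N s)" by (rule card_image[OF inj_point])
  have "card ((\<lambda>t. (t, False)) ` {..<N}) \<le> card (labels N s)"
    using finite_labels by (intro card_mono) (auto simp: labels_def)
  then show "N \<le> card (point N ` labels N s)" unfolding c by (simp add: card_image inj_on_def)
  have "card (labels N s) \<le> card ({..<N} \<times> (UNIV :: bool set))"
    by (intro card_mono) (auto simp: labels_def)
  then show "card (point N ` labels N s) \<le> 2 * N" unfolding c by (simp add: card_cartesian_product)
qed

lemma Grid_not_partially_well_ordered:
  assumes C: "\<And>t. perm_class (M (fst (e t)) (snd (e t)))"
      "\<And>t k. perm_of (monotone_points (\<tau> (e t)) k) \<in> M (fst (e t)) (snd (e t))"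
    and pairs: "\<And>t k. e t = e (Suc t) \<Longrightarrow> perm_of (layered_points (\<tau> (e t)) k) \<in> M (fst (e t)) (snd (e t))"
  shows "\<not> partially_well_ordered (Grid m n M)"
proof -
  \<comment> \<open>Spacings are the powers of \<open>E\<close>: since
    \<open>E * s = (2 * P + 6) * s + 6 * s\<close>, each spacing is sparse enough relative to all
    earlier ones. The lengths \<open>N\<close> meet the required lower bound and grow fast enough
    that a later permutation cannot lie in an earlier one.\<close>
  define E where "E = 2 * P + 12"
  define K where "K = 4 * (m + n) * P + 1"
  define W where "W i = (2 * P + 6) * E ^ i + 12" for i
  define N where "N i = (K * W i + 1) * P" for i
  define \<pi> where "\<pi> i = perm_of (point (N i) ` labels (N i) (E ^ i))" for i
  have E1: "1 \<le> E ^ i" for i by (simp add: E_def)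
  have N_step: "2 * N i < N (Suc i)" for i
  proof -
    define x where "x = (2 * P + 6) * E ^ i"
    have "x * 12 \<le> x * E" by (intro mult_le_mono2) (simp add: E_def)
    moreover have "6 * 1 \<le> x" using E1[of i] unfolding x_def by (intro mult_le_mono) auto
    moreover have "W i = x + 12" "W (Suc i) = x * E + 12" by (simp_all add: W_def x_def)
    ultimately have "2 * W i + 2 \<le> W (Suc i)" by linarith
    then have "K * (2 * W i + 2) \<le> K * W (Suc i)" by (rule mult_le_mono2)
    moreover have "1 \<le> K" by (simp add: K_def)
    ultimately have "2 * (K * W i + 1) < K * W (Suc i) + 1" by (simp add: algebra_simps)
    then have "2 * (K * W i + 1) * P < (K * W (Suc i) + 1) * P" using P_pos by (rule mult_strict_right_mono)
    then show ?thesis by (simp add: N_def mult.assoc)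
  qed
  have len: "length (\<pi> i) < length (\<pi> j)" if "i < j" for i j
    using that
  proof (induction j)
    case (Suc j)
    have "length (\<pi> j) < length (\<pi> (Suc j))"
      using card_points(2)[of "N j" "E ^ j"] card_points(1)[of "N (Suc j)" "E ^ Suc j"] N_step[of j]
      by (simp add: \<pi>_def)
    then show ?case using Suc by (auto simp: less_Suc_eq)
  qed simp
  have nc: "\<not> \<pi> i \<preceq> \<pi> j" if "i \<noteq> j" for i j
  proof (cases "i < j")
    case True
    have "E ^ Suc i \<le> E ^ j" using True by (intro power_increasing) (auto simp: E_def)
    moreover have "E ^ Suc i = (2 * P + 6) * E ^ i + 6 * E ^ i" by (simp add: E_def algebra_simps)
    ultimately have "(2 * P + 6) * E ^ i + 6 \<le> E ^ j" using E1[of i] by linarith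
    moreover have "0 < E ^ i" using E1[of i] by linarith
    ultimately show ?thesis unfolding \<pi>_def
      by (intro not_contained) (simp_all add: N_def K_def W_def)
  next
    case False
    then show ?thesis using len[of j i] that contained_length[of "\<pi> i" "\<pi> j"] by fastforce
  qed
  have "inj \<pi>"
  proof (rule injI)
    fix i j assume "\<pi> i = \<pi> j"
    then show "i = j" using len[of i j] len[of j i] by (metis less_irrefl linorder_neqE_nat)
  qed
  then have "infinite (range \<pi>)" by (rule range_inj_infinite)
  moreover have "range \<pi> \<subseteq> Grid m n M"
    using perm_of_points_in_Grid[of M] C pairs by (auto simp: \<pi>_def)
  moreover have "antichain (range \<pi>)"
    unfolding antichain_def
  proof (intro ballI impI)
    fix \<alpha> \<beta> assume "\<alpha> \<in> range \<pi>" "\<beta> \<in> range \<pi>" "\<alpha> \<noteq> \<beta>"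
    then obtain i j where "\<alpha> = \<pi> i" "\<beta> = \<pi> j" "i \<noteq> j" by blast
    then show "\<not> \<alpha> \<preceq> \<beta>" using nc by simp
  qed
  ultimately show ?thesis unfolding partially_well_ordered_def by blast
qed

end

section \<open>Walks in the cell graph\<close>

text \<open>The left points of all layers form the monotone pattern of the same sign.\<close>

lemma layered_class_monotone_points:
  assumes \<tau>: "\<tau> \<in> {1, - 1}" and C: "perm_class C" "perm_of (layered_points \<tau> k) \<in> C"
  shows "perm_of (monotone_points \<tau> k) \<in> C"
  unfolding monotone_points_def
proof (rule perm_of_image_in_class[OF \<tau> C(1) generic_layered_points[OF \<tau>] C(2),
      where f = "\<lambda>i. (2 * i, \<tau> * (2 * i + 1))"])
  show "generic ((\<lambda>i. (i, \<tau> * i)) ` {- int k..int k})"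
    using generic_monotone_points[OF \<tau>] unfolding monotone_points_def .
qed (use \<tau> in \<open>auto simp: layered_points_def inj_on_def\<close>)

text \<open>A cell where the walk both stays and passes needs one sign for both patterns, since its
  points follow a single diagonal. For a class that is not monotone griddable the sign is taken from
  the layered pattern, which contains the monotone one.\<close>

lemma class_signs:
  assumes "gridding_matrix m n M"
  shows "\<exists>\<tau>. \<forall>c. \<tau> c \<in> {1, - 1 :: int} \<and> (c \<in> cells m n M \<longrightarrow>
    (\<forall>k. perm_of (monotone_points (\<tau> c) k) \<in> M (fst c) (snd c)) \<and>
    (\<not> monotone_griddable (M (fst c) (snd c)) \<longrightarrow>
      (\<forall>k. perm_of (layered_points (\<tau> c) k) \<in> M (fst c) (snd c))))"
proof (rule choice, rule allI)
  fix c
  show "\<exists>t. t \<in> {1, - 1 :: int} \<and> (c \<in> cells m n M \<longrightarrow>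
    (\<forall>k. perm_of (monotone_points t k) \<in> M (fst c) (snd c)) \<and>
    (\<not> monotone_griddable (M (fst c) (snd c)) \<longrightarrow>
      (\<forall>k. perm_of (layered_points t k) \<in> M (fst c) (snd c))))"
  proof (cases "c \<in> cells m n M")
    case True
    then have "fst c < m" "snd c < n" "M (fst c) (snd c) \<noteq> {}" by (auto simp: cells_def)
    then have C: "perm_class (M (fst c) (snd c))" "infinite (M (fst c) (snd c))"
      using assms unfolding gridding_matrix_def by blast+
    show ?thesis
    proof (cases "monotone_griddable (M (fst c) (snd c))")
      case True
      then show ?thesis using infinite_class_monotone_points[OF C] by blast
    next
      case False
      then obtain t where "t \<in> {1, - 1}" "\<forall>k. perm_of (layered_points t k) \<in> M (fst c) (snd c)"
        using not_monotone_griddable_layered_points[OF C(1)] by blast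
      then show ?thesis using layered_class_monotone_points[OF _ C(1)] by blast
    qed
  next
    case False
    then show ?thesis by blast
  qed
qed

text \<open>The half lines used by the walk are carried along by the signs of the cells. There are
  finitely many combinations of cells and signs, so one recurs, and the part of the walk between two
  occurrences closes up to a spiral.\<close>

lemma walk_not_partially_well_ordered:
  assumes M: "gridding_matrix m n M"
    and w: "\<And>t. w t \<in> cells m n M"
    and row: "\<And>t. even t \<Longrightarrow> snd (w (Suc t)) = snd (w t)"
    and col: "\<And>t. odd t \<Longrightarrow> fst (w (Suc t)) = fst (w t)"
    and pause: "\<And>t. w t = w (Suc t) \<Longrightarrow>
      \<not> monotone_griddable (M (fst (w t)) (snd (w t))) \<and> w (Suc t) \<noteq> w (Suc (Suc t))"
  shows "\<not> partially_well_ordered (Grid m n M)"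
proof -
  obtain \<tau> where \<tau>0: "\<forall>c. \<tau> c \<in> {1, - 1 :: int} \<and> (c \<in> cells m n M \<longrightarrow>
    (\<forall>k. perm_of (monotone_points (\<tau> c) k) \<in> M (fst c) (snd c)) \<and>
    (\<not> monotone_griddable (M (fst c) (snd c)) \<longrightarrow>
      (\<forall>k. perm_of (layered_points (\<tau> c) k) \<in> M (fst c) (snd c))))"
    using class_signs[OF M] ..
  then have \<tau>: "\<tau> c \<in> {1, - 1}" for c by blast
  have \<tau>2: "\<tau> c * \<tau> c = 1" for c using \<tau>[of c] by auto
  \<comment> \<open>The row half at time t is \<open>sx t * \<tau> (w t)\<close>; multiplication by
    the signs of both cells keeps it unchanged across a row step.\<close>
  define sx :: "nat \<Rightarrow> int" where
    "sx = rec_nat 1 (\<lambda>t x. if even t then x * \<tau> (w t) * \<tau> (w (Suc t)) else x)"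
  have sx_0: "sx 0 = 1" and sx_Suc: "sx (Suc t) = (if even t then sx t * \<tau> (w t) * \<tau> (w (Suc t)) else sx t)" for t
    by (simp_all add: sx_def)
  have sx: "sx t \<in> {1, - 1}" for t
  proof (induction t)
    case (Suc t)
    then show ?case using \<tau>[of "w t"] \<tau>[of "w (Suc t)"] by (auto simp: sx_Suc)
  qed (simp add: sx_0)
  \<comment> \<open>Two consecutive cells are recorded because the condition on stays looks two
    steps ahead and must survive the wrap; even times are used so that the parity of steps survives
    it too.\<close>
  let ?g = "\<lambda>k. (w (2 * k), w (Suc (2 * k)), sx (2 * k))"
  have "finite (cells m n M)"
    by (rule finite_subset[of _ "{..<m} \<times> {..<n}"]) (auto simp: cells_def)
  then have "finite (cells m n M \<times> cells m n M \<times> {1, - 1 :: int})" by simp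
  moreover have "range ?g \<subseteq> cells m n M \<times> cells m n M \<times> {1, - 1}" using w sx by auto
  ultimately have "finite (range ?g)" using finite_subset by blast
  then have "\<not> inj ?g" using finite_imageD infinite_UNIV_nat by blast
  then obtain k0 l0 where "?g k0 = ?g l0" "k0 \<noteq> l0" unfolding inj_def by blast
  then obtain k l where kl: "?g k = ?g l" "k < l" by (metis linorder_neqE_nat)
  define T where "T = 2 * k"
  define P where "P = 2 * (l - k)"
  have P: "0 < P" "even P" "even T" "2 * l = T + P" using kl(2) by (auto simp: P_def T_def)
  have wrap: "w (T + P) = w T" "w (Suc (T + P)) = w (Suc T)" "sx (T + P) = sx T"
    using kl(1) P(4) by (auto simp: T_def)
  define e where "e t = w (T + t mod P)" for t
  define s where "s t = sx (T + t mod P)" for t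
  define u where "u t = T + t mod P" for t
  have par: "even (u t) = even t" for t
    using P(2,3) by (simp add: u_def dvd_mod_iff)
  have u0: "e t = w (u t)" "s t = sx (u t)" for t by (simp_all add: e_def s_def u_def)
  have u1: "e (Suc t) = w (Suc (u t))" "s (Suc t) = sx (Suc (u t))"
    "e (Suc (Suc t)) = w (Suc (Suc (u t)))" for t
  proof -
    have *: "(u (Suc t) = Suc (u t)) \<or> (u (Suc t) = T \<and> Suc (u t) = T + P)" for t
      using mod_less_divisor[OF P(1), of t] by (auto simp: u_def mod_Suc)
    show "e (Suc t) = w (Suc (u t))" using *[of t] wrap unfolding u0 by auto
    show "s (Suc t) = sx (Suc (u t))" using *[of t] wrap unfolding u0 by auto
    have "w (u (Suc t')) = w (Suc (u t'))" for t' using *[of t'] wrap by auto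
    then have "e (Suc (Suc t)) = w (Suc (u (Suc t)))" unfolding u0 .
    also have "\<dots> = w (Suc (Suc (u t)))" using *[of t] wrap by auto
    finally show "e (Suc (Suc t)) = w (Suc (Suc (u t)))" .
  qed
  have turn_e: "e (Suc t) \<noteq> e (Suc (Suc t))" if "e t = e (Suc t)" for t
  proof -
    have "w (u t) = w (Suc (u t))" using that u0(1)[of t] u1(1)[of t] by simp
    from pause[OF this] show ?thesis unfolding u1(1)[of t] u1(3)[of t] by blast
  qed
  \<comment> \<open>Of two consecutive steps at most one is a stay, so step 0 or step 1
    moves.\<close>
  define tm where "tm = (if e 0 = e (Suc 0) then 1 else 0 :: nat)"
  have e_cell: "e t \<in> cells m n M" for t unfolding u0 by (rule w)
  interpret spiral e s \<tau> P tm m n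
  proof
    fix t :: nat and c :: "nat \<times> nat"
    show "0 < P" "even P" by fact+
    show "e (t + P) = e t" "s (t + P) = s t" by (simp_all add: e_def s_def)
    show "s t \<in> {1, - 1}" unfolding u0 by (rule sx)
    show "\<tau> c \<in> {1, - 1}" by (rule \<tau>)
    show "fst (e t) < m" "snd (e t) < n" using e_cell[of t] by (auto simp: cells_def)
    show "snd (e (Suc t)) = snd (e t) \<and> s (Suc t) * \<tau> (e (Suc t)) = s t * \<tau> (e t)" if "even t"
      using row[of "u t"] that \<tau>2[of "w (Suc (u t))"] by (simp add: u1(1,2)[of t] u0[of t] sx_Suc par mult.assoc)
    show "fst (e (Suc t)) = fst (e t) \<and> s (Suc t) = s t" if "odd t"
      using col[of "u t"] that by (simp add: u1(1,2)[of t] u0[of t] sx_Suc par)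
    show "e (Suc t) \<noteq> e (Suc (Suc t))" if "e t = e (Suc t)" using turn_e[OF that] .
    show "tm < P" using P(1,2) unfolding tm_def by (cases "P = 1") auto
    show "e tm \<noteq> e (Suc tm)" using turn_e[of 0] by (simp add: tm_def)
  qed
  show ?thesis
  proof (rule Grid_not_partially_well_ordered)
    fix t k
    show "perm_class (M (fst (e t)) (snd (e t)))"
      using e_cell[of t] M by (auto simp: gridding_matrix_def cells_def)
    show "perm_of (monotone_points (\<tau> (e t)) k) \<in> M (fst (e t)) (snd (e t))"
      using \<tau>0 e_cell by blast
    show "perm_of (layered_points (\<tau> (e t)) k) \<in> M (fst (e t)) (snd (e t))" if "e t = e (Suc t)"
    proof -
      have "\<not> monotone_griddable (M (fst (e t)) (snd (e t)))"
        using pause[of "u t"] that u0(1)[of t] u1(1)[of t] by simp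
      then show ?thesis using \<tau>0 e_cell by blast
    qed
  qed
qed

text \<open>A walk that starts along a column starts along a row once its first step is
  dropped.\<close>

lemma alternating_walk_not_partially_well_ordered:
  assumes M: "gridding_matrix m n M"
    and w: "\<And>t. w t \<in> cells m n M"
    and row: "\<And>t. even t = d \<Longrightarrow> snd (w (Suc t)) = snd (w t)"
    and col: "\<And>t. even t \<noteq> d \<Longrightarrow> fst (w (Suc t)) = fst (w t)"
    and turn: "\<And>t. w t = w (Suc t) \<Longrightarrow>
      \<not> monotone_griddable (M (fst (w t)) (snd (w t))) \<and> w (Suc t) \<noteq> w (Suc (Suc t))"
  shows "\<not> partially_well_ordered (Grid m n M)"
proof (cases d)
  case True
  then show ?thesis
    using walk_not_partially_well_ordered[of m n M w] M w row col turn by simp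
next
  case False
  show ?thesis
  proof (rule walk_not_partially_well_ordered[of m n M "\<lambda>t. w (Suc t)", OF M])
    fix t
    show "w (Suc t) \<in> cells m n M" by (rule w)
    show "snd (w (Suc (Suc t))) = snd (w (Suc t))" if "even t" using row[of "Suc t"] that False by simp
    show "fst (w (Suc (Suc t))) = fst (w (Suc t))" if "odd t" using col[of "Suc t"] that False by simp
    show "\<not> monotone_griddable (M (fst (w (Suc t))) (snd (w (Suc t)))) \<and>
        w (Suc (Suc t)) \<noteq> w (Suc (Suc (Suc t)))" if "w (Suc t) = w (Suc (Suc t))"
      using turn[of "Suc t"] that by simp
  qed
qed

text \<open>Take a shortest path in the relation of sharing a row or column: two successive steps in
  the same direction could be merged, so directions alternate. Walk it back and forth with a stay at
  each end. A stay counts as a step of either direction, and it makes the return along each edge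
  happen at a time of the same parity as the way out.\<close>

lemma nonmonotone_pair_not_partially_well_ordered:
  assumes M: "gridding_matrix m n M"
    and uv: "u \<noteq> v" "(adjacent m n M)\<^sup>*\<^sup>* x u" "(adjacent m n M)\<^sup>*\<^sup>* x v" "x \<in> cells m n M"
    and nm: "\<not> monotone_griddable (M (fst u) (snd u))" "\<not> monotone_griddable (M (fst v) (snd v))"
  shows "\<not> partially_well_ordered (Grid m n M)"
proof -
  define R where "R = {(c, c'). c \<in> cells m n M \<and> c' \<in> cells m n M \<and> (fst c = fst c' \<or> snd c = snd c')}"
  have symR: "sym R" by (auto simp: R_def sym_def)
  have adj: "(x, y) \<in> R\<^sup>*" if "(adjacent m n M)\<^sup>*\<^sup>* x y" for y
    using that
  proof (induction rule: rtranclp_induct)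
    case (step y z)
    then have "(y, z) \<in> R" by (auto simp: adjacent_def R_def)
    then show ?case using step by (meson rtrancl.rtrancl_into_rtrancl)
  qed simp
  have "(u, x) \<in> R\<^sup>*" using adj[OF uv(2)] sym_rtrancl[OF symR] by (meson symD)
  then have "(u, v) \<in> R\<^sup>*" using adj[OF uv(3)] by (meson rtrancl_trans)
  then have ex: "\<exists>h. (u, v) \<in> R ^^ h" by (simp add: rtrancl_power)
  define h where "h = (LEAST h. (u, v) \<in> R ^^ h)"
  have h: "(u, v) \<in> R ^^ h" unfolding h_def using ex by (metis LeastI)
  have least: "(u, v) \<notin> R ^^ k" if "k < h" for k using that unfolding h_def by (rule not_less_Least)
  have h0: "0 < h" using h uv(1) by (cases h) auto
  obtain f where f: "f 0 = u" "f h = v" "\<And>i. i < h \<Longrightarrow> (f i, f (Suc i)) \<in> R"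
    using h unfolding relpow_fun_conv by blast
  have shortcut: False if ij: "i < j" "j \<le> h" "l < j - i" "(f i, f j) \<in> R ^^ l" for i j l
  proof -
    have "(u, f i) \<in> R ^^ i" unfolding relpow_fun_conv using f ij by (intro exI[of _ f]) auto
    moreover have "(f j, v) \<in> R ^^ (h - j)"
      unfolding relpow_fun_conv using f ij by (intro exI[of _ "\<lambda>k. f (j + k)"]) auto
    ultimately have "(u, v) \<in> R ^^ (i + (l + (h - j)))"
      using ij(4) by (auto simp: relpow_add)
    moreover have "i + (l + (h - j)) < h" using ij by linarith
    ultimately show False using least by blast
  qed
  have f_ne: "f i \<noteq> f (Suc i)" if "i < h" for i
    using shortcut[of i "Suc i" 0] that by auto
  have f_cells: "f i \<in> cells m n M" if "i \<le> h" for i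
    using f(3)[of i] f(3)[of "i - 1"] h0 that by (cases "i = h") (auto simp: R_def)
  define D where "D i = (snd (f i) = snd (f (Suc i)))" for i
  have D_col: "fst (f i) = fst (f (Suc i))" if "i < h" "\<not> D i" for i
    using f(3)[OF that(1)] that(2) by (auto simp: R_def D_def)
  have D_alt: "D (Suc i) \<noteq> D i" if "Suc i < h" for i
  proof
    assume "D (Suc i) = D i"
    then have "fst (f i) = fst (f (Suc (Suc i))) \<or> snd (f i) = snd (f (Suc (Suc i)))"
      using D_col[of i] D_col[of "Suc i"] that by (auto simp: D_def)
    then have "(f i, f (Suc (Suc i))) \<in> R ^^ 1" using f_cells that by (auto simp: R_def)
    then show False using shortcut[of i "Suc (Suc i)" 1] that by simp
  qed
  have D_par: "D i = (D 0 = even i)" if "i < h" for i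
    using that by (induction i) (use D_alt in auto)
  \<comment> \<open>One round visits \<open>f 0\<close>, ..., \<open>f h\<close>,
    \<open>f h\<close>, ..., \<open>f 0\<close>, hence the period \<open>2 * h + 2\<close> with both
    ends repeated.\<close>
  define b where "b r = (if r \<le> h then r else 2 * h + 1 - r)" for r
  define w where "w t = f (b (t mod (2 * h + 2)))" for t
  have bh: "b r \<le> h" if "r < 2 * h + 2" for r using that by (auto simp: b_def)
  have b_step: "(\<exists>i < h. (b (t mod (2 * h + 2)) = i \<and> b (Suc t mod (2 * h + 2)) = Suc i \<or>
        b (t mod (2 * h + 2)) = Suc i \<and> b (Suc t mod (2 * h + 2)) = i) \<and> even i = even t) \<or>
      (b (t mod (2 * h + 2)) = b (Suc t mod (2 * h + 2)) \<and> b (t mod (2 * h + 2)) \<in> {0, h} \<and>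
       b (Suc (Suc t) mod (2 * h + 2)) \<noteq> b (Suc t mod (2 * h + 2)) \<and> b (Suc (Suc t) mod (2 * h + 2)) \<le> h \<and>
       (b (Suc (Suc t) mod (2 * h + 2)) = Suc (b (Suc t mod (2 * h + 2))) \<or>
        Suc (b (Suc (Suc t) mod (2 * h + 2))) = b (Suc t mod (2 * h + 2))))" for t
  proof -
    define r where "r = t mod (2 * h + 2)"
    have r: "r < 2 * h + 2" by (simp add: r_def)
    have par: "even r = even t" unfolding r_def by (simp add: dvd_mod_iff)
    have S: "Suc t mod (2 * h + 2) = (if r = 2 * h + 1 then 0 else Suc r)"
      unfolding r_def by (simp add: mod_Suc)
    have SS: "Suc (Suc t) mod (2 * h + 2) = (if r = 2 * h + 1 then 1 else if r = 2 * h then 0 else Suc (Suc r))"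
      unfolding mod_Suc[of "Suc t"] S using h0 r by auto
    consider "r < h" | "r = h" | "h < r" "r < 2 * h + 1" | "r = 2 * h + 1" using r by linarith
    then show ?thesis
    proof cases
      case 1
      then show ?thesis unfolding S r_def[symmetric]
        by (intro disjI1 exI[of _ r]) (auto simp: b_def par)
    next
      case 2
      then show ?thesis unfolding S SS r_def[symmetric] using h0 by (intro disjI2) (auto simp: b_def)
    next
      case 3
      then have "even (2 * h - r) = even t" using par by auto
      then show ?thesis unfolding S r_def[symmetric] using 3
        by (intro disjI1 exI[of _ "2 * h - r"]) (auto simp: b_def)
    next
      case 4
      then show ?thesis unfolding S SS r_def[symmetric] using h0 by (intro disjI2) (auto simp: b_def)
    qed
  qed
  have w_step: "(\<exists>i < h. (w t = f i \<and> w (Suc t) = f (Suc i) \<or> w t = f (Suc i) \<and> w (Suc t) = f i) \<and>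
      even i = even t) \<or> w t = w (Suc t)" for t
    using b_step[of t] unfolding w_def by metis
  have f_row: "snd (f i) = snd (f (Suc i))" if "i < h" "even i = D 0" for i
  proof -
    have "D i" using D_par[OF that(1)] that(2) by blast
    then show ?thesis by (simp add: D_def)
  qed
  have f_col: "fst (f i) = fst (f (Suc i))" if "i < h" "even i \<noteq> D 0" for i
    using D_par[OF that(1)] D_col[OF that(1)] that(2) by blast
  show ?thesis
  proof (rule alternating_walk_not_partially_well_ordered[OF M, of w "D 0"])
    fix t
    show "w t \<in> cells m n M" unfolding w_def by (intro f_cells bh) simp
    show "snd (w (Suc t)) = snd (w t)" if "even t = D 0"
      using w_step[of t] f_row that by metis
    show "fst (w (Suc t)) = fst (w t)" if "even t \<noteq> D 0"
      using w_step[of t] f_col that by metis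
    show "\<not> monotone_griddable (M (fst (w t)) (snd (w t))) \<and> w (Suc t) \<noteq> w (Suc (Suc t))"
      if eq: "w t = w (Suc t)"
    proof -
      have *: "b (t mod (2 * h + 2)) \<in> {0, h} \<and>
       b (Suc (Suc t) mod (2 * h + 2)) \<noteq> b (Suc t mod (2 * h + 2)) \<and> b (Suc (Suc t) mod (2 * h + 2)) \<le> h \<and>
       (b (Suc (Suc t) mod (2 * h + 2)) = Suc (b (Suc t mod (2 * h + 2))) \<or>
        Suc (b (Suc (Suc t) mod (2 * h + 2))) = b (Suc t mod (2 * h + 2)))"
      proof -
        have "\<not> (\<exists>i < h. (b (t mod (2 * h + 2)) = i \<and> b (Suc t mod (2 * h + 2)) = Suc i \<or>
            b (t mod (2 * h + 2)) = Suc i \<and> b (Suc t mod (2 * h + 2)) = i) \<and> even i = even t)"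
        proof (intro notI, elim exE conjE)
          fix i assume "i < h" "b (t mod (2 * h + 2)) = i \<and> b (Suc t mod (2 * h + 2)) = Suc i \<or>
            b (t mod (2 * h + 2)) = Suc i \<and> b (Suc t mod (2 * h + 2)) = i"
          then show False using eq f_ne[of i] unfolding w_def by metis
        qed
        then show ?thesis using b_step[of t] by blast
      qed
      have "b (Suc t mod (2 * h + 2)) \<le> h" by (rule bh) simp
      then have "w (Suc t) \<noteq> w (Suc (Suc t))"
        using * f_ne[of "b (Suc t mod (2 * h + 2))"] f_ne[of "b (Suc (Suc t) mod (2 * h + 2))"]
        unfolding w_def by auto
      moreover have "w t = u \<or> w t = v" using * f unfolding w_def by auto
      ultimately show ?thesis using nm by auto
    qed
  qed
qed

text \<open>The first cell on the line has two distinct neighbours in the cycle, both after it; the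
  nearer one lies strictly between it and the farther one. So the emptiness between adjacent cells
  forces a cycle to turn.\<close>

lemma cyclic_line_impossible:
  fixes x :: "nat \<Rightarrow> nat"
  assumes r: "3 \<le> r" and period: "\<And>i. x (i + r) = x i"
    and inj: "\<And>i j. x i = x j \<Longrightarrow> i mod r = j mod r"
    and gap: "\<And>i j. \<not> (min (x i) (x (Suc i)) < x j \<and> x j < max (x i) (x (Suc i)))"
  shows False
proof -
  obtain i where i: "\<And>j. x i \<le> x j"
    using ex_has_least_nat[of "\<lambda>_. True" 0 x] by auto
  let ?p = "i + r - 1"
  have p: "Suc ?p = i + r" using r by simp
  have Suc_mod: "Suc a mod r \<noteq> a mod r" for a using r by (auto simp: mod_Suc)
  have "x (Suc i) \<noteq> x i"
  proof
    assume "x (Suc i) = x i"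
    then have "Suc i mod r = i mod r" by (rule inj)
    then show False using Suc_mod by blast
  qed
  moreover have "x ?p \<noteq> x i"
  proof
    assume "x ?p = x i"
    then have "?p mod r = i mod r" by (rule inj)
    also have "\<dots> = Suc ?p mod r" unfolding p by simp
    finally show False using Suc_mod by metis
  qed
  moreover have "x (Suc i) \<noteq> x ?p"
  proof
    assume "x (Suc i) = x ?p"
    then have "Suc i mod r = ?p mod r" by (rule inj)
    moreover have "?p = Suc i + (r - 2)" using r by linarith
    ultimately have "Suc i mod r = (Suc i + (r - 2)) mod r" by simp
    then have "r dvd r - 2" using r by (metis add_diff_cancel_left' mod_eq_dvd_iff_nat le_add1)
    then show False using r by (auto dest: dvd_imp_le)
  qed
  ultimately have lt: "x i < x (Suc i)" "x i < x ?p" "x (Suc i) \<noteq> x ?p"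
    using i[of "Suc i"] i[of ?p] by auto
  then show False
    using gap[of i ?p] gap[of ?p "Suc i"] period[of i] unfolding p by auto
qed

text \<open>Each run of cells along one line is contracted to its corners. Successive corners share
  a row or a column, and these alternate, so the corners form a walk that never stays.\<close>

lemma cycle_not_partially_well_ordered:
  assumes M: "gridding_matrix m n M" and cyc: "is_cycle m n M vs"
  shows "\<not> partially_well_ordered (Grid m n M)"
proof -
  define r where "r = length vs"
  have r: "3 \<le> r" and dist: "distinct vs" using cyc by (auto simp: is_cycle_def r_def)
  define v where "v i = vs ! (i mod r)" for i
  have v_eq: "v i = v j \<longleftrightarrow> i mod r = j mod r" for i j
    using dist r by (simp add: v_def nth_eq_iff_index_eq r_def[symmetric])
  have v_period: "v (i + k * r) = v i" for i k by (simp add: v_eq)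
  have adj: "adjacent m n M (v i) (v (Suc i))" for i
  proof (cases "Suc (i mod r) = r")
    case True
    then have "i mod r = r - 1" by simp
    moreover have "vs \<noteq> []" using r by (auto simp: r_def)
    ultimately have "v i = last vs" "v (Suc i) = hd vs"
      using True r by (auto simp: v_def r_def mod_Suc last_conv_nth hd_conv_nth)
    then show ?thesis using cyc by (simp add: is_cycle_def)
  next
    case False
    have "i mod r < r" using r by simp
    then have "Suc (i mod r) < r" using False by linarith
    then show ?thesis using cyc False by (simp add: is_cycle_def v_def r_def mod_Suc)
  qed
  then have v_cells: "v i \<in> cells m n M" for i by (simp add: adjacent_def)
  then have v_ne: "M (fst (v i)) (snd (v i)) \<noteq> {}" for i using v_cells[of i] by (cases "v i") (simp add: cells_def)
  define H where "H i = (snd (v i) = snd (v (Suc i)))" for i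
  have H_period: "H (i + k * r) = H i" for i k
    using v_period[of i k] v_period[of "Suc i" k] by (simp add: H_def)
  have colH: "fst (v i) = fst (v (Suc i))" if "\<not> H i" for i
    using adj[of i] that by (auto simp: adjacent_def H_def)
  have gap_row: "\<not> (min (fst (v i)) (fst (v (Suc i))) < k \<and> k < max (fst (v i)) (fst (v (Suc i)))) \<or>
      M k (snd (v i)) = {}" if "H i" for i k
    using adj[of i] that by (auto simp: adjacent_def H_def)
  have gap_col: "\<not> (min (snd (v i)) (snd (v (Suc i))) < k \<and> k < max (snd (v i)) (snd (v (Suc i)))) \<or>
      M (fst (v i)) k = {}" if "\<not> H i" for i k
    using adj[of i] that by (auto simp: adjacent_def H_def)
  have "\<exists>i. H i \<noteq> H (Suc i)"
  proof (rule ccontr)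
    assume "\<not> ?thesis"
    then have "H (Suc i) = H i" for i by simp
    then have Hc: "H i = H 0" for i by (induction i) auto
    show False
    proof (cases "H 0")
      case True
      have row: "snd (v i) = snd (v 0)" for i
        by (induction i) (use Hc True in \<open>auto simp: H_def\<close>)
      show False
      proof (rule cyclic_line_impossible[OF r, of "\<lambda>i. fst (v i)"])
        show "fst (v (i + r)) = fst (v i)" for i using v_period[of i 1] by simp
        show "i mod r = j mod r" if "fst (v i) = fst (v j)" for i j
          using that row[of i] row[of j] by (simp add: prod_eq_iff flip: v_eq)
        show "\<not> (min (fst (v i)) (fst (v (Suc i))) < fst (v j) \<and> fst (v j) < max (fst (v i)) (fst (v (Suc i))))" for i j
          using gap_row[of i "fst (v j)"] Hc[of i] True v_ne[of j] row[of i] row[of j] by auto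
      qed
    next
      case False
      have col: "fst (v i) = fst (v 0)" for i
        by (induction i) (use Hc False colH in auto)
      show False
      proof (rule cyclic_line_impossible[OF r, of "\<lambda>i. snd (v i)"])
        show "snd (v (i + r)) = snd (v i)" for i using v_period[of i 1] by simp
        show "i mod r = j mod r" if "snd (v i) = snd (v j)" for i j
          using that col[of i] col[of j] by (simp add: prod_eq_iff flip: v_eq)
        show "\<not> (min (snd (v i)) (snd (v (Suc i))) < snd (v j) \<and> snd (v j) < max (snd (v i)) (snd (v (Suc i))))" for i j
          using gap_col[of i "snd (v j)"] Hc[of i] False v_ne[of j] col[of i] col[of j] by auto
      qed
    qed
  qed
  then obtain i0 where i0: "H i0 \<noteq> H (Suc i0)" by blast
  define nxt where "nxt a = (LEAST b. a < b \<and> H b \<noteq> H a)" for a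
  define A where "A = rec_nat (Suc i0) (\<lambda>_. nxt)"
  have A0: "A 0 = Suc i0" and AS: "A (Suc k) = nxt (A k)" for k by (simp_all add: A_def)
  have nxt: "a < nxt a" "H (nxt a) \<noteq> H a" for a
  proof -
    obtain j where j: "H j \<noteq> H a" using i0 by blast
    have "(a + 1) * 1 \<le> (a + 1) * r" using r by (intro mult_le_mono2) simp
    then have "Suc a \<le> (a + 1) * r" by (simp only: mult_1_right Suc_eq_plus1)
    then have "a < j + (a + 1) * r" unfolding less_eq_Suc_le by (rule trans_le_add2)
    moreover have "H (j + (a + 1) * r) \<noteq> H a" using j H_period by blast
    ultimately have "a < j + (a + 1) * r \<and> H (j + (a + 1) * r) \<noteq> H a" by blast
    from LeastI[of "\<lambda>b. a < b \<and> H b \<noteq> H a", OF this] have "a < nxt a \<and> H (nxt a) \<noteq> H a"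
      unfolding nxt_def .
    then show "a < nxt a" "H (nxt a) \<noteq> H a" by auto
  qed
  have between: "H i = H a" if "a \<le> i" "i < nxt a" for a i
    using not_less_Least[of i "\<lambda>b. a < b \<and> H b \<noteq> H a"] that unfolding nxt_def by (cases "a = i") auto
  have corner: "0 < A k \<and> H (A k - 1) \<noteq> H (A k)" for k
  proof (induction k)
    case 0
    then show ?case using i0 by (simp add: A0)
  next
    case (Suc k)
    have "H (nxt (A k) - 1) = H (A k)" using nxt(1)[of "A k"] by (intro between) auto
    then show ?case using nxt[of "A k"] by (simp add: AS)
  qed
  \<comment> \<open>The step before corner \<open>A k\<close> has the other direction and recurs
    \<open>r\<close> steps later, so the next corner comes before a full turn. Therefore successive
    corners are different cells.\<close>
  have close: "A (Suc k) < A k + r" for k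
  proof -
    have "A k < A k - 1 + r" using corner[of k] r by linarith
    moreover have "H (A k - 1 + r) \<noteq> H (A k)" using corner[of k] H_period[of "A k - 1" 1] by simp
    ultimately have "A k < A k - 1 + r \<and> H (A k - 1 + r) \<noteq> H (A k)" by blast
    from Least_le[of "\<lambda>b. A k < b \<and> H b \<noteq> H (A k)", OF this] have "nxt (A k) \<le> A k - 1 + r"
      unfolding nxt_def .
    then show ?thesis using corner[of k] unfolding AS by linarith
  qed
  have H_alt: "H (A k) = (H (A 0) = even k)" for k
    by (induction k) (use nxt(2) in \<open>auto simp: AS\<close>)
  have along: "(H a \<longrightarrow> snd (v i) = snd (v a)) \<and> (\<not> H a \<longrightarrow> fst (v i) = fst (v a))"
    if "a \<le> i" "i \<le> nxt a" for a i
    using that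
  proof (induction i rule: dec_induct)
    case (step i)
    then have "H i = H a" by (intro between) auto
    then show ?case using step colH[of i] by (auto simp: H_def)
  qed simp
  show ?thesis
  proof (rule alternating_walk_not_partially_well_ordered[OF M, of "\<lambda>k. v (A k)" "H (A 0)"])
    fix k
    show "v (A k) \<in> cells m n M" by (rule v_cells)
    have al: "(H (A k) \<longrightarrow> snd (v (A (Suc k))) = snd (v (A k))) \<and>
        (\<not> H (A k) \<longrightarrow> fst (v (A (Suc k))) = fst (v (A k)))"
      unfolding AS using nxt(1)[of "A k"] by (intro along) auto
    show "snd (v (A (Suc k))) = snd (v (A k))" if "even k = H (A 0)" using al H_alt[of k] that by auto
    show "fst (v (A (Suc k))) = fst (v (A k))" if "even k \<noteq> H (A 0)" using al H_alt[of k] that by auto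
    have "v (A k) \<noteq> v (A (Suc k))"
    proof
      assume "v (A k) = v (A (Suc k))"
      then have "A k mod r = A (Suc k) mod r" by (simp add: v_eq)
      moreover have "A k < A (Suc k)" using nxt(1) by (simp add: AS)
      ultimately have "r dvd A (Suc k) - A k" by (metis less_imp_le mod_eq_dvd_iff_nat)
      then have "r \<le> A (Suc k) - A k" using \<open>A k < A (Suc k)\<close> by (intro dvd_imp_le) auto
      then show False using close[of k] \<open>A k < A (Suc k)\<close> by linarith
    qed
    then show "\<not> monotone_griddable (M (fst (v (A k))) (snd (v (A k)))) \<and> v (A (Suc k)) \<noteq> v (A (Suc (Suc k)))"
      if "v (A k) = v (A (Suc k))" using that by blast
  qed
qed

theorem theorem2:
  fixes m n :: nat and M :: class_matrix
  assumes "gridding_matrix m n M"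
    and "\<exists>K \<in> components m n M.
           (\<exists>vs. is_cycle m n M vs \<and> set vs \<subseteq> K) \<or>
           (\<exists>u \<in> K. \<exists>v \<in> K. u \<noteq> v \<and>
              \<not> monotone_griddable (M (fst u) (snd u)) \<and>
              \<not> monotone_griddable (M (fst v) (snd v)))"
  shows "\<not> partially_well_ordered (Grid m n M)"
proof -
  obtain K where K: "K \<in> components m n M" "(\<exists>vs. is_cycle m n M vs \<and> set vs \<subseteq> K) \<or>
           (\<exists>u \<in> K. \<exists>v \<in> K. u \<noteq> v \<and>
              \<not> monotone_griddable (M (fst u) (snd u)) \<and>
              \<not> monotone_griddable (M (fst v) (snd v)))" using assms(2) ..
  obtain x where x: "x \<in> cells m n M" "K = {v. (adjacent m n M)\<^sup>*\<^sup>* x v}"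
    using K(1) unfolding components_def by blast
  from K(2) show ?thesis
  proof
    assume "\<exists>vs. is_cycle m n M vs \<and> set vs \<subseteq> K"
    then show ?thesis using cycle_not_partially_well_ordered[OF assms(1)] by blast
  next
    assume "\<exists>u \<in> K. \<exists>v \<in> K. u \<noteq> v \<and>
              \<not> monotone_griddable (M (fst u) (snd u)) \<and>
              \<not> monotone_griddable (M (fst v) (snd v))"
    then obtain u v where "u \<in> K" "v \<in> K" "u \<noteq> v"
      "\<not> monotone_griddable (M (fst u) (snd u))" "\<not> monotone_griddable (M (fst v) (snd v))" by blast
    then show ?thesis
      using nonmonotone_pair_not_partially_well_ordered[OF assms(1), of u v x] x by blast
  qed
qed

end
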